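(* Let $z_2,\theta_1,\theta_2$ be non-zero real numbers. Let $\mathfrak{g}$ be the real vector space with basis $\{X,Y,Z,W\}$, equipped with the skew-symmetric bilinear bracket determined by $$[Z,X]=-2z_2W,\quad [Z,Y]=z_2Z,\quad [W,Y]=-z_2W,\quad [Y,X]=2z_2X+\theta_1Z+\theta_2W,\quad [W,Z]=[W,X]=0.$$ Then $\mathfrak{g}$ is a Lie algebra. Let $G$ be a Lie group with Lie algebra $\mathfrak{g}$, equipped with the left-invariant Riemannian metric for which $\{X,Y,Z,W\}$ is orthonormal. Let $\mathcal{V}$ be the left-invariant distribution on $G$ spanned by $Z,W$, let $\mathcal{H}$ be its orthogonal complement, spanned by $X,Y$, and let $J_1$ be the left-invariant almost Hermitian structure on $G$ given by $$J_1X=Y,\quad J_1Y=-X,\quad J_1Z=W,\quad J_1W=-Z.$$ Then the following hold: (1) $\mathcal{V}$ is integrable and the foliation $\mathcal{F}$ tangent to $\mathcal{V}$ is conformal with minimal leaves of codimension $2$; (2) the horizontal distribution $\mathcal{H}$ is not integrable, and the foliation $\mathcal{F}$ is not totally geodesic; (3) $J_1$ is integrable and $\mathcal{F}$ is holomorphic with respect to $J_1$; (4) the Hermitian structure $J_1$ is not Kähler; (5) the Riemannian manifold $G$ is not an Einstein manifold.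
   Context: Elements of $\mathfrak{g}$ are regarded as left-invariant vector fields on $G$, and $\nabla$ is the Levi-Civita connection of the Riemannian metric $g$. For an involutive distribution $\mathcal{V}$ with orthogonal complement $\mathcal{H}$, the symbols $\mathcal{V},\mathcal{H}$ also denote the orthogonal projections of the tangent bundle onto these subbundles. Define $$B^{\mathcal{V}}(U,V)=\tfrac12\mathcal{H}(\nabla_UV+\nabla_VU)\ (U,V\in\mathcal{V}),\qquad B^{\mathcal{H}}(E,F)=\tfrac12\mathcal{V}(\nabla_EF+\nabla_FE)\ (E,F\in\mathcal{H}).$$ The foliation $\mathcal{F}$ tangent to $\mathcal{V}$ is conformal if there is a vector field $V\in\mathcal{V}$ with $B^{\mathcal{H}}=g\otimes V$. It is minimal (has minimal leaves) if $\operatorname{trace}B^{\mathcal{V}}=0$, and it is totally geodesic if $B^{\mathcal{V}}=0$. The leaves of a conformal foliation are locally the fibres of horizontally conformal submersions. A conformal foliation $\mathcal{F}$ of codimension $2$ is holomorphic with respect to a Hermitian structure $J$ if locally its leaves are the fibres of a horizontally conformal submersion $\phi:U\to\mathbb{C}$ ($U$ open in $G$) satisfying $d\phi\circ J=i\,d\phi$. An almost Hermitian structure is integrable if its Nijenhuis tensor vanishes, in which case it is called a Hermitian structure. A Hermitian structure $J$ is Kähler if $\nabla J=0$. A Riemannian manifold is Einstein if its Ricci tensor is a constant multiple of the metric. *)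

theory Defs
  imports "HOL-Analysis.Analysis" "HOL-Library.Function_Algebras"
begin

text \<open>Pointwise vector space structure on function types; it is used for tangent vectors
  (functionals on functions) and for vector fields.\<close>

instantiation "fun" :: (type, real_vector) real_vector
begin

definition scaleR_fun :: "real \<Rightarrow> ('a \<Rightarrow> 'b) \<Rightarrow> 'a \<Rightarrow> 'b"
  where "scaleR_fun c f = (\<lambda>x. c *\<^sub>R f x)"

instance
  by standard (auto simp: scaleR_fun_def fun_eq_iff algebra_simps)

end


section \<open>Lie algebras\<close>

definition lie_algebra :: "('v::real_vector \<Rightarrow> 'v \<Rightarrow> 'v) \<Rightarrow> bool" where
  "lie_algebra br \<longleftrightarrow> bilinear br \<and> (\<forall>u. br u u = 0) \<and>
     (\<forall>u v w. br u (br v w) + br v (br w u) + br w (br u v) = 0)"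


section \<open>Smooth manifolds\<close>

primrec Ck_on :: "nat \<Rightarrow> 'a::real_normed_vector set \<Rightarrow> ('a \<Rightarrow> 'b::real_normed_vector) \<Rightarrow> bool" where
  "Ck_on 0 S f \<longleftrightarrow> continuous_on S f"
| "Ck_on (Suc k) S f \<longleftrightarrow> (\<forall>x\<in>S. f differentiable (at x)) \<and>
     (\<forall>w. Ck_on k S (\<lambda>x. frechet_derivative f (at x) w))"

text \<open>Only used for open sets.\<close>

definition Cinf_on :: "'a::real_normed_vector set \<Rightarrow> ('a \<Rightarrow> 'b::real_normed_vector) \<Rightarrow> bool" where
  "Cinf_on S f \<longleftrightarrow> (\<forall>k. Ck_on k S f)"

type_synonym ('m, 'e) atlas = "('m set \<times> ('m \<Rightarrow> 'e)) set"

definition smooth_atlas :: "('m::topological_space, 'e::euclidean_space) atlas \<Rightarrow> bool" where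
  "smooth_atlas A \<longleftrightarrow>
     (\<Union>(U, \<phi>)\<in>A. U) = UNIV \<and>
     (\<forall>(U, \<phi>)\<in>A. open U \<and> open (\<phi> ` U) \<and> homeomorphism U (\<phi> ` U) \<phi> (inv_into U \<phi>)) \<and>
     (\<forall>(U, \<phi>)\<in>A. \<forall>(V, \<psi>)\<in>A. Cinf_on (\<phi> ` (U \<inter> V)) (\<psi> \<circ> inv_into U \<phi>))"

definition prod_atlas :: "('m, 'e) atlas \<Rightarrow> ('n, 'f) atlas \<Rightarrow> ('m \<times> 'n, 'e \<times> 'f) atlas" where
  "prod_atlas A B = {(U \<times> V, map_prod \<phi> \<psi>) | U \<phi> V \<psi>. (U, \<phi>) \<in> A \<and> (V, \<psi>) \<in> B}"

definition smooth_map :: "('m::topological_space, 'e::euclidean_space) atlas \<Rightarrow>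
    ('n::topological_space, 'f::euclidean_space) atlas \<Rightarrow> ('m \<Rightarrow> 'n) \<Rightarrow> bool" where
  "smooth_map A B F \<longleftrightarrow> continuous_on UNIV F \<and>
     (\<forall>(U, \<phi>)\<in>A. \<forall>(V, \<psi>)\<in>B. Cinf_on (\<phi> ` (U \<inter> F -` V)) (\<psi> \<circ> F \<circ> inv_into U \<phi>))"

definition smooth_on :: "('m::topological_space, 'e::euclidean_space) atlas \<Rightarrow> 'm set \<Rightarrow>
    ('m \<Rightarrow> 'b::real_normed_vector) \<Rightarrow> bool" where
  "smooth_on A S f \<longleftrightarrow> open S \<and> (\<forall>(U, \<phi>)\<in>A. Cinf_on (\<phi> ` (U \<inter> S)) (f \<circ> inv_into U \<phi>))"

definition smooth_near :: "('m::topological_space, 'e::euclidean_space) atlas \<Rightarrow> 'm \<Rightarrow>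
    ('m \<Rightarrow> 'b::real_normed_vector) \<Rightarrow> bool" where
  "smooth_near A p f \<longleftrightarrow> (\<exists>S. p \<in> S \<and> smooth_on A S f)"


section \<open>Tangent vectors and vector fields\<close>

text \<open>A tangent vector at \<open>p\<close> is a directional derivative in a chart, acting on the functions that
  are smooth near \<open>p\<close>. On all other functions it is set to \<open>0\<close>, so that equality of functionals is
  equality of tangent vectors.\<close>

type_synonym 'm tvec = "('m \<Rightarrow> real) \<Rightarrow> real"
type_synonym 'm vfield = "'m \<Rightarrow> 'm tvec"
type_synonym 'm distribution = "'m \<Rightarrow> 'm tvec set"
type_synonym 'm metric = "'m \<Rightarrow> 'm tvec \<Rightarrow> 'm tvec \<Rightarrow> real"
type_synonym 'm connection = "'m vfield \<Rightarrow> 'm vfield \<Rightarrow> 'm vfield"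

definition chart_tvec :: "('m::topological_space, 'e::euclidean_space) atlas \<Rightarrow>
    'm set \<Rightarrow> ('m \<Rightarrow> 'e) \<Rightarrow> 'm \<Rightarrow> 'e \<Rightarrow> 'm tvec" where
  "chart_tvec A U \<phi> p w = (\<lambda>f. if smooth_near A p f
      then frechet_derivative (f \<circ> inv_into U \<phi>) (at (\<phi> p)) w else 0)"

definition tangent :: "('m::topological_space, 'e::euclidean_space) atlas \<Rightarrow> 'm distribution" where
  "tangent A p = {chart_tvec A U \<phi> p w | U \<phi> w. (U, \<phi>) \<in> A \<and> p \<in> U}"

definition smooth_vfield ::
    "('m::topological_space, 'e::euclidean_space) atlas \<Rightarrow> 'm vfield \<Rightarrow> bool" where
  "smooth_vfield A E \<longleftrightarrow> (\<forall>p. E p \<in> tangent A p) \<and>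
     (\<forall>S f. smooth_on A S f \<longrightarrow> smooth_on A S (\<lambda>p. E p f))"

definition fscale :: "('m \<Rightarrow> real) \<Rightarrow> 'm vfield \<Rightarrow> 'm vfield" where
  "fscale f E = (\<lambda>p. f p *\<^sub>R E p)"

definition lie_bracket :: "('m::topological_space, 'e::euclidean_space) atlas \<Rightarrow>
    'm vfield \<Rightarrow> 'm vfield \<Rightarrow> 'm vfield" where
  "lie_bracket A E F = (\<lambda>p f. if smooth_near A p f
      then E p (\<lambda>q. F q f) - F p (\<lambda>q. E q f) else 0)"

text \<open>The differential at \<open>p\<close> of a map \<open>F\<close> of the manifold to itself, and the differential of a map
  \<open>\<phi>\<close> into a Euclidean space.\<close>

definition push :: "('m::topological_space, 'e::euclidean_space) atlas \<Rightarrow>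
    ('m \<Rightarrow> 'm) \<Rightarrow> 'm \<Rightarrow> 'm tvec \<Rightarrow> 'm tvec" where
  "push A F p v = (\<lambda>f. if smooth_near A (F p) f then v (f \<circ> F) else 0)"

definition mdiff :: "('m \<Rightarrow> 'b::euclidean_space) \<Rightarrow> 'm tvec \<Rightarrow> 'b" where
  "mdiff \<phi> v = (\<Sum>b\<in>Basis. v (\<lambda>x. \<phi> x \<bullet> b) *\<^sub>R b)"


section \<open>Lie groups\<close>

definition lie_group :: "('g::{t2_space, second_countable_topology}, 'e::euclidean_space) atlas \<Rightarrow>
    ('g \<Rightarrow> 'g \<Rightarrow> 'g) \<Rightarrow> 'g \<Rightarrow> ('g \<Rightarrow> 'g) \<Rightarrow> bool" where
  "lie_group A mul e i \<longleftrightarrow> smooth_atlas A \<and> group mul e i \<and>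
     smooth_map (prod_atlas A A) A (\<lambda>(x, y). mul x y) \<and> smooth_map A A i"

definition left_invariant_vfields :: "('g::topological_space, 'e::euclidean_space) atlas \<Rightarrow>
    ('g \<Rightarrow> 'g \<Rightarrow> 'g) \<Rightarrow> 'g vfield set" where
  "left_invariant_vfields A mul =
     {E. smooth_vfield A E \<and> (\<forall>a p. E (mul a p) = push A (mul a) p (E p))}"

definition lie_algebra_of_group_iso :: "('g::topological_space, 'e::euclidean_space) atlas \<Rightarrow>
    ('g \<Rightarrow> 'g \<Rightarrow> 'g) \<Rightarrow> ('v::real_vector \<Rightarrow> 'v \<Rightarrow> 'v) \<Rightarrow> ('v \<Rightarrow> 'g vfield) \<Rightarrow> bool" where
  "lie_algebra_of_group_iso A mul br L \<longleftrightarrow> linear L \<and>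
     bij_betw L UNIV (left_invariant_vfields A mul) \<and>
     (\<forall>u v. L (br u v) = lie_bracket A (L u) (L v))"


section \<open>Riemannian metrics and the Levi-Civita connection\<close>

definition riemannian_metric ::
    "('m::topological_space, 'e::euclidean_space) atlas \<Rightarrow> 'm metric \<Rightarrow> bool" where
  "riemannian_metric A g \<longleftrightarrow>
     (\<forall>p. \<forall>u\<in>tangent A p. \<forall>v\<in>tangent A p. \<forall>w\<in>tangent A p. \<forall>c.
        g p (u + v) w = g p u w + g p v w \<and> g p (c *\<^sub>R u) w = c * g p u w) \<and>
     (\<forall>p. \<forall>u\<in>tangent A p. \<forall>v\<in>tangent A p. g p u v = g p v u) \<and>
     (\<forall>p. \<forall>u\<in>tangent A p. u \<noteq> 0 \<longrightarrow> g p u u > 0) \<and>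
     (\<forall>E F. smooth_vfield A E \<and> smooth_vfield A F \<longrightarrow> smooth_on A UNIV (\<lambda>p. g p (E p) (F p)))"

definition left_invariant_metric :: "('g::topological_space, 'e::euclidean_space) atlas \<Rightarrow>
    ('g \<Rightarrow> 'g \<Rightarrow> 'g) \<Rightarrow> 'g metric \<Rightarrow> bool" where
  "left_invariant_metric A mul g \<longleftrightarrow> (\<forall>a p. \<forall>u\<in>tangent A p. \<forall>v\<in>tangent A p.
     g (mul a p) (push A (mul a) p u) (push A (mul a) p v) = g p u v)"

definition orthonormal :: "('t \<Rightarrow> 't \<Rightarrow> real) \<Rightarrow> 't list \<Rightarrow> bool" where
  "orthonormal h vs \<longleftrightarrow>
     (\<forall>i<length vs. \<forall>j<length vs. h (vs ! i) (vs ! j) = (if i = j then 1 else 0))"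

definition orthonormal_basis ::
    "('t::real_vector \<Rightarrow> 't \<Rightarrow> real) \<Rightarrow> 't set \<Rightarrow> 't list \<Rightarrow> bool" where
  "orthonormal_basis h S vs \<longleftrightarrow> orthonormal h vs \<and> span (set vs) = S"

definition levi_civita :: "('m::topological_space, 'e::euclidean_space) atlas \<Rightarrow>
    'm metric \<Rightarrow> 'm connection \<Rightarrow> bool" where
  "levi_civita A g nabla \<longleftrightarrow>
     (\<forall>E F. smooth_vfield A E \<and> smooth_vfield A F \<longrightarrow>
        smooth_vfield A (nabla E F) \<and>
        nabla E F - nabla F E = lie_bracket A E F \<and>
        (\<forall>f. smooth_on A UNIV f \<longrightarrow>
           nabla (fscale f E) F = fscale f (nabla E F) \<and>
           nabla E (fscale f F) = fscale (\<lambda>p. E p f) F + fscale f (nabla E F)) \<and>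
        (\<forall>K. smooth_vfield A K \<longrightarrow>
           nabla (E + K) F = nabla E F + nabla K F \<and>
           nabla E (F + K) = nabla E F + nabla E K \<and>
           (\<forall>p. E p (\<lambda>q. g q (F q) (K q)) =
              g p (nabla E F p) (K p) + g p (F p) (nabla E K p))))"

definition curvature :: "('m::topological_space, 'e::euclidean_space) atlas \<Rightarrow> 'm connection \<Rightarrow>
    'm vfield \<Rightarrow> 'm vfield \<Rightarrow> 'm vfield \<Rightarrow> 'm vfield" where
  "curvature A nabla E F K =
     nabla E (nabla F K) - nabla F (nabla E K) - nabla (lie_bracket A E F) K"

text \<open>Trace at \<open>p\<close> of \<open>U \<mapsto> R(U, E)F\<close>, computed with fields \<open>Us\<close> that form an orthonormal basis at
  \<open>p\<close>.\<close>

definition ricci_frame :: "('m::topological_space, 'e::euclidean_space) atlas \<Rightarrow> 'm metric \<Rightarrow>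
    'm connection \<Rightarrow> 'm vfield list \<Rightarrow> 'm vfield \<Rightarrow> 'm vfield \<Rightarrow> 'm \<Rightarrow> real" where
  "ricci_frame A g nabla Us E F p = (\<Sum>U\<leftarrow>Us. g p (curvature A nabla U E F p) (U p))"

definition einstein :: "('m::topological_space, 'e::euclidean_space) atlas \<Rightarrow> 'm metric \<Rightarrow>
    'm connection \<Rightarrow> bool" where
  "einstein A g nabla \<longleftrightarrow> (\<exists>c. \<forall>E F Us p.
     smooth_vfield A E \<and> smooth_vfield A F \<and> (\<forall>U\<in>set Us. smooth_vfield A U) \<and>
     orthonormal_basis (g p) (tangent A p) (map (\<lambda>U. U p) Us) \<longrightarrow>
     ricci_frame A g nabla Us E F p = c * g p (E p) (F p))"


section \<open>Distributions and foliations\<close>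

definition sections :: "('m::topological_space, 'e::euclidean_space) atlas \<Rightarrow>
    'm distribution \<Rightarrow> 'm vfield set" where
  "sections A D = {E. smooth_vfield A E \<and> (\<forall>p. E p \<in> D p)}"

definition involutive ::
    "('m::topological_space, 'e::euclidean_space) atlas \<Rightarrow> 'm distribution \<Rightarrow> bool" where
  "involutive A D \<longleftrightarrow> (\<forall>E\<in>sections A D. \<forall>F\<in>sections A D. lie_bracket A E F \<in> sections A D)"

text \<open>There is a foliation tangent to \<open>D\<close>: locally \<open>D\<close> consists of the tangent spaces to the fibres of
  a submersion \<open>(f\<^sub>1, \<dots>, f\<^sub>k)\<close>.\<close>

definition integrable_distribution ::
    "('m::topological_space, 'e::euclidean_space) atlas \<Rightarrow> 'm distribution \<Rightarrow> bool" where
  "integrable_distribution A D \<longleftrightarrow> (\<forall>p. \<exists>U fs. p \<in> U \<and> (\<forall>f\<in>set fs. smooth_on A U f) \<and> open U \<and>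
     (\<forall>q\<in>U. (\<forall>c::nat \<Rightarrow> real. \<exists>v\<in>tangent A q. \<forall>i<length fs. v (fs ! i) = c i) \<and>
        D q = {v \<in> tangent A q. \<forall>f\<in>set fs. v f = 0}))"

definition has_codimension :: "('m::topological_space, 'e::euclidean_space) atlas \<Rightarrow>
    'm distribution \<Rightarrow> nat \<Rightarrow> bool" where
  "has_codimension A D k \<longleftrightarrow> (\<forall>p. D p \<subseteq> tangent A p \<and> subspace (D p) \<and>
     dim (tangent A p) = dim (D p) + k)"

definition ortho_complement :: "('m::topological_space, 'e::euclidean_space) atlas \<Rightarrow>
    'm metric \<Rightarrow> 'm distribution \<Rightarrow> 'm distribution" where
  "ortho_complement A g D p = {v \<in> tangent A p. \<forall>u\<in>D p. g p v u = 0}"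

definition ortho_proj :: "'m metric \<Rightarrow> 'm distribution \<Rightarrow> 'm \<Rightarrow> 'm tvec \<Rightarrow> 'm tvec" where
  "ortho_proj g D p v = (THE w. w \<in> D p \<and> (\<forall>u\<in>D p. g p (v - w) u = 0))"

text \<open>For sections \<open>E\<close>, \<open>F\<close> of a distribution with orthogonal complement \<open>D\<close>, this is the symmetrized
  second fundamental form of that distribution. Thus \<open>B\<^sup>V\<close> projects to \<open>H\<close> and \<open>B\<^sup>H\<close> projects to \<open>V\<close>.\<close>

definition sym_second_form :: "'m metric \<Rightarrow> 'm connection \<Rightarrow> 'm distribution \<Rightarrow>
    'm vfield \<Rightarrow> 'm vfield \<Rightarrow> 'm vfield" where
  "sym_second_form g nabla D E F =
     (\<lambda>p. (1/2) *\<^sub>R ortho_proj g D p (nabla E F p + nabla F E p))"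

definition conformal_foliation :: "('m::topological_space, 'e::euclidean_space) atlas \<Rightarrow>
    'm metric \<Rightarrow> 'm connection \<Rightarrow> 'm distribution \<Rightarrow> bool" where
  "conformal_foliation A g nabla V \<longleftrightarrow> involutive A V \<and>
     (\<exists>N\<in>sections A V. \<forall>E\<in>sections A (ortho_complement A g V).
        \<forall>F\<in>sections A (ortho_complement A g V).
          sym_second_form g nabla V E F = fscale (\<lambda>p. g p (E p) (F p)) N)"

definition minimal_foliation :: "('m::topological_space, 'e::euclidean_space) atlas \<Rightarrow>
    'm metric \<Rightarrow> 'm connection \<Rightarrow> 'm distribution \<Rightarrow> bool" where
  "minimal_foliation A g nabla V \<longleftrightarrow> involutive A V \<and>
     (\<forall>p Us. set Us \<subseteq> sections A V \<and> orthonormal_basis (g p) (V p) (map (\<lambda>U. U p) Us) \<longrightarrow>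
        (\<Sum>U\<leftarrow>Us. sym_second_form g nabla (ortho_complement A g V) U U p) = 0)"

definition totally_geodesic_foliation :: "('m::topological_space, 'e::euclidean_space) atlas \<Rightarrow>
    'm metric \<Rightarrow> 'm connection \<Rightarrow> 'm distribution \<Rightarrow> bool" where
  "totally_geodesic_foliation A g nabla V \<longleftrightarrow> involutive A V \<and>
     (\<forall>E\<in>sections A V. \<forall>F\<in>sections A V.
        sym_second_form g nabla (ortho_complement A g V) E F = 0)"

text \<open>The leaf through \<open>q\<close> of the restriction to \<open>U\<close> of the foliation tangent to \<open>D\<close>: all points
  that can be reached from \<open>q\<close> inside \<open>U\<close> along a differentiable curve tangent to \<open>D\<close>.\<close>

definition leaf_in :: "('m::topological_space, 'e::euclidean_space) atlas \<Rightarrow>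
    'm distribution \<Rightarrow> 'm set \<Rightarrow> 'm \<Rightarrow> 'm set" where
  "leaf_in A D U q = {pathfinish \<gamma> | \<gamma>. path \<gamma> \<and> path_image \<gamma> \<subseteq> U \<and> pathstart \<gamma> = q \<and>
     (\<forall>t\<in>{0..1}. \<exists>v\<in>D (\<gamma> t). \<forall>f. smooth_near A (\<gamma> t) f \<longrightarrow>
        ((\<lambda>s. f (\<gamma> s)) has_real_derivative v f) (at t within {0..1}))}"

definition submersion_on :: "('m::topological_space, 'e::euclidean_space) atlas \<Rightarrow> 'm set \<Rightarrow>
    ('m \<Rightarrow> 'b::euclidean_space) \<Rightarrow> bool" where
  "submersion_on A U \<phi> \<longleftrightarrow> smooth_on A U \<phi> \<and> (\<forall>q\<in>U. mdiff \<phi> ` tangent A q = UNIV)"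

definition horizontally_conformal_on :: "('m::topological_space, 'e::euclidean_space) atlas \<Rightarrow>
    'm metric \<Rightarrow> 'm set \<Rightarrow> ('m \<Rightarrow> 'b::euclidean_space) \<Rightarrow> bool" where
  "horizontally_conformal_on A g U \<phi> \<longleftrightarrow> (\<forall>q\<in>U. \<exists>l>0.
     let Hor = ortho_complement A g (\<lambda>x. {v \<in> tangent A x. mdiff \<phi> v = 0}) q
     in \<forall>v\<in>Hor. \<forall>w\<in>Hor. mdiff \<phi> v \<bullet> mdiff \<phi> w = l\<^sup>2 * g q v w)"


section \<open>Hermitian structures\<close>

type_synonym 'm endo = "'m \<Rightarrow> 'm tvec \<Rightarrow> 'm tvec"

definition appl :: "'m endo \<Rightarrow> 'm vfield \<Rightarrow> 'm vfield" where
  "appl J E = (\<lambda>p. J p (E p))"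

definition almost_hermitian :: "('m::topological_space, 'e::euclidean_space) atlas \<Rightarrow>
    'm metric \<Rightarrow> 'm endo \<Rightarrow> bool" where
  "almost_hermitian A g J \<longleftrightarrow>
     (\<forall>p. \<forall>u\<in>tangent A p. \<forall>v\<in>tangent A p. \<forall>c.
        J p u \<in> tangent A p \<and> J p (u + v) = J p u + J p v \<and> J p (c *\<^sub>R u) = c *\<^sub>R J p u \<and>
        J p (J p u) = - u \<and> g p (J p u) (J p v) = g p u v) \<and>
     (\<forall>E. smooth_vfield A E \<longrightarrow> smooth_vfield A (appl J E))"

definition left_invariant_endo :: "('g::topological_space, 'e::euclidean_space) atlas \<Rightarrow>
    ('g \<Rightarrow> 'g \<Rightarrow> 'g) \<Rightarrow> 'g endo \<Rightarrow> bool" where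
  "left_invariant_endo A mul J \<longleftrightarrow> (\<forall>a p. \<forall>u\<in>tangent A p.
     J (mul a p) (push A (mul a) p u) = push A (mul a) p (J p u))"

definition nijenhuis :: "('m::topological_space, 'e::euclidean_space) atlas \<Rightarrow>
    'm endo \<Rightarrow> 'm vfield \<Rightarrow> 'm vfield \<Rightarrow> 'm vfield" where
  "nijenhuis A J E F = lie_bracket A E F + appl J (lie_bracket A (appl J E) F) +
     appl J (lie_bracket A E (appl J F)) - lie_bracket A (appl J E) (appl J F)"

definition integrable_structure ::
    "('m::topological_space, 'e::euclidean_space) atlas \<Rightarrow> 'm endo \<Rightarrow> bool" where
  "integrable_structure A J \<longleftrightarrow>
     (\<forall>E F. smooth_vfield A E \<and> smooth_vfield A F \<longrightarrow> nijenhuis A J E F = 0)"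

definition hermitian :: "('m::topological_space, 'e::euclidean_space) atlas \<Rightarrow>
    'm metric \<Rightarrow> 'm endo \<Rightarrow> bool" where
  "hermitian A g J \<longleftrightarrow> almost_hermitian A g J \<and> integrable_structure A J"

definition kaehler :: "('m::topological_space, 'e::euclidean_space) atlas \<Rightarrow>
    'm metric \<Rightarrow> 'm connection \<Rightarrow> 'm endo \<Rightarrow> bool" where
  "kaehler A g nabla J \<longleftrightarrow> hermitian A g J \<and>
     (\<forall>E F. smooth_vfield A E \<and> smooth_vfield A F \<longrightarrow>
        nabla E (appl J F) - appl J (nabla E F) = 0)"

definition holomorphic_foliation :: "('m::topological_space, 'e::euclidean_space) atlas \<Rightarrow>
    'm metric \<Rightarrow> 'm endo \<Rightarrow> 'm distribution \<Rightarrow> bool" where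
  "holomorphic_foliation A g J V \<longleftrightarrow> (\<forall>p. \<exists>U (\<phi> :: 'm \<Rightarrow> complex). open U \<and> p \<in> U \<and>
     submersion_on A U \<phi> \<and> horizontally_conformal_on A g U \<phi> \<and>
     (\<forall>q\<in>U. {x \<in> U. \<phi> x = \<phi> q} = leaf_in A V U q) \<and>
     (\<forall>q\<in>U. \<forall>v\<in>tangent A q. mdiff \<phi> (J q v) = \<i> * mdiff \<phi> v))"

end

theory Submission
  imports Defs
begin

text \<open>The fields \<open>X, Y, Z, W\<close> form a global orthonormal frame with constant brackets. By
  Koszul's formula the connection has constant coefficients in it, and the tensors in question can be
  read off the frame:
  \<open>B\<^sup>H = 0\<close>, \<open>B\<^sup>V(Z,Z) = -z\<^sub>2 Y = -B\<^sup>V(W,W)\<close>, the Nijenhuis tensor vanishes,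
  \<open>\<nabla>\<^sub>X(JX) - J\<nabla>\<^sub>X X = -(\<theta>\<^sub>1 Z + \<theta>\<^sub>2 W)/2\<close>, and \<open>Ric(X,Z) = z\<^sub>2\<theta>\<^sub>1/2\<close> although
  \<open>g(X,Z) = 0\<close>.
  Instead of the Frobenius theorem, the leaves come from the dual coframe: \<open>Y\<^sup>*\<close> is closed, so
  locally \<open>Y\<^sup>* = dh\<close>, and \<open>exp(2z\<^sub>2h) X\<^sup>*\<close> is closed as well, so locally it is \<open>df\<close>. The map
  \<open>\<phi> = f + i exp(2z\<^sub>2h)/(2z\<^sub>2)\<close> satisfies \<open>d\<phi> = exp(2z\<^sub>2h)(X\<^sup>* + i Y\<^sup>*)\<close>; it is a horizontally
  conformal holomorphic submersion, and its fibres are the leaves because \<open>(Re \<phi>, Im \<phi>)\<close> extends to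
  local coordinates with convex range.\<close>

section \<open>Smooth functions between Euclidean spaces\<close>

text \<open>The integrating factor comes from the structure equation: a form of the dual coframe has
  d of it, on two frame fields, equal to minus its value on their bracket. No bracket has a
  \<open>Y\<close> component, and among the brackets only that of \<open>Y\<close> and
  \<open>X\<close> has an \<open>X\<close> component, namely 2 z2. Hence dY^* = 0 and dX^* = 2 z2
  X^* wedge Y^*, and a function l with dl = 2 z2 l Y^* makes l X^* closed. Since l / (2 z2) is a
  primitive of l Y^*, the same factor l multiplies both forms, and this equality makes the resulting
  map conformal and holomorphic. The obstacle is that the conditions on a distribution or on J range
  over all smooth sections, whose frame coefficients are functions, while brackets and connection
  are known for constant coefficients only. Function-linearity in the left slot of
  \<open>nabla\<close> and of the Nijenhuis tensor gives one reduction. In the right slot of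
  \<open>nabla\<close>, which is not function-linear, metric compatibility moves the derivative onto
  a frame field orthogonal to the section.\<close>

lemma Ck_on_cong:
  assumes "open S" "\<And>x. x \<in> S \<Longrightarrow> f x = g x" "Ck_on k S f"
  shows "Ck_on k S g"
  using assms(2,3)
proof (induction k arbitrary: f g)
  case 0
  then show ?case using continuous_on_cong by fastforce
next
  case (Suc k)
  have der: "(g has_derivative frechet_derivative f (at x)) (at x)" if "x \<in> S" for x
  proof (rule has_derivative_transform_within_open[OF _ assms(1) that])
    show "(f has_derivative frechet_derivative f (at x)) (at x)"
      using Suc.prems(2) that by (simp flip: frechet_derivative_works)
  qed (simp add: Suc.prems(1))
  have "frechet_derivative f (at x) = frechet_derivative g (at x)" if "x \<in> S" for x
    using der[OF that] by (rule frechet_derivative_at)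
  then have "Ck_on k S (\<lambda>x. frechet_derivative g (at x) w)" for w
    using Suc.IH[of "\<lambda>x. frechet_derivative f (at x) w"] Suc.prems(2) by simp
  then show ?case
    using der by (auto simp: differentiable_def)
qed

lemma Ck_on_subset: "Ck_on k S f \<Longrightarrow> T \<subseteq> S \<Longrightarrow> Ck_on k T f"
  by (induction k arbitrary: f) (auto intro: continuous_on_subset)

lemma Ck_on_Suc_imp: "Ck_on (Suc k) S f \<Longrightarrow> Ck_on k S f"
proof (induction k arbitrary: f)
  case 0
  then show ?case
    by (simp add: continuous_at_imp_continuous_on differentiable_imp_continuous_within)
next
  case (Suc k)
  then show ?case by (metis Ck_on.simps(2))
qed

text \<open>\<open>Ck_on\<close> is stated with \<open>frechet_derivative\<close>; by uniqueness of
  derivatives any explicit derivative may stand in for it, with openness entering through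
  \<open>Ck_on_cong\<close>. Together with \<open>Ck_on_SucD\<close> this reduces the inductions on
  k below to derivative rules.\<close>

lemma Ck_on_SucI:
  assumes "open S" "\<And>x. x \<in> S \<Longrightarrow> (f has_derivative f' x) (at x)"
    "\<And>w. Ck_on k S (\<lambda>x. f' x w)"
  shows "Ck_on (Suc k) S f"
proof -
  have "frechet_derivative f (at x) = f' x" if "x \<in> S" for x
    using frechet_derivative_at[OF assms(2)[OF that]] by simp
  then show ?thesis
    using assms by (auto simp: differentiable_def intro: Ck_on_cong[OF assms(1) _ assms(3)])
qed

lemma Ck_on_SucD:
  assumes "Ck_on (Suc k) S f"
  shows "\<exists>f'. (\<forall>x\<in>S. (f has_derivative f' x) (at x)) \<and> (\<forall>w. Ck_on k S (\<lambda>x. f' x w))"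
  using assms by (intro exI[of _ "\<lambda>x. frechet_derivative f (at x)"]) (simp flip: frechet_derivative_works)

lemma Ck_on_const: "open S \<Longrightarrow> Ck_on k S (\<lambda>x. c)"
proof (induction k arbitrary: c)
  case (Suc k)
  show ?case
    by (rule Ck_on_SucI[OF Suc.prems, where f'="\<lambda>x w. 0"]) (simp_all add: Suc)
qed simp

lemma Ck_on_bounded_linear:
  assumes "bounded_linear L" "open S" "Ck_on k S f"
  shows "Ck_on k S (\<lambda>x. L (f x))"
  using assms(3)
proof (induction k arbitrary: f)
  case 0
  then show ?case using bounded_linear.continuous_on[OF assms(1)] by auto
next
  case (Suc k)
  obtain f' where f': "\<And>x. x \<in> S \<Longrightarrow> (f has_derivative f' x) (at x)"
    "\<And>w. Ck_on k S (\<lambda>x. f' x w)" using Ck_on_SucD[OF Suc.prems] by blast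
  show ?case
    by (rule Ck_on_SucI[OF assms(2), where f'="\<lambda>x w. L (f' x w)"])
       (auto intro!: Suc.IH f' bounded_linear.has_derivative[OF assms(1)])
qed

lemma Ck_on_add:
  assumes "open S" "Ck_on k S f" "Ck_on k S g"
  shows "Ck_on k S (\<lambda>x. f x + g x)"
  using assms(2,3)
proof (induction k arbitrary: f g)
  case 0
  then show ?case by (auto intro: continuous_intros)
next
  case (Suc k)
  obtain f' where f': "\<And>x. x \<in> S \<Longrightarrow> (f has_derivative f' x) (at x)"
    "\<And>w. Ck_on k S (\<lambda>x. f' x w)" using Ck_on_SucD[OF Suc.prems(1)] by blast
  obtain g' where g': "\<And>x. x \<in> S \<Longrightarrow> (g has_derivative g' x) (at x)"
    "\<And>w. Ck_on k S (\<lambda>x. g' x w)" using Ck_on_SucD[OF Suc.prems(2)] by blast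
  show ?case
    by (rule Ck_on_SucI[OF assms(1), where f'="\<lambda>x w. f' x w + g' x w"])
       (auto intro!: Suc.IH f' g' has_derivative_add)
qed

lemma Ck_on_bilinear:
  assumes "bounded_bilinear h" "open S" "Ck_on k S f" "Ck_on k S g"
  shows "Ck_on k S (\<lambda>x. h (f x) (g x))"
  using assms(3,4)
proof (induction k arbitrary: f g)
  case 0
  then show ?case using bounded_bilinear.continuous_on[OF assms(1)] by auto
next
  case (Suc k)
  obtain f' where f': "\<And>x. x \<in> S \<Longrightarrow> (f has_derivative f' x) (at x)"
    "\<And>w. Ck_on k S (\<lambda>x. f' x w)" using Ck_on_SucD[OF Suc.prems(1)] by blast
  obtain g' where g': "\<And>x. x \<in> S \<Longrightarrow> (g has_derivative g' x) (at x)"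
    "\<And>w. Ck_on k S (\<lambda>x. g' x w)" using Ck_on_SucD[OF Suc.prems(2)] by blast
  show ?case
  proof (rule Ck_on_SucI[OF assms(2)])
    show "((\<lambda>x. h (f x) (g x)) has_derivative (\<lambda>w. h (f x) (g' x w) + h (f' x w) (g x))) (at x)"
      if "x \<in> S" for x
      using that by (intro bounded_bilinear.FDERIV[OF assms(1)] f' g')
    \<comment> \<open>The product rule pairs a derivative of one factor with the other factor
      itself, so the undifferentiated factors are needed at order k as well.\<close>
    have fg: "Ck_on k S f" "Ck_on k S g" using Suc.prems by (simp_all add: Ck_on_Suc_imp del: Ck_on.simps(2))
    show "Ck_on k S (\<lambda>x. h (f x) (g' x w) + h (f' x w) (g x))" for w
      by (rule Ck_on_add[OF assms(2) Suc.IH[OF fg(1) g'(2)] Suc.IH[OF f'(2) fg(2)]])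
  qed
qed

lemma Ck_on_sum:
  assumes "open S" "\<And>i. i \<in> I \<Longrightarrow> Ck_on k S (f i)"
  shows "Ck_on k S (\<lambda>x. \<Sum>i\<in>I. f i x)"
  using assms(2)
  by (induction I rule: infinite_finite_induct) (auto intro!: Ck_on_add Ck_on_const assms(1))

text \<open>The chain rule evaluates g' in the direction f' x w, which moves with x, whereas
  \<open>Ck_on\<close> controls derivatives in fixed directions only. Expanding f' x w in the basis
  of the intermediate Euclidean space makes the directions constant and the coefficients
  smooth.\<close>

lemma Ck_on_compose:
  fixes f :: "'a::real_normed_vector \<Rightarrow> 'b::euclidean_space" and g :: "'b \<Rightarrow> 'c::real_normed_vector"
  assumes "open S" "open T" "f ` S \<subseteq> T" "Ck_on k S f" "Ck_on k T g"
  shows "Ck_on k S (\<lambda>x. g (f x))"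
  using assms(4,5)
proof (induction k arbitrary: g)
  case 0
  then show ?case using assms(3) by (auto intro: continuous_on_compose2)
next
  case (Suc k)
  obtain f' where f': "\<And>x. x \<in> S \<Longrightarrow> (f has_derivative f' x) (at x)"
    "\<And>w. Ck_on k S (\<lambda>x. f' x w)" using Ck_on_SucD[OF Suc.prems(1)] by blast
  obtain g' where g': "\<And>x. x \<in> T \<Longrightarrow> (g has_derivative g' x) (at x)"
    "\<And>w. Ck_on k T (\<lambda>x. g' x w)" using Ck_on_SucD[OF Suc.prems(2)] by blast
  show ?case
  proof (rule Ck_on_SucI[OF assms(1), where f'="\<lambda>x w. \<Sum>b\<in>Basis. (f' x w \<bullet> b) *\<^sub>R g' (f x) b"])
    fix x assume x: "x \<in> S"
    then have fx: "f x \<in> T" using assms(3) by auto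
    have lin: "linear (g' (f x))" using g'(1)[OF fx] by (rule has_derivative_linear)
    have eq: "g' (f x) v = (\<Sum>b\<in>Basis. (v \<bullet> b) *\<^sub>R g' (f x) b)" for v
    proof -
      have "g' (f x) v = g' (f x) (\<Sum>b\<in>Basis. (v \<bullet> b) *\<^sub>R b)" by (simp add: euclidean_representation)
      also have "\<dots> = (\<Sum>b\<in>Basis. (v \<bullet> b) *\<^sub>R g' (f x) b)"
        by (simp add: linear_sum[OF lin] linear_cmul[OF lin])
      finally show ?thesis .
    qed
    have "((\<lambda>x. g (f x)) has_derivative (\<lambda>w. g' (f x) (f' x w))) (at x)"
      using has_derivative_compose[OF f'(1)[OF x] g'(1)[OF fx]] by simp
    then show "((\<lambda>x. g (f x)) has_derivative (\<lambda>w. \<Sum>b\<in>Basis. (f' x w \<bullet> b) *\<^sub>R g' (f x) b)) (at x)"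
      unfolding ext[of "\<lambda>w. g' (f x) (f' x w)", OF eq] .
  next
    fix w
    show "Ck_on k S (\<lambda>x. \<Sum>b\<in>Basis. (f' x w \<bullet> b) *\<^sub>R g' (f x) b)"
    proof (rule Ck_on_sum[OF assms(1)])
      fix b :: 'b
      have "Ck_on k S (\<lambda>x. f' x w \<bullet> b)"
        by (rule Ck_on_bounded_linear[OF bounded_linear_inner_left assms(1) f'(2)])
      moreover have "Ck_on k S (\<lambda>x. g' (f x) b)"
        by (rule Suc.IH[OF Ck_on_Suc_imp[OF Suc.prems(1)] g'(2)])
      ultimately show "Ck_on k S (\<lambda>x. (f' x w \<bullet> b) *\<^sub>R g' (f x) b)"
        by (rule Ck_on_bilinear[OF bounded_bilinear_scaleR assms(1)])
    qed
  qed
qed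

lemma Cinf_on_cong: "open S \<Longrightarrow> (\<And>x. x \<in> S \<Longrightarrow> f x = g x) \<Longrightarrow> Cinf_on S f \<Longrightarrow> Cinf_on S g"
  unfolding Cinf_on_def using Ck_on_cong by blast

lemma Cinf_on_subset: "Cinf_on S f \<Longrightarrow> T \<subseteq> S \<Longrightarrow> Cinf_on T f"
  unfolding Cinf_on_def using Ck_on_subset by blast

lemma Cinf_on_const: "open S \<Longrightarrow> Cinf_on S (\<lambda>x. c)"
  unfolding Cinf_on_def using Ck_on_const by blast

lemma Cinf_on_bounded_linear:
  "bounded_linear L \<Longrightarrow> open S \<Longrightarrow> Cinf_on S f \<Longrightarrow> Cinf_on S (\<lambda>x. L (f x))"
  unfolding Cinf_on_def using Ck_on_bounded_linear by blast

lemma Cinf_on_bilinear: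
  "bounded_bilinear h \<Longrightarrow> open S \<Longrightarrow> Cinf_on S f \<Longrightarrow> Cinf_on S g \<Longrightarrow> Cinf_on S (\<lambda>x. h (f x) (g x))"
  unfolding Cinf_on_def using Ck_on_bilinear by blast

lemma Cinf_on_add: "open S \<Longrightarrow> Cinf_on S f \<Longrightarrow> Cinf_on S g \<Longrightarrow> Cinf_on S (\<lambda>x. f x + g x)"
  unfolding Cinf_on_def using Ck_on_add by blast

lemma Cinf_on_sum:
  "open S \<Longrightarrow> (\<And>i. i \<in> I \<Longrightarrow> Cinf_on S (f i)) \<Longrightarrow> Cinf_on S (\<lambda>x. \<Sum>i\<in>I. f i x)"
  by (simp add: Cinf_on_def Ck_on_sum)

lemma Cinf_on_compose:
  fixes f :: "'a::real_normed_vector \<Rightarrow> 'b::euclidean_space" and g :: "'b \<Rightarrow> 'c::real_normed_vector"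
  shows "open S \<Longrightarrow> open T \<Longrightarrow> f ` S \<subseteq> T \<Longrightarrow> Cinf_on S f \<Longrightarrow> Cinf_on T g \<Longrightarrow> Cinf_on S (\<lambda>x. g (f x))"
  unfolding Cinf_on_def using Ck_on_compose by blast

lemma Cinf_on_has_derivative:
  "Cinf_on S f \<Longrightarrow> x \<in> S \<Longrightarrow> (f has_derivative frechet_derivative f (at x)) (at x)"
  unfolding Cinf_on_def using frechet_derivative_works Ck_on.simps(2) by blast

lemma Cinf_on_frechet_derivative:
  "Cinf_on S f \<Longrightarrow> Cinf_on S (\<lambda>x. frechet_derivative f (at x) w)"
  unfolding Cinf_on_def using Ck_on.simps(2) by blast

lemma Cinf_on_imp_continuous_on: "Cinf_on S f \<Longrightarrow> continuous_on S f"
  unfolding Cinf_on_def using Ck_on.simps(1) by blast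

text \<open>Order k follows from order k + 1, which looks only at the derivative. This is how
  potentials, known only through their differentials, are seen to be smooth.\<close>

lemma Cinf_onI_derivative:
  assumes "open S" "\<And>x. x \<in> S \<Longrightarrow> (f has_derivative f' x) (at x)" "\<And>w. Cinf_on S (\<lambda>x. f' x w)"
  shows "Cinf_on S f"
  unfolding Cinf_on_def
proof
  fix k
  have "Ck_on (Suc k) S f"
    by (rule Ck_on_SucI[OF assms(1,2)]) (use assms(3) in \<open>auto simp: Cinf_on_def\<close>)
  then show "Ck_on k S f" by (rule Ck_on_Suc_imp)
qed

lemma Cinf_on_inner_const:
  fixes f :: "'a::real_normed_vector \<Rightarrow> 'b::real_inner"
  shows "open S \<Longrightarrow> Cinf_on S f \<Longrightarrow> Cinf_on S (\<lambda>x. f x \<bullet> b)"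
  by (rule Cinf_on_bounded_linear[OF bounded_linear_inner_left])

lemma Cinf_on_mult:
  fixes f :: "'a::real_normed_vector \<Rightarrow> real"
  shows "open S \<Longrightarrow> Cinf_on S f \<Longrightarrow> Cinf_on S g \<Longrightarrow> Cinf_on S (\<lambda>x. f x * g x)"
  by (rule Cinf_on_bilinear[OF bounded_bilinear_mult])

lemma Cinf_on_scaleR:
  "open S \<Longrightarrow> Cinf_on S f \<Longrightarrow> Cinf_on S g \<Longrightarrow> Cinf_on S (\<lambda>x. f x *\<^sub>R g x)"
  by (rule Cinf_on_bilinear[OF bounded_bilinear_scaleR])

lemma Cinf_on_prod:
  fixes f :: "'i \<Rightarrow> 'a::real_normed_vector \<Rightarrow> real"
  shows "open S \<Longrightarrow> (\<And>i. i \<in> I \<Longrightarrow> Cinf_on S (f i)) \<Longrightarrow> Cinf_on S (\<lambda>x. \<Prod>i\<in>I. f i x)"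
  by (induction I rule: infinite_finite_induct) (auto intro!: Cinf_on_mult Cinf_on_const)

lemma Cinf_on_vec_nth:
  fixes f :: "'a::real_normed_vector \<Rightarrow> real ^ 'n"
  shows "open S \<Longrightarrow> Cinf_on S f \<Longrightarrow> Cinf_on S (\<lambda>x. f x $ i)"
  by (rule Cinf_on_bounded_linear[OF bounded_linear_vec_nth])

lemma Cinf_on_vec_lambda:
  fixes f :: "'n::finite \<Rightarrow> 'a::real_normed_vector \<Rightarrow> real"
  assumes "open S" "\<And>i. Cinf_on S (f i)"
  shows "Cinf_on S (\<lambda>x. \<chi> i. f i x)"
proof -
  have "Cinf_on S (\<lambda>x. \<Sum>i\<in>UNIV. f i x *\<^sub>R axis i (1::real))"
    by (intro Cinf_on_sum assms Cinf_on_scaleR Cinf_on_const)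
  then show ?thesis
    by (rule Cinf_on_cong[rotated 2])
       (auto simp: assms vec_eq_iff axis_def if_distrib cong: if_cong)
qed

lemma Cinf_on_exp: "Cinf_on UNIV (exp :: real \<Rightarrow> real)"
  unfolding Cinf_on_def
proof
  fix k show "Ck_on k UNIV (exp :: real \<Rightarrow> real)"
  proof (induction k)
    case (Suc k)
    show ?case
      by (rule Ck_on_SucI[where f'="\<lambda>x w. exp x * w"])
         (auto intro!: has_derivative_eq_rhs[OF has_derivative_exp[OF has_derivative_ident]]
            Ck_on_bounded_linear[OF bounded_linear_mult_left] Suc)
  qed (auto intro: continuous_intros)
qed

lemma Cinf_on_inverse: "Cinf_on (- {0}) (inverse :: real \<Rightarrow> real)"
  unfolding Cinf_on_def
proof
  fix k show "Ck_on k (- {0}) (inverse :: real \<Rightarrow> real)"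
  proof (induction k)
    case (Suc k)
    show ?case
    \<comment> \<open>Expressing the derivative through \<open>inverse\<close> itself lets the
      induction hypothesis serve for both factors.\<close>
    proof (rule Ck_on_SucI[where f'="\<lambda>x w. - (inverse x * w * inverse x)"])
      fix w :: real
      show "Ck_on k (- {0}) (\<lambda>x. - (inverse x * w * inverse x))"
        by (intro Ck_on_bounded_linear[OF bounded_linear_minus[OF bounded_linear_ident]]
             Ck_on_bilinear[OF bounded_bilinear_mult] Suc Ck_on_const) auto
    qed (auto intro!: derivative_eq_intros)
  qed (auto intro: continuous_intros)
qed

lemma Cinf_on_det:
  fixes M :: "'a::real_normed_vector \<Rightarrow> real ^ 'n ^ 'n"
  assumes "open S" "\<And>i j. Cinf_on S (\<lambda>x. M x $ i $ j)"
  shows "Cinf_on S (\<lambda>x. det (M x))"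
  unfolding det_def
  by (intro Cinf_on_sum Cinf_on_mult Cinf_on_const Cinf_on_prod assms)

text \<open>Smoothness of the dual frame is Cramer's rule.\<close>

lemma smooth_dual_frame:
  fixes \<xi> :: "'n::finite \<Rightarrow> 'a::real_normed_vector \<Rightarrow> real ^ 'n"
  assumes S: "open S" and sm: "\<And>j. Cinf_on S (\<xi> j)"
    and indep: "\<And>x c. x \<in> S \<Longrightarrow> (\<Sum>j\<in>UNIV. c j *\<^sub>R \<xi> j x) = 0 \<Longrightarrow> c = (\<lambda>_. 0)"
  obtains \<alpha> :: "'n \<Rightarrow> 'a \<Rightarrow> real ^ 'n" where
    "\<And>k. Cinf_on S (\<alpha> k)"
    "\<And>x w. x \<in> S \<Longrightarrow> (\<Sum>k\<in>UNIV. (\<alpha> k x \<bullet> w) *\<^sub>R \<xi> k x) = w"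
    "\<And>x j k. x \<in> S \<Longrightarrow> \<alpha> k x \<bullet> \<xi> j x = (if j = k then 1 else 0)"
proof -
  \<comment> \<open>The frame vectors are the columns, so solving M c = b expands b in the
    frame.\<close>
  define M :: "'a \<Rightarrow> real ^ 'n ^ 'n" where "M x = (\<chi> i j. \<xi> j x $ i)" for x
  have Mv: "M x *v c = (\<Sum>j\<in>UNIV. c $ j *\<^sub>R \<xi> j x)" for x c
    by (simp add: M_def matrix_vector_mult_def vec_eq_iff mult.commute)
  have det: "det (M x) \<noteq> 0" if "x \<in> S" for x
  proof -
    have "\<forall>c. M x *v c = 0 \<longrightarrow> c = 0"
      using indep[OF that] by (auto simp: Mv vec_eq_iff fun_eq_iff)
    then have "invertible (M x)"
      using invertible_left_inverse matrix_left_invertible_ker by blast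
    then show ?thesis by (simp add: invertible_det_nz)
  qed
  \<comment> \<open>Cramer's formula for the k-th coordinate of the solution. The quotient is a
    product with \<open>inverse\<close>, so that its smoothness is a composition with
    \<open>Cinf_on_inverse\<close>.\<close>
  define s where "s k b x = det (\<chi> i j. if j = k then b $ i else M x $ i $ j) * inverse (det (M x))"
    for k x and b :: "real ^ 'n"
  have sols: "M x *v c = b \<longleftrightarrow> c = (\<chi> k. s k b x)" if "x \<in> S" for x b c
    unfolding s_def using cramer[OF det[OF that]] by (simp add: divide_inverse)
  have sm_s: "Cinf_on S (s k b)" for k b
  proof -
    have Mij: "Cinf_on S (\<lambda>x. M x $ i $ j)" for i j
      unfolding M_def using Cinf_on_vec_nth[OF S sm] by simp
    have 1: "Cinf_on S (\<lambda>x. det (\<chi> i j. if j = k then b $ i else M x $ i $ j))"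
    proof (rule Cinf_on_det[OF S])
      fix i j show "Cinf_on S (\<lambda>x. (\<chi> i j. if j = k then b $ i else M x $ i $ j) $ i $ j)"
        by (cases "j = k") (auto intro: Cinf_on_const[OF S] Mij)
    qed
    have 2: "Cinf_on S (\<lambda>x. inverse (det (M x)))"
      by (rule Cinf_on_compose[OF S _ _ Cinf_on_det[OF S Mij] Cinf_on_inverse]) (use det in auto)
    show ?thesis unfolding s_def[abs_def] by (intro Cinf_on_mult S 1 2)
  qed
  \<comment> \<open>Entry i is the k-th frame coordinate of the i-th unit vector: \<alpha> k is the
    k-th row of the inverse of M.\<close>
  define \<alpha> :: "'n \<Rightarrow> 'a \<Rightarrow> real ^ 'n" where "\<alpha> k x = (\<chi> i. s k (axis i 1) x)" for k x
  have expand: "(\<Sum>k\<in>UNIV. (\<alpha> k x \<bullet> w) *\<^sub>R \<xi> k x) = w" if "x \<in> S" for x w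
  proof -
    have "(\<Sum>k\<in>UNIV. (\<alpha> k x \<bullet> w) *\<^sub>R \<xi> k x)
      = (\<Sum>k\<in>UNIV. \<Sum>i\<in>UNIV. (s k (axis i 1) x * w $ i) *\<^sub>R \<xi> k x)"
      by (simp add: \<alpha>_def inner_vec_def scaleR_sum_left)
    also have "\<dots> = (\<Sum>i\<in>UNIV. w $ i *\<^sub>R (\<Sum>k\<in>UNIV. s k (axis i 1) x *\<^sub>R \<xi> k x))"
      by (subst sum.swap) (simp add: scaleR_sum_right mult.commute)
    also have "\<dots> = (\<Sum>i\<in>UNIV. w $ i *\<^sub>R axis i 1)"
    proof -
      have "(\<Sum>k\<in>UNIV. s k b x *\<^sub>R \<xi> k x) = b" for b
        using sols[OF that, of "\<chi> k. s k b x" b] by (simp add: Mv)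
      then show ?thesis by simp
    qed
    also have "\<dots> = w"
      by (auto simp: vec_eq_iff axis_def if_distrib cong: if_cong)
    finally show ?thesis .
  qed
  \<comment> \<open>Both sides are the coefficients of \<xi> j in the frame, so independence
    identifies them.\<close>
  have "\<alpha> k x \<bullet> \<xi> j x = (if j = k then 1 else 0)" if "x \<in> S" for x j k
  proof -
    have "(\<Sum>k\<in>UNIV. (\<alpha> k x \<bullet> \<xi> j x - (if j = k then 1 else 0)) *\<^sub>R \<xi> k x) = 0"
      using expand[OF that, of "\<xi> j x"]
      by (simp add: scaleR_diff_left sum_subtractf if_distrib[of "\<lambda>c. c *\<^sub>R _"] cong: if_cong)
    from indep[OF that this] show ?thesis by (auto simp: fun_eq_iff)
  qed
  moreover have "Cinf_on S (\<alpha> k)" for k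
    unfolding \<alpha>_def[abs_def] by (intro Cinf_on_vec_lambda S sm_s)
  ultimately show thesis using expand that by blast
qed

section \<open>The Poincare lemma and local diffeomorphisms\<close>

lemma Blinfun_frechet_derivative:
  assumes "Cinf_on S f" "x \<in> S"
  shows "blinfun_apply (Blinfun (frechet_derivative f (at x))) = frechet_derivative f (at x)"
  using Cinf_on_has_derivative[OF assms]
  by (simp add: bounded_linear_Blinfun_apply has_derivative_bounded_linear)

text \<open>In finite dimensions, continuity of every directional derivative amounts to continuity
  in operator norm, the form in which the Leibniz rule and the inverse function theorem take a
  derivative.\<close>

lemma continuous_on_Blinfun_frechet_derivative:
  fixes f :: "'a::euclidean_space \<Rightarrow> 'b::real_normed_vector"
  assumes "Cinf_on S f"
  shows "continuous_on S (\<lambda>x. Blinfun (frechet_derivative f (at x)))"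
proof (rule continuous_on_blinfun_componentwise)
  fix i :: 'a
  have "continuous_on S (\<lambda>x. frechet_derivative f (at x) i)"
    by (rule Cinf_on_imp_continuous_on[OF Cinf_on_frechet_derivative[OF assms]])
  then show "continuous_on S (\<lambda>x. blinfun_apply (Blinfun (frechet_derivative f (at x))) i)"
    by (rule continuous_on_eq) (simp add: Blinfun_frechet_derivative[OF assms])
qed

text \<open>Poincare's lemma for the 1-form \<open>w \<mapsto> a y \<bullet> w\<close>, whose closedness is the symmetry of the
  derivative of \<open>a\<close>.\<close>

lemma poincare_lemma:
  fixes a :: "'e::euclidean_space \<Rightarrow> 'e"
  assumes a: "Cinf_on (ball x0 r) a"
    and sym: "\<And>y v w. y \<in> ball x0 r \<Longrightarrow>
      frechet_derivative a (at y) v \<bullet> w = frechet_derivative a (at y) w \<bullet> v"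
  obtains f where "\<And>y. y \<in> ball x0 r \<Longrightarrow> (f has_derivative (\<lambda>w. a y \<bullet> w)) (at y)"
proof -
  let ?U = "ball x0 r"
  let ?D = "\<lambda>z. frechet_derivative a (at z)"
  define z where "z y t = x0 + t *\<^sub>R (y - x0)" for y t
  have z_in: "z y t \<in> ?U" if "y \<in> ?U" "t \<in> cbox 0 1" for y t
  proof -
    have "norm (t *\<^sub>R (y - x0)) \<le> 1 * norm (y - x0)"
      unfolding norm_scaleR by (rule mult_right_mono) (use that in auto)
    then show ?thesis using that by (simp add: z_def dist_norm norm_minus_commute)
  qed
  have der_a: "(a has_derivative ?D y) (at y)" if "y \<in> ?U" for y
    by (rule Cinf_on_has_derivative[OF a that])
  \<comment> \<open>The derivative in y of the integrand
    \<open>a (z y t) \<bullet> (y - x0)\<close>: the factor t is the derivative of z in y, and the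
    second summand differentiates y - x0.\<close>
  define fx where "fx y t = t *\<^sub>R (blinfun_inner_left (y - x0) o\<^sub>L Blinfun (?D (z y t)))
      + blinfun_inner_left (a (z y t))" for y t
  have fx_apply: "blinfun_apply (fx y t) w = t * (?D (z y t) w \<bullet> (y - x0)) + a (z y t) \<bullet> w"
    if "y \<in> ?U" "t \<in> cbox 0 1" for y t w
    using z_in[OF that] by (simp add: fx_def blinfun.bilinear_simps Blinfun_frechet_derivative[OF a] inner_commute)
  have cont_z: "continuous_on (?U \<times> cbox 0 1) (\<lambda>p. z (fst p) (snd p))"
    unfolding z_def by (intro continuous_intros)
  have z_img: "(\<lambda>p. z (fst p) (snd p)) ` (?U \<times> cbox 0 1) \<subseteq> ?U"
    using z_in by auto
  have cont_a: "continuous_on (?U \<times> cbox 0 1) (\<lambda>p. a (z (fst p) (snd p)))"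
    by (rule continuous_on_compose2[OF Cinf_on_imp_continuous_on[OF a] cont_z z_img])
  have cont_D: "continuous_on (?U \<times> cbox 0 1) (\<lambda>p. Blinfun (?D (z (fst p) (snd p))))"
    by (rule continuous_on_compose2[OF continuous_on_Blinfun_frechet_derivative[OF a] cont_z z_img])
  have cont_fx: "continuous_on (?U \<times> cbox 0 1) (\<lambda>(y, t). fx y t)"
    unfolding fx_def split_beta
    by (intro continuous_intros bounded_linear.continuous_on[OF bounded_linear_blinfun_inner_left]
         cont_a cont_D)
  \<comment> \<open>The potential is the integral of the form along the segment from x0 to
    y.\<close>
  define f where "f y = integral (cbox 0 1) (\<lambda>t. a (z y t) \<bullet> (y - x0))" for y
  have "(f has_derivative (\<lambda>w. a y \<bullet> w)) (at y)" if y: "y \<in> ?U" for y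
  proof -
    have cont_line: "continuous_on (cbox 0 1) (\<lambda>t. Pair y t)"
      by (intro continuous_intros)
    have line_img: "Pair y ` cbox 0 1 \<subseteq> ?U \<times> cbox 0 1"
      using y by auto
    have "((\<lambda>y. integral (cbox 0 1) (\<lambda>t. a (z y t) \<bullet> (y - x0))) has_derivative
        blinfun_apply (integral (cbox 0 1) (fx y))) (at y within ?U)"
    proof (rule leibniz_rule[OF _ _ cont_fx y convex_ball])
      fix x t assume x: "x \<in> ?U" and t: "t \<in> cbox (0::real) 1"
      have dz: "((\<lambda>x. z x t) has_derivative (\<lambda>w. t *\<^sub>R w)) (at x within ?U)"
        unfolding z_def by (auto intro!: derivative_eq_intros)
      have "((\<lambda>x. a (z x t)) has_derivative (\<lambda>w. ?D (z x t) (t *\<^sub>R w))) (at x within ?U)"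
        by (rule has_derivative_compose[OF dz der_a[OF z_in[OF x t]]])
      then have "((\<lambda>x. a (z x t) \<bullet> (x - x0)) has_derivative
          (\<lambda>w. a (z x t) \<bullet> w + ?D (z x t) (t *\<^sub>R w) \<bullet> (x - x0))) (at x within ?U)"
        by (auto intro!: derivative_eq_intros)
      moreover have "(\<lambda>w. a (z x t) \<bullet> w + ?D (z x t) (t *\<^sub>R w) \<bullet> (x - x0)) = blinfun_apply (fx x t)"
        using has_derivative_linear[OF der_a[OF z_in[OF x t]]]
        by (simp add: fun_eq_iff fx_apply[OF x t] linear_cmul)
      ultimately show "((\<lambda>x. a (z x t) \<bullet> (x - x0)) has_derivative blinfun_apply (fx x t)) (at x within ?U)"
        by simp
    next
      fix x assume x: "x \<in> ?U"
      have "continuous_on (cbox 0 1) (\<lambda>t. a (z x t))"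
        unfolding z_def
        by (rule continuous_on_compose2[OF Cinf_on_imp_continuous_on[OF a]])
           (use z_in[OF x] in \<open>auto simp: z_def intro!: continuous_intros\<close>)
      then show "(\<lambda>t. a (z x t) \<bullet> (x - x0)) integrable_on cbox 0 1"
        by (intro integrable_continuous continuous_intros)
    qed
    then have der: "(f has_derivative blinfun_apply (integral (cbox 0 1) (fx y))) (at y)"
      unfolding f_def[abs_def] at_within_open[OF y open_ball] .
    have "blinfun_apply (integral (cbox 0 1) (fx y)) w = a y \<bullet> w" for w
    proof -
      have "fx y integrable_on cbox 0 1"
        using continuous_on_compose2[OF cont_fx cont_line line_img] by (intro integrable_continuous) simp
      then have "blinfun_apply (integral (cbox 0 1) (fx y)) w = integral (cbox 0 1) (\<lambda>t. fx y t w)"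
        by (rule blinfun_apply_integral)
      \<comment> \<open>Closedness enters here: \<open>sym\<close> exchanges w with y - x0, after
        which the integrand is the t-derivative of
        \<open>t * (a (z y t) \<bullet> w)\<close>.\<close>
      also have "\<dots> = integral {0..1} (\<lambda>t. t * (?D (z y t) (y - x0) \<bullet> w) + a (z y t) \<bullet> w)"
        using z_in[OF y] by (auto intro!: integral_cong simp: fx_apply[OF y] sym)
      also have "\<dots> = 1 * (a (z y 1) \<bullet> w) - 0 * (a (z y 0) \<bullet> w)"
      proof (rule integral_unique[OF fundamental_theorem_of_calculus])
        fix t :: real assume t: "t \<in> {0..1}"
        have dz: "((\<lambda>t. z y t) has_derivative (\<lambda>s. s *\<^sub>R (y - x0))) (at t within {0..1})"
          unfolding z_def by (auto intro!: derivative_eq_intros)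
        have za: "z y t \<in> ?U" using z_in[OF y, of t] t by simp
        have "((\<lambda>t. a (z y t)) has_derivative (\<lambda>s. ?D (z y t) (s *\<^sub>R (y - x0)))) (at t within {0..1})"
          by (rule has_derivative_compose[OF dz der_a[OF za]])
        then have "((\<lambda>t. t * (a (z y t) \<bullet> w)) has_derivative
           (\<lambda>s. t * (?D (z y t) (s *\<^sub>R (y - x0)) \<bullet> w) + s * (a (z y t) \<bullet> w))) (at t within {0..1})"
          by (auto intro!: derivative_eq_intros)
        then show "((\<lambda>t. t * (a (z y t) \<bullet> w)) has_vector_derivative
            t * (?D (z y t) (y - x0) \<bullet> w) + a (z y t) \<bullet> w) (at t within {0..1})"
          unfolding has_vector_derivative_def using has_derivative_linear[OF der_a[OF za]]
          by (simp add: linear_cmul distrib_left mult.left_commute add.commute)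
      qed simp
      finally show ?thesis by (simp add: z_def)
    qed
    then have "blinfun_apply (integral (cbox 0 1) (fx y)) = (\<lambda>w. a y \<bullet> w)" by (rule ext)
    with der show ?thesis by simp
  qed
  then show thesis by (rule that)
qed

text \<open>The inverse function theorem, cut down so that the image is a ball. Convexity of the
  ball will allow two points of a fibre to be joined by a segment in the image, and the identity for
  g' will give the velocity of the lifted segment.\<close>

lemma local_diffeo_onto_ball:
  fixes f :: "'e::euclidean_space \<Rightarrow> 'e"
  assumes S: "open S" "x0 \<in> S" and f: "Cinf_on S f"
    and inj: "\<And>w. frechet_derivative f (at x0) w = 0 \<Longrightarrow> w = 0"
  obtains U r g g' where "open U" "x0 \<in> U" "U \<subseteq> S" "r > 0" "homeomorphism U (ball (f x0) r) f g"
    "\<And>z. z \<in> ball (f x0) r \<Longrightarrow> (g has_derivative g' z) (at z)"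
    "\<And>z w. z \<in> ball (f x0) r \<Longrightarrow> frechet_derivative f (at (g z)) (g' z w) = w"
proof -
  let ?f' = "\<lambda>x. Blinfun (frechet_derivative f (at x))"
  let ?L = "frechet_derivative f (at x0)"
  have L: "linear ?L" using Cinf_on_has_derivative[OF f S(2)] by (rule has_derivative_linear)
  then have "inj ?L" using inj by (simp add: linear_injective_0)
  then obtain h where h: "linear h" "h \<circ> ?L = id"
    using linear_injective_left_inverse[OF L] by blast
  have *: "blinfun_apply (Blinfun h) = h"
    using h(1) by (simp add: bounded_linear_Blinfun_apply linear_conv_bounded_linear)
  have der: "(f has_derivative blinfun_apply (?f' x)) (at x)" if "x \<in> S" for x
    using Cinf_on_has_derivative[OF f that] by (simp add: Blinfun_frechet_derivative[OF f that])
  have inv: "Blinfun h o\<^sub>L ?f' x0 = id_blinfun"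
    using h(2) by (intro blinfun_eqI) (simp add: * Blinfun_frechet_derivative[OF f S(2)] fun_eq_iff)
  obtain U' V g g' where U': "open U'" "U' \<subseteq> S" "x0 \<in> U'" and V: "open V" "f x0 \<in> V"
    and hom: "homeomorphism U' V f g"
    and g: "\<And>y. y \<in> V \<Longrightarrow> (g has_derivative (g' y)) (at y)"
    and g': "\<And>y. y \<in> V \<Longrightarrow> g' y = inv (blinfun_apply (?f' (g y)))"
    and bij: "\<And>y. y \<in> V \<Longrightarrow> bij (blinfun_apply (?f' (g y)))"
    by (rule inverse_function_theorem[OF S(1) der continuous_on_Blinfun_frechet_derivative[OF f] S(2) inv])
       (assumption, rule that)
  obtain r where r: "r > 0" "ball (f x0) r \<subseteq> V" using V open_contains_ball by blast
  let ?U = "U' \<inter> f -` ball (f x0) r"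
  have cont: "continuous_on U' f" using hom by (simp add: homeomorphism_def)
  have sub: "f ` ?U = ball (f x0) r"
  proof -
    have "f ` ?U = f ` U' \<inter> ball (f x0) r" by blast
    then show ?thesis using hom r(2) by (auto simp: homeomorphism_def)
  qed
  show thesis
  proof (rule that[of ?U r g g'])
    show "open ?U" by (rule continuous_open_preimage[OF cont U'(1) open_ball])
    show "homeomorphism ?U (ball (f x0) r) f g"
      by (rule homeomorphism_of_subsets[OF hom _ r(2) sub]) auto
    fix z assume z: "z \<in> ball (f x0) r"
    then have zV: "z \<in> V" using r by auto
    then show "(g has_derivative g' z) (at z)" by (rule g)
    have "g z \<in> S" using hom zV U'(2) by (auto simp: homeomorphism_def)
    then show "frechet_derivative f (at (g z)) (g' z w) = w" for w
      using bij[OF zV] by (simp add: g'[OF zV] Blinfun_frechet_derivative[OF f] bij_is_surj surj_f_inv_f)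
  qed (use U' r in auto)
qed

section \<open>Tangent vectors and smooth vector fields\<close>

locale smooth_manifold =
  fixes A :: "('m::topological_space, 'e::euclidean_space) atlas"
  assumes atlas: "smooth_atlas A"
begin

lemma chart_at: obtains U \<phi> where "(U, \<phi>) \<in> A" "p \<in> U"
proof -
  have "p \<in> (\<Union>(U, \<phi>)\<in>A. U)" using atlas by (simp add: smooth_atlas_def)
  then show thesis using that by auto
qed

context
  fixes U \<phi> assumes chart: "(U, \<phi>) \<in> A"
begin

lemma chart_open: "open U" "open (\<phi> ` U)"
  and chart_homeomorphism: "homeomorphism U (\<phi> ` U) \<phi> (inv_into U \<phi>)"
  using atlas chart unfolding smooth_atlas_def by auto

lemma chart_continuous: "continuous_on U \<phi>" "continuous_on (\<phi> ` U) (inv_into U \<phi>)"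
  and chart_inv: "p \<in> U \<Longrightarrow> inv_into U \<phi> (\<phi> p) = p"
  using chart_homeomorphism by (auto simp: homeomorphism_def)

lemma chart_image_Int: "\<phi> ` (U \<inter> T) = \<phi> ` U \<inter> inv_into U \<phi> -` T"
  using chart_inv by force

lemma open_chart_image: "open T \<Longrightarrow> open (\<phi> ` (U \<inter> T))"
  unfolding chart_image_Int
  by (rule continuous_open_preimage[OF chart_continuous(2) chart_open(2)])

lemma open_chart_preimage: "open T \<Longrightarrow> open (U \<inter> \<phi> -` T)"
  by (rule continuous_open_preimage[OF chart_continuous(1) chart_open(1)])

end

lemma transition_smooth:
  "(U, \<phi>) \<in> A \<Longrightarrow> (V, \<psi>) \<in> A \<Longrightarrow> Cinf_on (\<phi> ` (U \<inter> V)) (\<psi> \<circ> inv_into U \<phi>)"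
  using atlas unfolding smooth_atlas_def by auto

lemma smooth_onI:
  "open S \<Longrightarrow> (\<And>U \<phi>. (U, \<phi>) \<in> A \<Longrightarrow> Cinf_on (\<phi> ` (U \<inter> S)) (\<lambda>y. f (inv_into U \<phi> y))) \<Longrightarrow> smooth_on A S f"
  unfolding smooth_on_def by (auto simp: comp_def)

lemma smooth_onD:
  assumes "smooth_on A S f"
  shows smooth_on_open: "open S"
    and smooth_on_chart: "(U, \<phi>) \<in> A \<Longrightarrow> Cinf_on (\<phi> ` (U \<inter> S)) (\<lambda>y. f (inv_into U \<phi> y))"
  using assms unfolding smooth_on_def by (auto simp: comp_def)

lemma smooth_on_cong:
  assumes "smooth_on A S f" "\<And>x. x \<in> S \<Longrightarrow> f x = g x"
  shows "smooth_on A S g"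
proof (rule smooth_onI)
  fix U \<phi> assume c: "(U, \<phi>) \<in> A"
  show "Cinf_on (\<phi> ` (U \<inter> S)) (\<lambda>y. g (inv_into U \<phi> y))"
    by (rule Cinf_on_cong[OF open_chart_image[OF c smooth_on_open[OF assms(1)]] _ smooth_on_chart[OF assms(1) c]])
       (auto simp: chart_inv[OF c] assms(2))
qed (rule smooth_on_open[OF assms(1)])

lemma smooth_on_subset: "smooth_on A S f \<Longrightarrow> T \<subseteq> S \<Longrightarrow> open T \<Longrightarrow> smooth_on A T f"
  by (rule smooth_onI) (auto intro: Cinf_on_subset dest: smooth_on_chart)

lemma smooth_on_const: "open S \<Longrightarrow> smooth_on A S (\<lambda>x. c)"
  by (rule smooth_onI) (simp_all add: Cinf_on_const open_chart_image)

lemma smooth_on_add: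
  "smooth_on A S f \<Longrightarrow> smooth_on A S g \<Longrightarrow> smooth_on A S (\<lambda>x. f x + g x)"
  by (rule smooth_onI) (simp_all add: Cinf_on_add open_chart_image smooth_onD)

lemma smooth_on_mult:
  fixes f g :: "'m \<Rightarrow> real"
  shows "smooth_on A S f \<Longrightarrow> smooth_on A S g \<Longrightarrow> smooth_on A S (\<lambda>x. f x * g x)"
  by (rule smooth_onI) (simp_all add: Cinf_on_mult open_chart_image smooth_onD)

text \<open>Read in another chart, the function is h after a transition map. This carries the
  potentials found in one chart back to the manifold.\<close>

lemma smooth_on_compose_chart:
  assumes c: "(U, \<phi>) \<in> A" and T: "open T" "T \<subseteq> \<phi> ` U" and h: "Cinf_on T h"
  shows "smooth_on A (U \<inter> \<phi> -` T) (\<lambda>x. h (\<phi> x))"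
proof (rule smooth_onI)
  show o: "open (U \<inter> \<phi> -` T)" by (rule open_chart_preimage[OF c T(1)])
  fix V \<psi> assume d: "(V, \<psi>) \<in> A"
  have "Cinf_on (\<psi> ` (V \<inter> (U \<inter> \<phi> -` T))) (\<lambda>y. \<phi> (inv_into V \<psi> y))"
    using Cinf_on_subset[OF transition_smooth[OF d c], of "\<psi> ` (V \<inter> (U \<inter> \<phi> -` T))"]
    by (auto simp: comp_def)
  moreover have "(\<lambda>y. \<phi> (inv_into V \<psi> y)) ` \<psi> ` (V \<inter> (U \<inter> \<phi> -` T)) \<subseteq> T"
    by (auto simp: chart_inv[OF d])
  ultimately show "Cinf_on (\<psi> ` (V \<inter> (U \<inter> \<phi> -` T))) (\<lambda>y. h (\<phi> (inv_into V \<psi> y)))"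
    using Cinf_on_compose[OF open_chart_image[OF d o] T(1) _ _ h] by blast
qed

lemma smooth_on_chart_coord:
  assumes c: "(U, \<phi>) \<in> A" shows "smooth_on A U (\<lambda>x. \<phi> x \<bullet> b)"
proof (rule smooth_onI)
  fix V \<psi> assume d: "(V, \<psi>) \<in> A"
  show "Cinf_on (\<psi> ` (V \<inter> U)) (\<lambda>y. \<phi> (inv_into V \<psi> y) \<bullet> b)"
    using Cinf_on_inner_const[OF open_chart_image[OF d chart_open(1)[OF c]] transition_smooth[OF d c]]
    by (simp add: comp_def)
qed (rule chart_open[OF c])

lemma smooth_near_cong:
  assumes "open S" "p \<in> S" "\<And>x. x \<in> S \<Longrightarrow> f x = g x" "smooth_near A p f"
  shows "smooth_near A p g"
proof -
  from assms(4) obtain T where T: "p \<in> T" "smooth_on A T f" unfolding smooth_near_def by blast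
  have "smooth_on A (S \<inter> T) g"
    by (rule smooth_on_cong[OF smooth_on_subset[OF T(2)]]) (use assms T smooth_on_open in auto)
  then show ?thesis unfolding smooth_near_def using assms(2) T(1) by blast
qed

lemma smooth_near_has_derivative:
  assumes c: "(U, \<phi>) \<in> A" and p: "p \<in> U" and f: "smooth_near A p f"
  shows "((\<lambda>y. f (inv_into U \<phi> y)) has_derivative (\<lambda>w. chart_tvec A U \<phi> p w f)) (at (\<phi> p))"
proof -
  from f obtain S where S: "p \<in> S" "smooth_on A S f" unfolding smooth_near_def by blast
  have "((\<lambda>y. f (inv_into U \<phi> y)) has_derivative
      frechet_derivative (\<lambda>y. f (inv_into U \<phi> y)) (at (\<phi> p))) (at (\<phi> p))"
    by (rule Cinf_on_has_derivative[OF smooth_on_chart[OF S(2) c]]) (use p S(1) in auto)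
  moreover have "(\<lambda>w. chart_tvec A U \<phi> p w f) = frechet_derivative (\<lambda>y. f (inv_into U \<phi> y)) (at (\<phi> p))"
    using f by (simp add: chart_tvec_def comp_def)
  ultimately show ?thesis by simp
qed

lemma chart_tvec_eqI:
  assumes c: "(U, \<phi>) \<in> A" and p: "p \<in> U" and f: "smooth_near A p f"
    and "((\<lambda>y. f (inv_into U \<phi> y)) has_derivative D) (at (\<phi> p))"
  shows "chart_tvec A U \<phi> p w f = D w"
  using has_derivative_unique[OF smooth_near_has_derivative[OF c p f] assms(4)] by (rule fun_cong)

lemma chart_tvec_not_smooth: "\<not> smooth_near A p f \<Longrightarrow> chart_tvec A U \<phi> p w f = 0"
  by (simp add: chart_tvec_def)

lemma linear_chart_tvec:
  assumes c: "(U, \<phi>) \<in> A" and p: "p \<in> U"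
  shows "linear (chart_tvec A U \<phi> p)"
proof (rule linearI; rule ext)
  fix v w f
  show "chart_tvec A U \<phi> p (v + w) f = (chart_tvec A U \<phi> p v + chart_tvec A U \<phi> p w) f"
    using linear_add[OF has_derivative_linear[OF smooth_near_has_derivative[OF c p, of f]]]
    by (cases "smooth_near A p f") (simp_all add: chart_tvec_not_smooth)
next
  fix r v f
  show "chart_tvec A U \<phi> p (r *\<^sub>R v) f = (r *\<^sub>R chart_tvec A U \<phi> p v) f"
    using linear_cmul[OF has_derivative_linear[OF smooth_near_has_derivative[OF c p, of f]]]
    by (cases "smooth_near A p f") (simp_all add: scaleR_fun_def chart_tvec_not_smooth)
qed

text \<open>The chain rule through the transition map. Functions not smooth near p give 0 on both
  sides, so the functionals agree everywhere. Consequently \<open>tangent\<close>, a union over all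
  charts at p, is the linear image under any single one of them.\<close>

lemma chart_tvec_change:
  assumes c: "(U, \<phi>) \<in> A" "p \<in> U" and d: "(V, \<psi>) \<in> A" "p \<in> V"
  shows "chart_tvec A V \<psi> p w =
    chart_tvec A U \<phi> p (frechet_derivative (\<phi> \<circ> inv_into V \<psi>) (at (\<psi> p)) w)"
proof
  fix f
  let ?\<tau> = "\<phi> \<circ> inv_into V \<psi>"
  show "chart_tvec A V \<psi> p w f = chart_tvec A U \<phi> p (frechet_derivative ?\<tau> (at (\<psi> p)) w) f"
  proof (cases "smooth_near A p f")
    case True
    have \<tau>: "(?\<tau> has_derivative frechet_derivative ?\<tau> (at (\<psi> p))) (at (\<psi> p))"
      by (rule Cinf_on_has_derivative[OF transition_smooth[OF d(1) c(1)]]) (use c d in auto)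
    have f: "((\<lambda>y. f (inv_into U \<phi> y)) has_derivative (\<lambda>w. chart_tvec A U \<phi> p w f)) (at (?\<tau> (\<psi> p)))"
      using smooth_near_has_derivative[OF c True] d by (simp add: chart_inv[OF d(1)])
    have "((\<lambda>y. f (inv_into U \<phi> (?\<tau> y))) has_derivative
        (\<lambda>w. chart_tvec A U \<phi> p (frechet_derivative ?\<tau> (at (\<psi> p)) w) f)) (at (\<psi> p))"
      by (rule has_derivative_compose[OF \<tau> f])
    then have "((\<lambda>y. f (inv_into V \<psi> y)) has_derivative
        (\<lambda>w. chart_tvec A U \<phi> p (frechet_derivative ?\<tau> (at (\<psi> p)) w) f)) (at (\<psi> p))"
    proof (rule has_derivative_transform_within_open)
      show "open (\<psi> ` (V \<inter> U))" by (rule open_chart_image[OF d(1) chart_open(1)[OF c(1)]])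
      show "\<psi> p \<in> \<psi> ` (V \<inter> U)" using c d by auto
    qed (auto simp: chart_inv[OF c(1)] chart_inv[OF d(1)])
    then show ?thesis by (rule chart_tvec_eqI[OF d True])
  qed (simp add: chart_tvec_not_smooth)
qed

lemma tangent_eq_range:
  assumes c: "(U, \<phi>) \<in> A" "p \<in> U"
  shows "tangent A p = range (chart_tvec A U \<phi> p)"
proof
  show "tangent A p \<subseteq> range (chart_tvec A U \<phi> p)"
    unfolding tangent_def by (auto simp: chart_tvec_change[OF c])
  show "range (chart_tvec A U \<phi> p) \<subseteq> tangent A p"
    unfolding tangent_def using c by blast
qed

lemma subspace_tangent: "subspace (tangent A p)"
proof -
  obtain U \<phi> where c: "(U, \<phi>) \<in> A" "p \<in> U" by (rule chart_at)
  show ?thesis unfolding tangent_eq_range[OF c]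
    by (rule linear_subspace_image[OF linear_chart_tvec[OF c] subspace_UNIV])
qed

text \<open>Testing on the coordinate functions recovers w. Thus \<open>chart_tvec\<close> is
  injective in w, and \<open>mdiff \<phi>\<close> is its inverse on the tangent space.\<close>

lemma mdiff_chart_tvec:
  assumes c: "(U, \<phi>) \<in> A" "p \<in> U"
  shows "mdiff \<phi> (chart_tvec A U \<phi> p w) = w"
proof -
  have near: "smooth_near A p (\<lambda>x. \<phi> x \<bullet> b)" for b
    unfolding smooth_near_def using smooth_on_chart_coord[OF c(1)] c(2) by blast
  have "chart_tvec A U \<phi> p w (\<lambda>x. \<phi> x \<bullet> b) = w \<bullet> b" for b
  proof (rule chart_tvec_eqI[OF c near])
    have "((\<lambda>y. y \<bullet> b) has_derivative (\<lambda>w. w \<bullet> b)) (at (\<phi> p))"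
      by (auto intro!: derivative_eq_intros)
    then show "((\<lambda>y. \<phi> (inv_into U \<phi> y) \<bullet> b) has_derivative (\<lambda>w. w \<bullet> b)) (at (\<phi> p))"
      by (rule has_derivative_transform_within_open[OF _ chart_open(2)[OF c(1)]])
         (use c in \<open>auto simp: f_inv_into_f\<close>)
  qed
  then show ?thesis by (simp add: mdiff_def euclidean_representation)
qed

lemma chart_tvec_mdiff:
  assumes c: "(U, \<phi>) \<in> A" "p \<in> U" and "v \<in> tangent A p"
  shows "chart_tvec A U \<phi> p (mdiff \<phi> v) = v"
  using assms(3) mdiff_chart_tvec[OF c] unfolding tangent_eq_range[OF c] by auto

lemma tangent_apply:
  assumes c: "(U, \<phi>) \<in> A" "p \<in> U" and v: "v \<in> tangent A p" and f: "smooth_near A p f"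
    and "((\<lambda>y. f (inv_into U \<phi> y)) has_derivative D) (at (\<phi> p))"
  shows "v f = D (mdiff \<phi> v)"
  using chart_tvec_eqI[OF c f assms(5)] chart_tvec_mdiff[OF c v] by metis

lemma tangent_not_smooth: "v \<in> tangent A p \<Longrightarrow> \<not> smooth_near A p f \<Longrightarrow> v f = 0"
  unfolding tangent_def by (auto simp: chart_tvec_not_smooth)

text \<open>A tangent vector sees only the germ. Smoothness near p also depends only on the germ, so
  the default value 0 for other functions is respected.\<close>

lemma tangent_local:
  assumes v: "v \<in> tangent A p" and S: "open S" "p \<in> S" and eq: "\<And>x. x \<in> S \<Longrightarrow> f x = g x"
  shows "v f = v g"
proof (cases "smooth_near A p f")
  case True
  note g = smooth_near_cong[OF S eq True]
  obtain U \<phi> where c: "(U, \<phi>) \<in> A" "p \<in> U" by (rule chart_at)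
  have "((\<lambda>y. g (inv_into U \<phi> y)) has_derivative (\<lambda>w. chart_tvec A U \<phi> p w f)) (at (\<phi> p))"
    by (rule has_derivative_transform_within_open[OF smooth_near_has_derivative[OF c True]
          open_chart_image[OF c(1) S(1)]])
       (use c S eq in \<open>auto simp: chart_inv[OF c(1)]\<close>)
  from tangent_apply[OF c v g this] show ?thesis by (simp add: chart_tvec_mdiff[OF c v])
next
  case False
  have "\<not> smooth_near A p g"
    using smooth_near_cong[OF S, of g f] eq False by auto
  then show ?thesis using False tangent_not_smooth[OF v] by simp
qed

lemma tangent_const: 
  assumes v: "v \<in> tangent A p" shows "v (\<lambda>_. c) = 0"
proof -
  obtain U \<phi> where c: "(U, \<phi>) \<in> A" "p \<in> U" by (rule chart_at)
  have "smooth_near A p (\<lambda>_. c)"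
    unfolding smooth_near_def using smooth_on_const[of UNIV c] by auto
  from tangent_apply[OF c v this has_derivative_const] show ?thesis .
qed

text \<open>Functionals form an infinite-dimensional space, so the count takes place in the span of
  the images of \<open>Basis\<close>: a tangent vector outside \<open>span B\<close> would yield
  more than DIM('e) independent vectors in the span of at most DIM('e) generators.\<close>

lemma span_eq_tangent:
  assumes "B \<subseteq> tangent A p" "independent B" "card B = DIM('e)"
  shows "span B = tangent A p"
proof
  show "span B \<subseteq> tangent A p" by (rule span_minimal[OF assms(1) subspace_tangent])
  obtain U \<phi> where c: "(U, \<phi>) \<in> A" "p \<in> U" by (rule chart_at)
  let ?T = "chart_tvec A U \<phi> p ` Basis"
  have T: "tangent A p = span ?T"
    unfolding tangent_eq_range[OF c] linear_span_image[OF linear_chart_tvec[OF c]] by (simp add: span_Basis)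
  have fin: "finite ?T" and card: "card ?T \<le> DIM('e)" by (auto simp: card_image_le)
  have "finite B" using assms(3) card.infinite by fastforce
  show "tangent A p \<subseteq> span B"
  proof
    fix x assume x: "x \<in> tangent A p"
    show "x \<in> span B"
    proof (rule ccontr)
      assume "x \<notin> span B"
      then have "independent (insert x B)" and "x \<notin> B"
        using assms(2) by (auto simp: independent_insert span_base)
      moreover have "insert x B \<subseteq> span ?T" using assms(1) x T by auto
      ultimately have "card (insert x B) \<le> card ?T"
        using independent_span_bound[OF fin] by blast
      then show False using card assms(3) \<open>x \<notin> B\<close> \<open>finite B\<close> by simp
    qed
  qed
qed

lemma smooth_vfield_tangent: "smooth_vfield A E \<Longrightarrow> E p \<in> tangent A p"
  unfolding smooth_vfield_def by blast

lemma smooth_vfield_apply: "smooth_vfield A E \<Longrightarrow> smooth_on A S f \<Longrightarrow> smooth_on A S (\<lambda>p. E p f)"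
  unfolding smooth_vfield_def by blast

lemma smooth_vfield_add:
  "smooth_vfield A E \<Longrightarrow> smooth_vfield A F \<Longrightarrow> smooth_vfield A (E + F)"
  by (simp add: smooth_vfield_def subspace_add[OF subspace_tangent] smooth_on_add)

lemma smooth_vfield_fscale:
  "smooth_on A UNIV f \<Longrightarrow> smooth_vfield A E \<Longrightarrow> smooth_vfield A (fscale f E)"
  unfolding smooth_vfield_def fscale_def
proof (intro conjI allI impI)
  fix S and h :: "'m \<Rightarrow> real" assume f: "smooth_on A UNIV f" and h: "smooth_on A S h"
    and E: "(\<forall>p. E p \<in> tangent A p) \<and> (\<forall>S f. smooth_on A S f \<longrightarrow> smooth_on A S (\<lambda>p. E p f))"
  have "smooth_on A S (\<lambda>p. f p * E p h)"
    using E h by (intro smooth_on_mult smooth_on_subset[OF f]) (auto dest: smooth_on_open)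
  then show "smooth_on A S (\<lambda>p. (f p *\<^sub>R E p) h)" by (simp add: scaleR_fun_def)
qed (auto intro: subspace_scale[OF subspace_tangent])

lemma fscale_const: "fscale (\<lambda>_. c) E = c *\<^sub>R E"
  by (simp add: fscale_def scaleR_fun_def)

lemma smooth_vfield_scaleR: "smooth_vfield A E \<Longrightarrow> smooth_vfield A (c *\<^sub>R E)"
  using smooth_vfield_fscale[OF smooth_on_const[OF open_UNIV]] by (metis fscale_const)

lemma smooth_vfield_minus: "smooth_vfield A E \<Longrightarrow> smooth_vfield A (- E)"
  using smooth_vfield_scaleR[of E "-1"] by simp

lemma smooth_vfield_diff:
  "smooth_vfield A E \<Longrightarrow> smooth_vfield A F \<Longrightarrow> smooth_vfield A (E - F)"
  using smooth_vfield_add[of E "- F"] smooth_vfield_minus[of F] by simp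

lemma smooth_vfield_zero: "smooth_vfield A 0"
  by (simp add: smooth_vfield_def subspace_0[OF subspace_tangent] smooth_on_const smooth_on_open)

lemma smooth_near_vfield:
  assumes "smooth_vfield A E" "smooth_near A p f" shows "smooth_near A p (\<lambda>q. E q f)"
  using assms smooth_vfield_apply unfolding smooth_near_def by blast

definition coords :: "'m set \<Rightarrow> ('m \<Rightarrow> 'e) \<Rightarrow> 'm vfield \<Rightarrow> 'e \<Rightarrow> 'e"
  where "coords U \<phi> E y = mdiff \<phi> (E (inv_into U \<phi> y))"

lemma coords_inner:
  "b \<in> Basis \<Longrightarrow> coords U \<phi> E y \<bullet> b = E (inv_into U \<phi> y) (\<lambda>x. \<phi> x \<bullet> b)"
  by (simp add: coords_def mdiff_def inner_sum_left inner_Basis if_distrib cong: if_cong)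

lemma Cinf_on_coords:
  assumes c: "(U, \<phi>) \<in> A" and E: "smooth_vfield A E"
  shows "Cinf_on (\<phi> ` U) (coords U \<phi> E)"
proof -
  have "Cinf_on (\<phi> ` U) (\<lambda>y. E (inv_into U \<phi> y) (\<lambda>x. \<phi> x \<bullet> b))" for b
    using smooth_on_chart[OF smooth_vfield_apply[OF E smooth_on_chart_coord[OF c]] c] by simp
  then show ?thesis
    unfolding coords_def[abs_def] mdiff_def
    by (intro Cinf_on_sum Cinf_on_scaleR Cinf_on_const chart_open[OF c])
qed

text \<open>The classical component formula of the bracket. It connects the bracket of derivations
  with Frechet calculus in a chart, where the exterior derivatives of the coframe are
  computed.\<close>

lemma coords_lie_bracket:
  assumes c: "(U, \<phi>) \<in> A" and E: "smooth_vfield A E" and F: "smooth_vfield A F" and y: "y \<in> \<phi> ` U"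
  shows "coords U \<phi> (lie_bracket A E F) y =
    frechet_derivative (coords U \<phi> F) (at y) (coords U \<phi> E y) -
    frechet_derivative (coords U \<phi> E) (at y) (coords U \<phi> F y)"
proof (rule euclidean_eqI)
  fix b :: 'e assume b: "b \<in> Basis"
  let ?x = "\<lambda>x. \<phi> x \<bullet> b"
  define p where "p = inv_into U \<phi> y"
  have p: "p \<in> U" "\<phi> p = y" using y by (auto simp: p_def inv_into_into f_inv_into_f)
  have near: "smooth_near A p ?x"
    unfolding smooth_near_def using smooth_on_chart_coord[OF c] p by blast
  \<comment> \<open>Applying H to a coordinate function gives a component of
    \<open>coords U \<phi> H\<close>, so the iterated derivative is a directional derivative of that
    component.\<close>
  have second: "G p (\<lambda>q. H q ?x) = frechet_derivative (coords U \<phi> H) (at y) (coords U \<phi> G y) \<bullet> b"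
    if G: "smooth_vfield A G" and H: "smooth_vfield A H" for G H
  proof -
    have "((\<lambda>y. coords U \<phi> H y \<bullet> b) has_derivative
        (\<lambda>w. frechet_derivative (coords U \<phi> H) (at y) w \<bullet> b)) (at (\<phi> p))"
      using Cinf_on_has_derivative[OF Cinf_on_coords[OF c H] y] p by (auto intro!: derivative_eq_intros)
    then have "((\<lambda>y. H (inv_into U \<phi> y) ?x) has_derivative
        (\<lambda>w. frechet_derivative (coords U \<phi> H) (at y) w \<bullet> b)) (at (\<phi> p))"
      by (simp add: coords_inner[OF b])
    from tangent_apply[OF c p(1) smooth_vfield_tangent[OF G] smooth_near_vfield[OF H near] this]
    show ?thesis by (simp add: coords_def p_def)
  qed
  show "coords U \<phi> (lie_bracket A E F) y \<bullet> b = (frechet_derivative (coords U \<phi> F) (at y) (coords U \<phi> E y) -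
      frechet_derivative (coords U \<phi> E) (at y) (coords U \<phi> F y)) \<bullet> b"
    using near second[OF E F] second[OF F E]
    by (simp add: coords_inner[OF b] lie_bracket_def inner_diff_left flip: p_def)
qed

end

section \<open>The Levi-Civita connection\<close>

lemma scaleR_fun_apply: "(c *\<^sub>R f) x = c *\<^sub>R f x"
  by (simp add: scaleR_fun_def)

locale levi_civita_manifold = smooth_manifold A
  for A :: "('m::topological_space, 'e::euclidean_space) atlas" +
  fixes g :: "'m metric" and nabla :: "'m connection"
  assumes riem: "riemannian_metric A g" and lc: "levi_civita A g nabla"
begin

lemma tangent_closed [simp]:
  "u \<in> tangent A p \<Longrightarrow> v \<in> tangent A p \<Longrightarrow> u + v \<in> tangent A p"
  "u \<in> tangent A p \<Longrightarrow> v \<in> tangent A p \<Longrightarrow> u - v \<in> tangent A p"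
  "u \<in> tangent A p \<Longrightarrow> c *\<^sub>R u \<in> tangent A p"
  "u \<in> tangent A p \<Longrightarrow> - u \<in> tangent A p"
  "0 \<in> tangent A p"
  using subspace_tangent[of p]
  by (auto simp: subspace_add subspace_diff subspace_scale subspace_neg subspace_0)

lemma g_sym: "u \<in> tangent A p \<Longrightarrow> v \<in> tangent A p \<Longrightarrow> g p u v = g p v u"
  using riem unfolding riemannian_metric_def by blast

lemma g_add_left: "u \<in> tangent A p \<Longrightarrow> v \<in> tangent A p \<Longrightarrow> w \<in> tangent A p \<Longrightarrow>
    g p (u + v) w = g p u w + g p v w"
  and g_scale_left: "u \<in> tangent A p \<Longrightarrow> w \<in> tangent A p \<Longrightarrow> g p (c *\<^sub>R u) w = c * g p u w"
  using riem unfolding riemannian_metric_def by blast+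

lemma g_pos: "u \<in> tangent A p \<Longrightarrow> g p u u = 0 \<Longrightarrow> u = 0"
  using riem unfolding riemannian_metric_def by (metis less_irrefl)

lemma g_minus_left: "u \<in> tangent A p \<Longrightarrow> w \<in> tangent A p \<Longrightarrow> g p (- u) w = - g p u w"
  using g_scale_left[of u p w "-1"] by simp

lemma g_diff_left: "u \<in> tangent A p \<Longrightarrow> v \<in> tangent A p \<Longrightarrow> w \<in> tangent A p \<Longrightarrow>
    g p (u - v) w = g p u w - g p v w"
  using g_add_left[of u p "- v" w] g_minus_left[of v p w] by simp

lemma g_zero_left: "w \<in> tangent A p \<Longrightarrow> g p 0 w = 0"
  using g_scale_left[of 0 p w 0] by simp

lemma g_add_right: "u \<in> tangent A p \<Longrightarrow> v \<in> tangent A p \<Longrightarrow> w \<in> tangent A p \<Longrightarrow>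
    g p w (u + v) = g p w u + g p w v"
  and g_scale_right: "u \<in> tangent A p \<Longrightarrow> w \<in> tangent A p \<Longrightarrow> g p w (c *\<^sub>R u) = c * g p w u"
  and g_minus_right: "u \<in> tangent A p \<Longrightarrow> w \<in> tangent A p \<Longrightarrow> g p w (- u) = - g p w u"
  and g_diff_right: "u \<in> tangent A p \<Longrightarrow> v \<in> tangent A p \<Longrightarrow> w \<in> tangent A p \<Longrightarrow>
    g p w (u - v) = g p w u - g p w v"
  and g_zero_right: "w \<in> tangent A p \<Longrightarrow> g p w 0 = 0"
  using g_add_left g_scale_left g_minus_left g_diff_left g_zero_left by (simp_all add: g_sym[of w])

lemmas g_bilinear = g_add_left g_scale_left g_minus_left g_diff_left g_zero_left
  g_add_right g_scale_right g_minus_right g_diff_right g_zero_right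

lemma g_smooth: "smooth_vfield A E \<Longrightarrow> smooth_vfield A F \<Longrightarrow> smooth_on A UNIV (\<lambda>p. g p (E p) (F p))"
  using riem unfolding riemannian_metric_def by blast

lemma nabla_smooth: "smooth_vfield A E \<Longrightarrow> smooth_vfield A F \<Longrightarrow> smooth_vfield A (nabla E F)"
  and nabla_torsion: "smooth_vfield A E \<Longrightarrow> smooth_vfield A F \<Longrightarrow>
    lie_bracket A E F = nabla E F - nabla F E"
  and nabla_fscale_left: "smooth_vfield A E \<Longrightarrow> smooth_vfield A F \<Longrightarrow> smooth_on A UNIV f \<Longrightarrow>
    nabla (fscale f E) F = fscale f (nabla E F)"
  and nabla_fscale_right: "smooth_vfield A E \<Longrightarrow> smooth_vfield A F \<Longrightarrow> smooth_on A UNIV f \<Longrightarrow>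
    nabla E (fscale f F) = fscale (\<lambda>p. E p f) F + fscale f (nabla E F)"
  and nabla_add_left: "smooth_vfield A E \<Longrightarrow> smooth_vfield A F \<Longrightarrow> smooth_vfield A K \<Longrightarrow>
    nabla (E + K) F = nabla E F + nabla K F"
  and nabla_add_right: "smooth_vfield A E \<Longrightarrow> smooth_vfield A F \<Longrightarrow> smooth_vfield A K \<Longrightarrow>
    nabla E (F + K) = nabla E F + nabla E K"
  and nabla_metric: "smooth_vfield A E \<Longrightarrow> smooth_vfield A F \<Longrightarrow> smooth_vfield A K \<Longrightarrow>
    E p (\<lambda>q. g q (F q) (K q)) = g p (nabla E F p) (K p) + g p (F p) (nabla E K p)"
  using lc unfolding levi_civita_def by metis+

lemma nabla_scaleR_left: "smooth_vfield A E \<Longrightarrow> smooth_vfield A F \<Longrightarrow> nabla (c *\<^sub>R E) F = c *\<^sub>R nabla E F"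
  using nabla_fscale_left[OF _ _ smooth_on_const[of UNIV c]] by (simp add: fscale_const)

lemma nabla_scaleR_right:
  assumes "smooth_vfield A E" "smooth_vfield A F" shows "nabla E (c *\<^sub>R F) = c *\<^sub>R nabla E F"
proof -
  have "(\<lambda>p. E p (\<lambda>_. c)) = (\<lambda>_. 0)"
    using tangent_const[OF smooth_vfield_tangent[OF assms(1)]] by auto
  then show ?thesis
    using nabla_fscale_right[OF assms smooth_on_const[of UNIV c]] by (simp add: fscale_const)
qed

text \<open>Torsion-freeness writes the bracket as a difference of two values of
  \<open>nabla\<close>. Its smoothness, and below its additivity and Leibniz rule, are read off from
  the axioms of the connection.\<close>

lemma smooth_vfield_lie_bracket:
  "smooth_vfield A E \<Longrightarrow> smooth_vfield A F \<Longrightarrow> smooth_vfield A (lie_bracket A E F)"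
  by (simp add: nabla_torsion smooth_vfield_diff nabla_smooth)

lemma lie_bracket_antisym: "lie_bracket A E F = - lie_bracket A F E"
  by (simp add: lie_bracket_def fun_eq_iff)

lemma lie_bracket_add_left:
  "smooth_vfield A E \<Longrightarrow> smooth_vfield A F \<Longrightarrow> smooth_vfield A K \<Longrightarrow>
    lie_bracket A (E + K) F = lie_bracket A E F + lie_bracket A K F"
  by (simp add: nabla_torsion smooth_vfield_add nabla_add_left nabla_add_right)

lemma lie_bracket_fscale_left:
  "smooth_vfield A E \<Longrightarrow> smooth_vfield A F \<Longrightarrow> smooth_on A UNIV f \<Longrightarrow>
    lie_bracket A (fscale f E) F = fscale f (lie_bracket A E F) - fscale (\<lambda>p. F p f) E"
  by (simp add: nabla_torsion smooth_vfield_fscale nabla_fscale_left nabla_fscale_right)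
     (simp add: fscale_def fun_eq_iff algebra_simps scaleR_fun_def)

text \<open>Since the inner products are constant, the three derivative terms of the general formula
  vanish. What remains is metric compatibility in three cyclic arrangements, with torsion-freeness
  replacing differences of covariant derivatives by brackets.\<close>

lemma koszul:
  assumes E: "smooth_vfield A E" and F: "smooth_vfield A F" and K: "smooth_vfield A K"
    and const: "\<And>q. g q (E q) (F q) = a" "\<And>q. g q (F q) (K q) = b" "\<And>q. g q (K q) (E q) = c"
  shows "2 * g p (nabla E F p) (K p) = g p (lie_bracket A E F p) (K p)
    - g p (lie_bracket A F K p) (E p) + g p (lie_bracket A K E p) (F p)"
proof -
  note T = smooth_vfield_tangent[where p=p]
  note T' = T[OF E] T[OF F] T[OF K] T[OF nabla_smooth[OF E F]] T[OF nabla_smooth[OF F E]]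
    T[OF nabla_smooth[OF E K]] T[OF nabla_smooth[OF K E]]
    T[OF nabla_smooth[OF F K]] T[OF nabla_smooth[OF K F]]
  have 1: "g p (nabla K E p) (F p) + g p (E p) (nabla K F p) = 0"
    using nabla_metric[OF K E F, of p] tangent_const[OF T[OF K]] by (simp add: const)
  have 2: "g p (nabla E F p) (K p) + g p (F p) (nabla E K p) = 0"
    using nabla_metric[OF E F K, of p] tangent_const[OF T[OF E]] by (simp add: const)
  have 3: "g p (nabla F K p) (E p) + g p (K p) (nabla F E p) = 0"
    using nabla_metric[OF F K E, of p] tangent_const[OF T[OF F]] by (simp add: const)
  show ?thesis
    using 1 2 3 by (simp add: nabla_torsion E F K g_diff_left T' g_sym[of "E p"] g_sym[of "F p"] g_sym[of "K p"])
qed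

text \<open>Uniqueness, needed for the definite description: the difference of two candidates lies
  in D and is orthogonal to D, hence to itself.\<close>

lemma ortho_proj_eq:
  assumes D: "subspace (D p)" "D p \<subseteq> tangent A p" and v: "v \<in> tangent A p" and w: "w \<in> D p"
    and orth: "\<And>u. u \<in> D p \<Longrightarrow> g p (v - w) u = 0"
  shows "ortho_proj g D p v = w"
  unfolding ortho_proj_def
proof (rule the_equality)
  fix w' assume w': "w' \<in> D p \<and> (\<forall>u\<in>D p. g p (v - w') u = 0)"
  then have d: "w' - w \<in> D p" using w D(1) by (simp add: subspace_diff)
  have "g p (w' - w) (w' - w) = g p ((v - w) - (v - w')) (w' - w)" by simp
  also have "\<dots> = g p (v - w) (w' - w) - g p (v - w') (w' - w)"
    using D v w w' d by (intro g_diff_left tangent_closed) auto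
  also have "\<dots> = 0" using orth[OF d] w' d by simp
  finally have "w' - w = 0" using g_pos[of "w' - w" p] d D(2) by blast
  then show "w' = w" by simp
qed (use w orth in auto)

lemma g_sum_list_left:
  assumes "\<And>x. x \<in> set xs \<Longrightarrow> f x \<in> tangent A p" and w: "w \<in> tangent A p"
  shows "(\<Sum>x\<leftarrow>xs. f x) \<in> tangent A p" "g p (\<Sum>x\<leftarrow>xs. f x) w = (\<Sum>x\<leftarrow>xs. g p (f x) w)"
  using assms(1) by (induction xs) (auto simp: g_bilinear w)

text \<open>The sum is linear in u, so span induction leaves the members of the list, where
  orthonormality selects a single summand.\<close>

lemma orthonormal_basis_expansion:
  assumes b: "orthonormal_basis (g p) S vs" and S: "S \<subseteq> tangent A p" and u: "u \<in> S"
  shows "(\<Sum>v\<leftarrow>vs. g p u v *\<^sub>R v) = u"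
proof -
  have on: "orthonormal (g p) vs" and S_eq: "span (set vs) = S"
    using b by (auto simp: orthonormal_basis_def)
  have vs: "set vs \<subseteq> tangent A p" using S_eq S span_superset by blast
  let ?P = "\<lambda>u. (\<Sum>v\<leftarrow>vs. g p u v *\<^sub>R v)"
  have scale: "?P (c *\<^sub>R u) = c *\<^sub>R ?P u" if "u \<in> tangent A p" for c u
    using vs by (induction vs) (auto simp: g_scale_left that scaleR_right_distrib)
  have add: "?P (u + u') = ?P u + ?P u'" if "u \<in> tangent A p" "u' \<in> tangent A p" for u u'
    using vs by (induction vs) (auto simp: g_add_left that scaleR_left_distrib)
  have base: "?P w = w" if w: "w \<in> set vs" for w
  proof -
    obtain i where i: "i < length vs" "w = vs ! i" using w by (auto simp: in_set_conv_nth)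
    have "?P w = (\<Sum>j<length vs. g p (vs ! i) (vs ! j) *\<^sub>R (vs ! j))"
      by (simp add: sum_list_sum_nth atLeast0LessThan i(2))
    also have "\<dots> = (\<Sum>j<length vs. (if i = j then vs ! j else 0))"
      using on i(1) by (intro sum.cong) (auto simp: orthonormal_def)
    also have "\<dots> = w" using i by simp
    finally show ?thesis .
  qed
  have "u \<in> tangent A p \<and> ?P u = u" using u unfolding S_eq[symmetric]
  proof (induction rule: span_induct_alt)
    case base
    show ?case using scale[of 0 0] by (simp flip: zero_fun_def)
  next
    case (step c x y)
    then have x: "x \<in> tangent A p" using vs by auto
    have y: "y \<in> tangent A p" "?P y = y" using step by auto
    have "?P (c *\<^sub>R x + y) = c *\<^sub>R x + y"
      using add[OF tangent_closed(3)[OF x] y(1)] scale[OF x] base[OF step(1)] y(2) by metis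
    then show ?case using tangent_closed(1)[OF tangent_closed(3)[OF x] y(1)] by (simp only: plus_fun_def)
  qed
  then show ?thesis ..
qed

text \<open>Traces are defined with arbitrary orthonormal fields; this identity evaluates them by
  means of the fixed frame.\<close>

lemma orthonormal_basis_parseval:
  assumes b: "orthonormal_basis (g p) S vs" and S: "S \<subseteq> tangent A p" and u: "u \<in> S" and w: "w \<in> S"
  shows "(\<Sum>v\<leftarrow>vs. g p v u * g p v w) = g p u w"
proof -
  have vs: "set vs \<subseteq> tangent A p"
    using b S span_superset unfolding orthonormal_basis_def by blast
  have u': "u \<in> tangent A p" and w': "w \<in> tangent A p" using u w S by auto
  have "g p u w = g p (\<Sum>v\<leftarrow>vs. g p u v *\<^sub>R v) w"
    by (simp add: orthonormal_basis_expansion[OF b S u])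
  also have "\<dots> = (\<Sum>v\<leftarrow>vs. g p (g p u v *\<^sub>R v) w)"
    by (rule g_sum_list_left) (use vs w' in auto)
  also have "\<dots> = (\<Sum>v\<leftarrow>vs. g p v u * g p v w)"
    using vs by (intro arg_cong[where f=sum_list] map_cong) (auto simp: g_scale_left u' w' g_sym[of u])
  finally show ?thesis by simp
qed

end

section \<open>An orthonormal frame with constant brackets\<close>

context levi_civita_manifold
begin

text \<open>A member lying in the span of the others would be orthogonal to itself.\<close>

lemma orthonormal_independent:
  assumes on: "orthonormal (g p) vs" and vs: "set vs \<subseteq> tangent A p"
  shows "distinct vs" "independent (set vs)"
proof -
  have same: "g p x x = 1" and diff: "x \<noteq> y \<Longrightarrow> g p x y = 0"
    if "x \<in> set vs" "y \<in> set vs" for x y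
    using on that by (auto simp: orthonormal_def in_set_conv_nth)
  show "distinct vs"
    unfolding distinct_conv_nth
  proof (intro allI impI notI)
    fix i j assume ij: "i < length vs" "j < length vs" "i \<noteq> j" and "vs ! i = vs ! j"
    then have "g p (vs ! i) (vs ! j) = 0" using on unfolding orthonormal_def by metis
    then have "g p (vs ! i) (vs ! i) = 0" using \<open>vs ! i = vs ! j\<close> by simp
    then show False using same[of "vs ! i" "vs ! i"] nth_mem[OF ij(1)] by simp
  qed
  show "independent (set vs)"
  proof
    assume "dependent (set vs)"
    then obtain a where a: "a \<in> set vs" "a \<in> span (set vs - {a})"
      unfolding dependent_def by blast
    have at: "a \<in> tangent A p" using a vs by auto
    have sub: "subspace {u \<in> tangent A p. g p u a = 0}"
      unfolding subspace_def by (simp add: g_bilinear at)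
    have "span (set vs - {a}) \<subseteq> {u \<in> tangent A p. g p u a = 0}"
      by (rule span_minimal[OF _ sub]) (use diff a vs in auto)
    then have "g p a a = 0" using a by auto
    then show False using same[OF a(1) a(1)] by simp
  qed
qed

end

locale bracket_frame = levi_civita_manifold A g nabla
  for A :: "('m::topological_space, real ^ 4) atlas" and g nabla +
  fixes X Y Z W :: "'m vfield" and z2 \<theta>1 \<theta>2 :: real
  assumes frame_smooth: "smooth_vfield A X" "smooth_vfield A Y" "smooth_vfield A Z" "smooth_vfield A W"
    and frame_orthonormal: "orthonormal (g p) [X p, Y p, Z p, W p]"
    and brackets: "lie_bracket A Z X = (- 2 * z2) *\<^sub>R W" "lie_bracket A Z Y = z2 *\<^sub>R Z"
      "lie_bracket A W Y = (- z2) *\<^sub>R W"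
      "lie_bracket A Y X = (2 * z2) *\<^sub>R X + \<theta>1 *\<^sub>R Z + \<theta>2 *\<^sub>R W"
      "lie_bracket A W Z = 0" "lie_bracket A W X = 0"
begin

lemma frame_tangent [simp]: "X p \<in> tangent A p" "Y p \<in> tangent A p" "Z p \<in> tangent A p" "W p \<in> tangent A p"
  using frame_smooth by (simp_all add: smooth_vfield_tangent)

lemma g_frame [simp]:
  "g p (X p) (X p) = 1" "g p (X p) (Y p) = 0" "g p (X p) (Z p) = 0" "g p (X p) (W p) = 0"
  "g p (Y p) (X p) = 0" "g p (Y p) (Y p) = 1" "g p (Y p) (Z p) = 0" "g p (Y p) (W p) = 0"
  "g p (Z p) (X p) = 0" "g p (Z p) (Y p) = 0" "g p (Z p) (Z p) = 1" "g p (Z p) (W p) = 0"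
  "g p (W p) (X p) = 0" "g p (W p) (Y p) = 0" "g p (W p) (Z p) = 0" "g p (W p) (W p) = 1"
proof -
  have *: "g p ([X p, Y p, Z p, W p] ! i) ([X p, Y p, Z p, W p] ! j) = (if i = j then 1 else 0)"
    if "i < 4" "j < 4" for i j
    using frame_orthonormal[of p] that by (simp add: orthonormal_def)
  show "g p (X p) (X p) = 1" "g p (X p) (Y p) = 0" "g p (X p) (Z p) = 0" "g p (X p) (W p) = 0"
    "g p (Y p) (X p) = 0" "g p (Y p) (Y p) = 1" "g p (Y p) (Z p) = 0" "g p (Y p) (W p) = 0"
    "g p (Z p) (X p) = 0" "g p (Z p) (Y p) = 0" "g p (Z p) (Z p) = 1" "g p (Z p) (W p) = 0"
    "g p (W p) (X p) = 0" "g p (W p) (Y p) = 0" "g p (W p) (Z p) = 0" "g p (W p) (W p) = 1"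
    using *[of 0 0] *[of 0 1] *[of 0 2] *[of 0 3] *[of 1 0] *[of 1 1] *[of 1 2] *[of 1 3]
      *[of 2 0] *[of 2 1] *[of 2 2] *[of 2 3] *[of 3 0] *[of 3 1] *[of 3 2] *[of 3 3] by simp_all
qed

lemma frame_basis: "orthonormal_basis (g p) (tangent A p) [X p, Y p, Z p, W p]"
proof -
  let ?vs = "[X p, Y p, Z p, W p]"
  have sub: "set ?vs \<subseteq> tangent A p" by simp
  note ind = orthonormal_independent[OF frame_orthonormal sub]
  have "card (set ?vs) = DIM(real ^ 4)" using distinct_card[OF ind(1)] by simp
  then show ?thesis
    unfolding orthonormal_basis_def using span_eq_tangent[OF sub ind(2)] frame_orthonormal by blast
qed

text \<open>A normal form for constant-coefficient fields. Brackets, \<open>nabla\<close> and J send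
  such fields to such fields, so tensor computations become arithmetic on four coefficients.\<close>

definition comb :: "real \<Rightarrow> real \<Rightarrow> real \<Rightarrow> real \<Rightarrow> 'm vfield"
  where "comb a b c d = a *\<^sub>R X + b *\<^sub>R Y + c *\<^sub>R Z + d *\<^sub>R W"

lemma comb_apply: "comb a b c d p = a *\<^sub>R X p + b *\<^sub>R Y p + c *\<^sub>R Z p + d *\<^sub>R W p"
  by (simp add: comb_def scaleR_fun_apply)

lemma comb_smooth [simp]: "smooth_vfield A (comb a b c d)"
  by (simp add: comb_def frame_smooth smooth_vfield_add smooth_vfield_scaleR)

lemma comb_tangent [simp]: "comb a b c d p \<in> tangent A p"
  by (simp add: smooth_vfield_tangent)

lemma comb_frame: "X = comb 1 0 0 0" "Y = comb 0 1 0 0" "Z = comb 0 0 1 0" "W = comb 0 0 0 1"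
  by (simp_all add: comb_def)

lemma g_comb [simp]: "g p (comb a b c d p) (comb a' b' c' d' p) = a * a' + b * b' + c * c' + d * d'"
  by (simp add: comb_apply g_bilinear)

lemma g_comb_frame [simp]:
  "g p (comb a b c d p) (X p) = a" "g p (comb a b c d p) (Y p) = b"
  "g p (comb a b c d p) (Z p) = c" "g p (comb a b c d p) (W p) = d"
  "g p (X p) (comb a b c d p) = a" "g p (Y p) (comb a b c d p) = b"
  "g p (Z p) (comb a b c d p) = c" "g p (W p) (comb a b c d p) = d"
  by (simp_all add: comb_apply g_bilinear)

lemma comb_algebra [simp]:
  "comb a b c d + comb a' b' c' d' = comb (a + a') (b + b') (c + c') (d + d')"
  "comb a b c d - comb a' b' c' d' = comb (a - a') (b - b') (c - c') (d - d')"
  "- comb a b c d = comb (- a) (- b) (- c) (- d)"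
  "r *\<^sub>R comb a b c d = comb (r * a) (r * b) (r * c) (r * d)"
  by (simp_all add: comb_def algebra_simps)

lemma comb_apply_algebra [simp]:
  "comb a b c d p + comb a' b' c' d' p = comb (a + a') (b + b') (c + c') (d + d') p"
  "comb a b c d p - comb a' b' c' d' p = comb (a - a') (b - b') (c - c') (d - d') p"
  "- comb a b c d p = comb (- a) (- b) (- c) (- d) p"
  "r *\<^sub>R comb a b c d p = comb (r * a) (r * b) (r * c) (r * d) p"
  by (simp_all add: comb_apply algebra_simps)

lemma comb_zero: "comb 0 0 0 0 = 0"
  by (simp add: comb_def)

lemma comb_eq_iff [simp]: "comb a b c d p = comb a' b' c' d' p \<longleftrightarrow> a = a' \<and> b = b' \<and> c = c' \<and> d = d'"
  by (metis g_comb_frame(1-4))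

lemma tangent_comb:
  assumes "v \<in> tangent A p"
  shows "v = comb (g p v (X p)) (g p v (Y p)) (g p v (Z p)) (g p v (W p)) p"
  using orthonormal_basis_expansion[OF frame_basis order_refl assms] by (simp add: comb_apply add.assoc)

lemma tangent_eqI:
  assumes "v \<in> tangent A p" "w \<in> tangent A p" "g p v (X p) = g p w (X p)" "g p v (Y p) = g p w (Y p)"
    "g p v (Z p) = g p w (Z p)" "g p v (W p) = g p w (W p)"
  shows "v = w"
  using tangent_comb[OF assms(1)] tangent_comb[OF assms(2)] assms(3-) by simp

lemma lie_bracket_self: "lie_bracket A E E = 0"
  by (simp add: lie_bracket_def fun_eq_iff)

lemma bracket_comb:
  "lie_bracket A X X = comb 0 0 0 0" "lie_bracket A X Y = comb (- 2 * z2) 0 (- \<theta>1) (- \<theta>2)"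
  "lie_bracket A X Z = comb 0 0 0 (2 * z2)" "lie_bracket A X W = comb 0 0 0 0"
  "lie_bracket A Y X = comb (2 * z2) 0 \<theta>1 \<theta>2" "lie_bracket A Y Y = comb 0 0 0 0"
  "lie_bracket A Y Z = comb 0 0 (- z2) 0" "lie_bracket A Y W = comb 0 0 0 z2"
  "lie_bracket A Z X = comb 0 0 0 (- 2 * z2)" "lie_bracket A Z Y = comb 0 0 z2 0"
  "lie_bracket A Z Z = comb 0 0 0 0" "lie_bracket A Z W = comb 0 0 0 0"
  "lie_bracket A W X = comb 0 0 0 0" "lie_bracket A W Y = comb 0 0 0 (- z2)"
  "lie_bracket A W Z = comb 0 0 0 0" "lie_bracket A W W = comb 0 0 0 0"
  using lie_bracket_antisym[of X Y] lie_bracket_antisym[of X Z] lie_bracket_antisym[of X W]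
    lie_bracket_antisym[of Y Z] lie_bracket_antisym[of Y W] lie_bracket_antisym[of Z W]
  by (simp_all add: lie_bracket_self brackets comb_def)

lemma koszul_frame:
  assumes "E \<in> {X, Y, Z, W}" "F \<in> {X, Y, Z, W}" "K \<in> {X, Y, Z, W}"
  shows "g p (nabla E F p) (K p) = (g p (lie_bracket A E F p) (K p)
    - g p (lie_bracket A F K p) (E p) + g p (lie_bracket A K E p) (F p)) / 2"
proof -
  have smooth: "smooth_vfield A E'" if "E' \<in> {X, Y, Z, W}" for E'
    using that frame_smooth by auto
  have const: "g q (E' q) (F' q) = g p (E' p) (F' p)" if "E' \<in> {X, Y, Z, W}" "F' \<in> {X, Y, Z, W}" for E' F' q
    using that by auto
  show ?thesis
    using koszul[where p=p, OF smooth[OF assms(1)] smooth[OF assms(2)] smooth[OF assms(3)]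
        const[OF assms(1,2)] const[OF assms(2,3)] const[OF assms(3,1)]] by simp
qed

text \<open>Koszul's formula fixes the inner products of the covariant derivative with the frame,
  and these determine it; a proposed value therefore only has to be verified.\<close>

lemma nabla_frame_eqI:
  assumes "E \<in> {X, Y, Z, W}" "F \<in> {X, Y, Z, W}"
    and "\<And>p K. K \<in> {X, Y, Z, W} \<Longrightarrow> g p (lie_bracket A E F p) (K p) - g p (lie_bracket A F K p) (E p)
      + g p (lie_bracket A K E p) (F p) = 2 * g p (comb a b c d p) (K p)"
  shows "nabla E F = comb a b c d"
proof
  fix p
  have "smooth_vfield A E" "smooth_vfield A F" using assms frame_smooth by auto
  then have t: "nabla E F p \<in> tangent A p" by (simp add: smooth_vfield_tangent nabla_smooth)
  have K: "g p (nabla E F p) (K p) = g p (comb a b c d p) (K p)" if "K \<in> {X, Y, Z, W}" for K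
    using koszul_frame[OF assms(1,2) that, of p] assms(3)[OF that, of p] by simp
  show "nabla E F p = comb a b c d p"
    by (rule tangent_eqI[OF t comb_tangent]) (simp_all only: K insert_iff simp_thms)
qed

lemma nabla_frame:
  "nabla X X = comb 0 (2 * z2) 0 0" "nabla X Y = comb (- 2 * z2) 0 (- \<theta>1 / 2) (- \<theta>2 / 2)"
  "nabla X Z = comb 0 (\<theta>1 / 2) 0 z2" "nabla X W = comb 0 (\<theta>2 / 2) (- z2) 0"
  "nabla Y X = comb 0 0 (\<theta>1 / 2) (\<theta>2 / 2)" "nabla Y Y = comb 0 0 0 0"
  "nabla Y Z = comb (- \<theta>1 / 2) 0 0 0" "nabla Y W = comb (- \<theta>2 / 2) 0 0 0"
  "nabla Z X = comb 0 (\<theta>1 / 2) 0 (- z2)" "nabla Z Y = comb (- \<theta>1 / 2) 0 z2 0"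
  "nabla Z Z = comb 0 (- z2) 0 0" "nabla Z W = comb z2 0 0 0"
  "nabla W X = comb 0 (\<theta>2 / 2) (- z2) 0" "nabla W Y = comb (- \<theta>2 / 2) 0 0 (- z2)"
  "nabla W Z = comb z2 0 0 0" "nabla W W = comb 0 z2 0 0"
  by (rule nabla_frame_eqI; auto simp: bracket_comb)+

lemma nabla_comb: "nabla (comb a b c d) (comb a' b' c' d') =
  a *\<^sub>R (a' *\<^sub>R nabla X X + b' *\<^sub>R nabla X Y + c' *\<^sub>R nabla X Z + d' *\<^sub>R nabla X W) +
  b *\<^sub>R (a' *\<^sub>R nabla Y X + b' *\<^sub>R nabla Y Y + c' *\<^sub>R nabla Y Z + d' *\<^sub>R nabla Y W) +
  c *\<^sub>R (a' *\<^sub>R nabla Z X + b' *\<^sub>R nabla Z Y + c' *\<^sub>R nabla Z Z + d' *\<^sub>R nabla Z W) +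
  d *\<^sub>R (a' *\<^sub>R nabla W X + b' *\<^sub>R nabla W Y + c' *\<^sub>R nabla W Z + d' *\<^sub>R nabla W W)"
  unfolding comb_def
  by (simp only: nabla_add_left nabla_add_right nabla_scaleR_left nabla_scaleR_right
      frame_smooth smooth_vfield_add smooth_vfield_scaleR)
     (simp add: scaleR_right_distrib mult.commute ac_simps)

end

section \<open>The distributions, the almost complex structure and the curvature\<close>

context levi_civita_manifold
begin

context
  fixes J assumes J: "almost_hermitian A g J"
begin

lemma J_add: "u \<in> tangent A p \<Longrightarrow> v \<in> tangent A p \<Longrightarrow> J p (u + v) = J p u + J p v"
  and J_scaleR: "u \<in> tangent A p \<Longrightarrow> J p (c *\<^sub>R u) = c *\<^sub>R J p u"
  and J_J: "u \<in> tangent A p \<Longrightarrow> J p (J p u) = - u"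
  and smooth_vfield_appl: "smooth_vfield A E \<Longrightarrow> smooth_vfield A (appl J E)"
  using J unfolding almost_hermitian_def by blast+

lemma J_diff: "u \<in> tangent A p \<Longrightarrow> v \<in> tangent A p \<Longrightarrow> J p (u - v) = J p u - J p v"
  using J_add[of u p "(-1) *\<^sub>R v"] J_scaleR[of v p "-1"] by simp

lemma appl_add: "smooth_vfield A E \<Longrightarrow> smooth_vfield A F \<Longrightarrow> appl J (E + F) = appl J E + appl J F"
  by (simp add: fun_eq_iff appl_def J_add smooth_vfield_tangent)

lemma appl_diff: "smooth_vfield A E \<Longrightarrow> smooth_vfield A F \<Longrightarrow> appl J (E - F) = appl J E - appl J F"
  by (simp add: fun_eq_iff appl_def J_diff smooth_vfield_tangent)

lemma appl_fscale: "smooth_vfield A E \<Longrightarrow> appl J (fscale f E) = fscale f (appl J E)"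
  by (rule ext) (simp add: appl_def fscale_def J_scaleR smooth_vfield_tangent)

lemma appl_appl: "smooth_vfield A E \<Longrightarrow> appl J (appl J E) = - E"
  by (simp add: fun_eq_iff appl_def J_J smooth_vfield_tangent)

lemma appl_minus: "smooth_vfield A E \<Longrightarrow> appl J (- E) = - appl J E"
  using appl_fscale[of E "\<lambda>_. -1"] by (simp add: fscale_const)

lemmas field_smooth = smooth_vfield_appl smooth_vfield_lie_bracket smooth_vfield_add smooth_vfield_fscale

lemma nijenhuis_antisym:
  assumes "smooth_vfield A E" "smooth_vfield A F"
  shows "nijenhuis A J E F = - nijenhuis A J F E"
proof -
  have "appl J (lie_bracket A (appl J E) F) = - appl J (lie_bracket A F (appl J E))"
    "appl J (lie_bracket A E (appl J F)) = - appl J (lie_bracket A (appl J F) E)"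
    using assms lie_bracket_antisym[of "appl J E" F] lie_bracket_antisym[of E "appl J F"]
    by (simp_all add: appl_minus field_smooth)
  then show ?thesis
    unfolding nijenhuis_def lie_bracket_antisym[of E F] lie_bracket_antisym[of "appl J E" "appl J F"]
    by simp
qed

lemma nijenhuis_add_left:
  assumes "smooth_vfield A E" "smooth_vfield A K" "smooth_vfield A F"
  shows "nijenhuis A J (E + K) F = nijenhuis A J E F + nijenhuis A J K F"
  using assms by (simp add: nijenhuis_def lie_bracket_add_left appl_add field_smooth)

text \<open>The derivatives of f cancel in pairs. The first bracket contributes -(F f) E, and the
  second +(F f) E because J J = -1; the terms (J F f) J E of the last two brackets have opposite
  signs.\<close>

lemma nijenhuis_fscale_left:
  assumes E: "smooth_vfield A E" and F: "smooth_vfield A F" and f: "smooth_on A UNIV f"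
  shows "nijenhuis A J (fscale f E) F = fscale f (nijenhuis A J E F)"
proof -
  have Ff: "smooth_on A UNIV (\<lambda>p. G p f)" if "smooth_vfield A G" for G
    by (rule smooth_vfield_apply[OF that f])
  note JE = smooth_vfield_appl[OF E] and JF = smooth_vfield_appl[OF F]
  have 1: "appl J (lie_bracket A (appl J (fscale f E)) F)
      = fscale f (appl J (lie_bracket A (appl J E) F)) + fscale (\<lambda>p. F p f) E"
    by (simp add: appl_fscale lie_bracket_fscale_left appl_diff appl_appl field_smooth E F f JE Ff)
       (simp add: fscale_def fun_eq_iff scaleR_fun_apply)
  have 2: "appl J (lie_bracket A (fscale f E) (appl J F))
      = fscale f (appl J (lie_bracket A E (appl J F))) - fscale (\<lambda>p. appl J F p f) (appl J E)"
    by (simp add: appl_fscale lie_bracket_fscale_left appl_diff field_smooth E F f JF Ff)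
  have 3: "lie_bracket A (appl J (fscale f E)) (appl J F)
      = fscale f (lie_bracket A (appl J E) (appl J F)) - fscale (\<lambda>p. appl J F p f) (appl J E)"
    by (simp add: appl_fscale lie_bracket_fscale_left E f JE JF)
  show ?thesis
    unfolding nijenhuis_def 1 2 3 lie_bracket_fscale_left[OF E F f]
    by (simp add: fscale_def fun_eq_iff algebra_simps scaleR_fun_apply)
qed

end

text \<open>For F a section and K a frame field orthogonal to it, this yields a component of
  \<open>nabla E F\<close> without differentiating the variable coefficients of F.\<close>

lemma nabla_metric_orthogonal:
  assumes "smooth_vfield A E" "smooth_vfield A F" "smooth_vfield A K" "\<And>q. g q (F q) (K q) = 0"
  shows "g p (nabla E F p) (K p) = - g p (F p) (nabla E K p)"
  using nabla_metric[OF assms(1-3), of p] tangent_const[OF smooth_vfield_tangent[OF assms(1)], of p 0]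
  by (simp add: assms(4))

end

context bracket_frame
begin

section \<open>The two distributions and their second fundamental forms\<close>

abbreviation "Vd \<equiv> \<lambda>p. span {Z p, W p}"
abbreviation "Hd \<equiv> ortho_complement A g Vd"

lemma Vd_iff: "v \<in> span {Z p, W p} \<longleftrightarrow> v \<in> tangent A p \<and> g p v (X p) = 0 \<and> g p v (Y p) = 0"
proof
  have "subspace {v \<in> tangent A p. g p v (X p) = 0 \<and> g p v (Y p) = 0}"
    unfolding subspace_def by (simp add: g_bilinear)
  then have "span {Z p, W p} \<subseteq> {v \<in> tangent A p. g p v (X p) = 0 \<and> g p v (Y p) = 0}"
    by (rule span_minimal[rotated]) simp
  then show "v \<in> span {Z p, W p} \<Longrightarrow> v \<in> tangent A p \<and> g p v (X p) = 0 \<and> g p v (Y p) = 0"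
    by blast
next
  assume v: "v \<in> tangent A p \<and> g p v (X p) = 0 \<and> g p v (Y p) = 0"
  have "comb 0 0 c d p \<in> span {Z p, W p}" for c d
    unfolding comb_apply by (simp add: span_add span_scale span_base)
  then show "v \<in> span {Z p, W p}" using tangent_comb[of v p] v by metis
qed

lemma Hd_iff: "v \<in> Hd p \<longleftrightarrow> v \<in> tangent A p \<and> g p v (Z p) = 0 \<and> g p v (W p) = 0"
proof
  assume "v \<in> Hd p"
  then show "v \<in> tangent A p \<and> g p v (Z p) = 0 \<and> g p v (W p) = 0"
    by (simp add: ortho_complement_def span_base)
next
  assume v: "v \<in> tangent A p \<and> g p v (Z p) = 0 \<and> g p v (W p) = 0"
  have "g p v u = 0" if u: "u \<in> span {Z p, W p}" for u
  proof -
    have "g p (comb (g p v (X p)) (g p v (Y p)) 0 0 p) (comb 0 0 (g p u (Z p)) (g p u (W p)) p) = 0"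
      by simp
    then show ?thesis using tangent_comb[of v p] tangent_comb[of u p] v u unfolding Vd_iff by metis
  qed
  then show "v \<in> Hd p" using v by (simp add: ortho_complement_def)
qed

lemma subspace_Vd_Hd: "subspace (Vd p)" "subspace (Hd p)"
  and Vd_Hd_tangent: "Vd p \<subseteq> tangent A p" "Hd p \<subseteq> tangent A p"
proof -
  show "subspace (Hd p)" unfolding subspace_def by (simp add: Hd_iff g_bilinear)
qed (auto simp: Vd_iff Hd_iff)

lemma ortho_proj_Vd: "ortho_proj g Vd p (comb a b c d p) = comb 0 0 c d p"
proof (rule ortho_proj_eq[where D=Vd, OF subspace_Vd_Hd(1) Vd_Hd_tangent(1)])
  fix u assume "u \<in> span {Z p, W p}"
  then have "u = comb 0 0 (g p u (Z p)) (g p u (W p)) p" using tangent_comb[of u p] by (simp add: Vd_iff)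
  then show "g p (comb a b c d p - comb 0 0 c d p) u = 0" by (metis comb_apply_algebra(2) g_comb
        add_0 diff_0_right diff_self mult_zero_left mult_zero_right add.right_neutral)
qed (simp_all add: Vd_iff)

lemma ortho_proj_Hd: "ortho_proj g Hd p (comb a b c d p) = comb a b 0 0 p"
proof (rule ortho_proj_eq[where D=Hd, OF subspace_Vd_Hd(2) Vd_Hd_tangent(2)])
  fix u assume "u \<in> Hd p"
  then have "u = comb (g p u (X p)) (g p u (Y p)) 0 0 p" using tangent_comb[of u p] by (simp add: Hd_iff)
  then show "g p (comb a b c d p - comb a b 0 0 p) u = 0" by (metis comb_apply_algebra(2) g_comb
        add_0 diff_0_right diff_self mult_zero_left mult_zero_right add.right_neutral)
qed (simp_all add: Hd_iff)

text \<open>The coefficients are inner products of global smooth fields, hence smooth on the whole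
  manifold, as the function-linearity of \<open>nabla\<close> requires.\<close>

lemma frame_expansion:
  assumes E: "smooth_vfield A E"
  shows "E = fscale (\<lambda>p. g p (E p) (X p)) X + fscale (\<lambda>p. g p (E p) (Y p)) Y
    + fscale (\<lambda>p. g p (E p) (Z p)) Z + fscale (\<lambda>p. g p (E p) (W p)) W"
proof
  fix p
  show "E p = (fscale (\<lambda>p. g p (E p) (X p)) X + fscale (\<lambda>p. g p (E p) (Y p)) Y
    + fscale (\<lambda>p. g p (E p) (Z p)) Z + fscale (\<lambda>p. g p (E p) (W p)) W) p"
    using tangent_comb[OF smooth_vfield_tangent[OF E], of p] by (simp add: fscale_def comb_apply)
qed

lemma nabla_left_frame:
  assumes E: "smooth_vfield A E" and F: "smooth_vfield A F"
  shows "nabla E F p = g p (E p) (X p) *\<^sub>R nabla X F p + g p (E p) (Y p) *\<^sub>R nabla Y F p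
    + g p (E p) (Z p) *\<^sub>R nabla Z F p + g p (E p) (W p) *\<^sub>R nabla W F p"
proof -
  have "nabla E F = fscale (\<lambda>p. g p (E p) (X p)) (nabla X F) + fscale (\<lambda>p. g p (E p) (Y p)) (nabla Y F)
    + fscale (\<lambda>p. g p (E p) (Z p)) (nabla Z F) + fscale (\<lambda>p. g p (E p) (W p)) (nabla W F)"
    by (subst frame_expansion[OF E])
       (simp only: nabla_add_left nabla_fscale_left F frame_smooth g_smooth[OF E] smooth_vfield_fscale smooth_vfield_add)
  then show ?thesis by (simp add: fscale_def)
qed

lemma sections_Vd: "E \<in> sections A Vd \<longleftrightarrow>
    smooth_vfield A E \<and> (\<forall>p. g p (E p) (X p) = 0 \<and> g p (E p) (Y p) = 0)"
  by (auto simp: sections_def Vd_iff smooth_vfield_tangent)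

lemma sections_Hd: "E \<in> sections A Hd \<longleftrightarrow>
    smooth_vfield A E \<and> (\<forall>p. g p (E p) (Z p) = 0 \<and> g p (E p) (W p) = 0)"
  by (auto simp: sections_def Hd_iff smooth_vfield_tangent)

text \<open>The derivative is moved onto \<open>X\<close> and \<open>Y\<close>; then
  \<open>nabla E X\<close> and \<open>nabla E Y\<close> are function-linear in E and come from the
  frame table. Both right-hand sides are symmetric in E and F, which gives involutivity, and they
  are the components of the second fundamental form.\<close>

lemma nabla_Vd:
  assumes E: "E \<in> sections A Vd" and F: "F \<in> sections A Vd"
  defines "z \<equiv> \<lambda>E p. g p (E p) (Z p)" and "w \<equiv> \<lambda>E p. g p (E p) (W p)"
  shows "g p (nabla E F p) (X p) = z2 * (z E p * w F p + w E p * z F p)"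
    and "g p (nabla E F p) (Y p) = z2 * (w E p * w F p - z E p * z F p)"
proof -
  have sE: "smooth_vfield A E" and sF: "smooth_vfield A F" using E F by (auto simp: sections_Vd)
  have Fp: "F p = comb 0 0 (z F p) (w F p) p"
    using tangent_comb[OF smooth_vfield_tangent[OF sF]] F by (simp add: sections_Vd z_def w_def)
  have "nabla E X p = comb 0 (z E p * \<theta>1 / 2 + w E p * \<theta>2 / 2) (- z2 * w E p) (- z2 * z E p) p"
    "nabla E Y p = comb (- (z E p * \<theta>1 / 2 + w E p * \<theta>2 / 2)) 0 (z2 * z E p) (- z2 * w E p) p"
    using E by (simp_all add: nabla_left_frame sE frame_smooth nabla_frame sections_Vd z_def w_def)
  then show "g p (nabla E F p) (X p) = z2 * (z E p * w F p + w E p * z F p)"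
    "g p (nabla E F p) (Y p) = z2 * (w E p * w F p - z E p * z F p)"
    using nabla_metric_orthogonal[OF sE sF frame_smooth(1), of p]
      nabla_metric_orthogonal[OF sE sF frame_smooth(2), of p] F
    by (simp_all add: sections_Vd Fp algebra_simps)
qed

text \<open>Moving the derivative onto \<open>Z\<close> and \<open>W\<close> leaves expressions skew
  in E and F. The vertical part of \<open>nabla E F\<close> is thus purely a torsion effect, and its
  symmetrisation vanishes.\<close>

lemma nabla_Hd:
  assumes E: "E \<in> sections A Hd" and F: "F \<in> sections A Hd"
  shows "g p (nabla E F p) (Z p) + g p (nabla F E p) (Z p) = 0"
    and "g p (nabla E F p) (W p) + g p (nabla F E p) (W p) = 0"
proof -
  have *: "g p (nabla E F p) (Z p) = (g p (E p) (Y p) * g p (F p) (X p) - g p (E p) (X p) * g p (F p) (Y p)) * \<theta>1 / 2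
      \<and> g p (nabla E F p) (W p) = (g p (E p) (Y p) * g p (F p) (X p) - g p (E p) (X p) * g p (F p) (Y p)) * \<theta>2 / 2"
    if E: "E \<in> sections A Hd" and F: "F \<in> sections A Hd" for E F
  proof -
    have sE: "smooth_vfield A E" and sF: "smooth_vfield A F" using E F by (auto simp: sections_Hd)
    define x y where "x = g p (F p) (X p)" and "y = g p (F p) (Y p)"
    have Fp: "F p = comb x y 0 0 p"
      using tangent_comb[OF smooth_vfield_tangent[OF sF]] F by (simp add: sections_Hd x_def y_def)
    have "nabla E Z p = comb (- g p (E p) (Y p) * \<theta>1 / 2) (g p (E p) (X p) * \<theta>1 / 2) 0 (g p (E p) (X p) * z2) p"
      "nabla E W p = comb (- g p (E p) (Y p) * \<theta>2 / 2) (g p (E p) (X p) * \<theta>2 / 2) (- g p (E p) (X p) * z2) 0 p"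
      using E by (simp_all add: nabla_left_frame sE frame_smooth nabla_frame sections_Hd)
    then show ?thesis
      using nabla_metric_orthogonal[OF sE sF frame_smooth(3), of p]
        nabla_metric_orthogonal[OF sE sF frame_smooth(4), of p] F
      by (simp add: sections_Hd Fp algebra_simps diff_divide_distrib)
  qed
  show "g p (nabla E F p) (Z p) + g p (nabla F E p) (Z p) = 0"
    "g p (nabla E F p) (W p) + g p (nabla F E p) (W p) = 0"
    using *[OF E F] *[OF F E] by (simp_all add: algebra_simps)
qed

text \<open>The bracket is the skew part of \<open>nabla E F\<close>, and for vertical sections the
  horizontal components of \<open>nabla E F\<close> are symmetric.\<close>

lemma involutive_Vd: "involutive A Vd"
  unfolding involutive_def
proof (intro ballI)
  fix E F assume E: "E \<in> sections A Vd" and F: "F \<in> sections A Vd"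
  then have s: "smooth_vfield A E" "smooth_vfield A F" by (auto simp: sections_Vd)
  have "g p (lie_bracket A E F p) (K p) = g p (nabla E F p) (K p) - g p (nabla F E p) (K p)"
    if "smooth_vfield A K" for K p
    using s that by (simp add: nabla_torsion g_diff_left smooth_vfield_tangent nabla_smooth)
  then show "lie_bracket A E F \<in> sections A Vd"
    using s by (simp add: sections_Vd smooth_vfield_lie_bracket frame_smooth nabla_Vd[OF E F] nabla_Vd[OF F E] mult.commute)
qed

lemma conformal_Vd: "conformal_foliation A g nabla Vd"
  unfolding conformal_foliation_def
\<comment> \<open>By \<open>nabla_Hd\<close> the symmetrised form vanishes, so the conformality
  condition holds with the zero field.\<close>
proof (intro conjI involutive_Vd bexI[of _ 0] ballI)
  show "0 \<in> sections A Vd" by (simp add: sections_Vd smooth_vfield_zero g_zero_left)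
next
  fix E F assume E: "E \<in> sections A Hd" and F: "F \<in> sections A Hd"
  show "sym_second_form g nabla Vd E F = fscale (\<lambda>p. g p (E p) (F p)) 0"
  proof
    fix p
    let ?v = "nabla E F p + nabla F E p"
    have t: "nabla E F p \<in> tangent A p" "nabla F E p \<in> tangent A p"
      using E F by (auto simp: sections_Hd nabla_smooth smooth_vfield_tangent)
    have "?v = comb (g p ?v (X p)) (g p ?v (Y p)) 0 0 p"
      using tangent_comb[of ?v p] nabla_Hd[OF E F, of p] t by (simp add: g_add_left)
    then have "ortho_proj g Vd p ?v = 0"
      using ortho_proj_Vd[of p "g p ?v (X p)" "g p ?v (Y p)" 0 0] by (simp add: comb_zero)
    then show "sym_second_form g nabla Vd E F p = fscale (\<lambda>p. g p (E p) (F p)) 0 p"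
      by (simp add: sym_second_form_def fscale_def)
  qed
qed

text \<open>The diagonal values suffice: minimality sums them over a frame, and the value at
  \<open>Z\<close> refutes total geodesy.\<close>

lemma second_form_Vd:
  assumes U: "U \<in> sections A Vd"
  shows "sym_second_form g nabla Hd U U p = comb (2 * z2 * (g p (U p) (Z p) * g p (U p) (W p)))
    (z2 * ((g p (U p) (W p))\<^sup>2 - (g p (U p) (Z p))\<^sup>2)) 0 0 p"
proof -
  have t: "nabla U U p \<in> tangent A p"
    using U by (auto simp: sections_Vd nabla_smooth smooth_vfield_tangent)
  have proj: "ortho_proj g Hd p v = comb (g p v (X p)) (g p v (Y p)) 0 0 p" if "v \<in> tangent A p" for v
    using ortho_proj_Hd[of p "g p v (X p)" "g p v (Y p)" "g p v (Z p)" "g p v (W p)"]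
      tangent_comb[OF that] by simp
  have "sym_second_form g nabla Hd U U p = (1 / 2) *\<^sub>R ortho_proj g Hd p (2 *\<^sub>R nabla U U p)"
    by (simp only: sym_second_form_def scaleR_2)
  then show ?thesis
    by (simp add: proj t g_scale_left nabla_Vd[OF U U] power2_eq_square algebra_simps)
qed

text \<open>By Parseval the two coefficients sum to 2 z2 times the product of \<open>Z\<close> with
  \<open>W\<close>, which is 0, and to z2 times the difference of the squared lengths of
  \<open>W\<close> and \<open>Z\<close>, which is 1 - 1.\<close>

lemma minimal_Vd: "minimal_foliation A g nabla Vd"
  unfolding minimal_foliation_def
proof (intro conjI involutive_Vd allI impI)
  fix p Us
  assume Us: "set Us \<subseteq> sections A Vd \<and> orthonormal_basis (g p) (span {Z p, W p}) (map (\<lambda>U. U p) Us)"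
  then have b: "orthonormal_basis (g p) (span {Z p, W p}) (map (\<lambda>U. U p) Us)" by simp
  have ZW: "Z p \<in> span {Z p, W p}" "W p \<in> span {Z p, W p}" by (simp_all add: span_base)
  note pars = orthonormal_basis_parseval[OF b Vd_Hd_tangent(1)]
  have sums: "(\<Sum>U\<leftarrow>Us. g p (U p) (Z p) * g p (U p) (W p)) = 0"
    "(\<Sum>U\<leftarrow>Us. (g p (U p) (Z p))\<^sup>2) = 1" "(\<Sum>U\<leftarrow>Us. (g p (U p) (W p))\<^sup>2) = 1"
    using pars[OF ZW] pars[OF ZW(1) ZW(1)] pars[OF ZW(2) ZW(2)]
    by (simp_all add: comp_def power2_eq_square)
  have comb_sum: "(\<Sum>U\<leftarrow>Us. comb (a U) (b U) 0 0 p) = comb (\<Sum>U\<leftarrow>Us. a U) (\<Sum>U\<leftarrow>Us. b U) 0 0 p" for a b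
    by (induction Us) (simp_all add: comb_zero)
  have "(\<Sum>U\<leftarrow>Us. sym_second_form g nabla Hd U U p)
      = (\<Sum>U\<leftarrow>Us. comb (2 * z2 * (g p (U p) (Z p) * g p (U p) (W p)))
          (z2 * ((g p (U p) (W p))\<^sup>2 - (g p (U p) (Z p))\<^sup>2)) 0 0 p)"
    using Us second_form_Vd by (intro arg_cong[where f=sum_list] map_cong) auto
  also have "\<dots> = 0"
    unfolding comb_sum sum_list_const_mult sum_list_subtractf sums by (simp add: comb_zero)
  finally show "(\<Sum>U\<leftarrow>Us. sym_second_form g nabla Hd U U p) = 0" .
qed

lemma codimension_Vd: "has_codimension A Vd 2"
  unfolding has_codimension_def
proof (intro allI conjI)
  fix p
  have "orthonormal (g p) [Z p, W p]"
    by (auto simp: orthonormal_def less_Suc_eq numeral_2_eq_2)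
  from orthonormal_independent[OF this]
  have "dim (span {Z p, W p}) = 2" by (simp add: dim_eq_card_independent)
  moreover have "dim (tangent A p) = 4"
  proof -
    let ?vs = "[X p, Y p, Z p, W p]"
    have sub: "set ?vs \<subseteq> tangent A p" by simp
    note ind = orthonormal_independent[OF frame_orthonormal sub]
    have "dim (span (set ?vs)) = card (set ?vs)"
      unfolding dim_span by (rule dim_eq_card_independent[OF ind(2)])
    also have "\<dots> = 4" using distinct_card[OF ind(1)] by simp
    finally show ?thesis using frame_basis[of p] unfolding orthonormal_basis_def by metis
  qed
  ultimately show "dim (tangent A p) = dim (span {Z p, W p}) + 2" by simp
qed (use Vd_Hd_tangent subspace_Vd_Hd in auto)

lemma not_totally_geodesic_Vd:
  assumes "z2 \<noteq> 0" shows "\<not> totally_geodesic_foliation A g nabla Vd"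
proof
  assume "totally_geodesic_foliation A g nabla Vd"
  moreover have Z: "Z \<in> sections A Vd" by (simp add: sections_Vd frame_smooth)
  ultimately have "sym_second_form g nabla Hd Z Z = 0"
    unfolding totally_geodesic_foliation_def by blast
  \<comment> \<open>\<open>undefined\<close> serves as an arbitrary point of the manifold.\<close>
  then have "comb 0 (- z2) 0 0 undefined = comb 0 0 0 0 undefined"
    using second_form_Vd[OF Z, of undefined] by (simp add: comb_zero)
  then show False using assms by simp
qed

text \<open>Functions cutting out the horizontal distribution would be annihilated by
  \<open>X\<close> and \<open>Y\<close> near the point, hence by their bracket. That bracket would
  then be horizontal, but its \<open>Z\<close> component is - \<theta>1.\<close>

lemma not_integrable_Hd:
  assumes "\<theta>1 \<noteq> 0" shows "\<not> integrable_distribution A Hd"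
proof
  assume "integrable_distribution A Hd"
  then have "\<exists>U fs. undefined \<in> U \<and> (\<forall>f\<in>set fs. smooth_on A U f) \<and> open U \<and>
     (\<forall>q\<in>U. (\<forall>c::nat \<Rightarrow> real. \<exists>v\<in>tangent A q. \<forall>i<length fs. v (fs ! i) = c i) \<and>
        Hd q = {v \<in> tangent A q. \<forall>f\<in>set fs. v f = 0})"
    unfolding integrable_distribution_def by (rule spec)
  then obtain U fs where U: "undefined \<in> U" "open U"
    and H: "\<And>q. q \<in> U \<Longrightarrow> Hd q = {v \<in> tangent A q. \<forall>f\<in>set fs. v f = 0}"
    by auto
  let ?p = "undefined :: 'm"
  have "lie_bracket A X Y ?p f = 0" if f: "f \<in> set fs" for f
  proof -
    have XY: "X q f = 0" "Y q f = 0" if "q \<in> U" for q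
      using H[OF that] f Hd_iff[of "X q" q] Hd_iff[of "Y q" q] by auto
    \<comment> \<open>The inner derivatives are known to vanish on U only; locality of tangent
      vectors allows replacing them by 0.\<close>
    have "X ?p (\<lambda>q. Y q f) = X ?p (\<lambda>_. 0)" "Y ?p (\<lambda>q. X q f) = Y ?p (\<lambda>_. 0)"
      by (rule tangent_local[OF _ U(2,1)]; simp add: XY)+
    then show ?thesis by (simp add: lie_bracket_def tangent_const[where p="?p"])
  qed
  then have "comb (- 2 * z2) 0 (- \<theta>1) (- \<theta>2) ?p \<in> Hd ?p"
    unfolding H[OF U(1)] bracket_comb(2)[symmetric]
    by (simp add: smooth_vfield_tangent smooth_vfield_lie_bracket frame_smooth)
  then show False using assms by (simp add: Hd_iff)
qed

lemma not_einstein: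
  assumes "z2 \<noteq> 0" "\<theta>1 \<noteq> 0" shows "\<not> einstein A g nabla"
proof
  assume "einstein A g nabla"
  then obtain c where "\<And>E F Us p. smooth_vfield A E \<and> smooth_vfield A F \<and> (\<forall>U\<in>set Us. smooth_vfield A U) \<and>
     orthonormal_basis (g p) (tangent A p) (map (\<lambda>U. U p) Us) \<Longrightarrow>
     ricci_frame A g nabla Us E F p = c * g p (E p) (F p)"
    unfolding einstein_def by blast
  \<comment> \<open>For the orthogonal pair \<open>X\<close>, \<open>Z\<close> the unknown Einstein
    constant drops out.\<close>
  from this[of X Z "[X, Y, Z, W]" undefined]
  have "ricci_frame A g nabla [X, Y, Z, W] X Z undefined = 0"
    using frame_basis by (simp add: frame_smooth)
  moreover have "ricci_frame A g nabla [X, Y, Z, W] X Z undefined = z2 * \<theta>1 / 2"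
  proof -
    \<comment> \<open>Second covariant derivatives mix frame fields with combinations; rewriting the
      frame fields as combinations brings every term under \<open>nabla_comb\<close>.\<close>
    have nab: "nabla X (comb a b c d) = nabla (comb 1 0 0 0) (comb a b c d)"
      "nabla Y (comb a b c d) = nabla (comb 0 1 0 0) (comb a b c d)"
      "nabla Z (comb a b c d) = nabla (comb 0 0 1 0) (comb a b c d)"
      "nabla W (comb a b c d) = nabla (comb 0 0 0 1) (comb a b c d)"
      "nabla (comb a b c d) Z = nabla (comb a b c d) (comb 0 0 1 0)" for a b c d
      by (simp_all flip: comb_frame)
    show ?thesis
      by (simp add: ricci_frame_def curvature_def bracket_comb nabla_frame nab nabla_comb)
  qed
  ultimately show False using assms by simp
qed

section \<open>The almost complex structure on the frame\<close>

context
  fixes J assumes J: "almost_hermitian A g J"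
    and J_frame: "appl J X = Y" "appl J Y = - X" "appl J Z = W" "appl J W = - Z"
begin

lemma J_comb: "J p (comb a b c d p) = comb (- b) a (- d) c p"
proof -
  have "J p (X p) = Y p" "J p (Y p) = - X p" "J p (Z p) = W p" "J p (W p) = - Z p"
    using J_frame by (auto simp: appl_def fun_eq_iff)
  then show ?thesis by (simp add: comb_apply J_add[OF J] J_scaleR[OF J] algebra_simps)
qed

lemma appl_comb: "appl J (comb a b c d) = comb (- b) a (- d) c"
  by (rule ext) (simp add: appl_def J_comb)

lemma nijenhuis_frame:
  assumes "E \<in> {X, Y, Z, W}" "F \<in> {X, Y, Z, W}"
  shows "nijenhuis A J E F = 0"
proof -
  have neg: "lie_bracket A (- E) F = - lie_bracket A E F" "lie_bracket A F (- E) = - lie_bracket A F E"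
    if "smooth_vfield A E" "smooth_vfield A F" for E F
    using that nabla_scaleR_left[of _ _ "-1"] nabla_scaleR_right[of _ _ "-1"]
    by (simp_all add: nabla_torsion smooth_vfield_minus)
  show ?thesis
    using assms
    by (auto simp: nijenhuis_def J_frame bracket_comb neg frame_smooth smooth_vfield_minus appl_comb
        simp flip: comb_zero)
qed

lemma nijenhuis_left_frame:
  assumes E: "smooth_vfield A E" and F: "smooth_vfield A F"
    and "\<And>K. K \<in> {X, Y, Z, W} \<Longrightarrow> nijenhuis A J K F = 0"
  shows "nijenhuis A J E F = 0"
proof -
  have z: "fscale f 0 = 0" for f by (simp add: fscale_def fun_eq_iff)
  show ?thesis
    by (subst frame_expansion[OF E])
       (simp add: nijenhuis_add_left[OF J] nijenhuis_fscale_left[OF J] F frame_smooth g_smooth[OF E]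
          smooth_vfield_fscale smooth_vfield_add assms(3) z)
qed

text \<open>Tensoriality is available in the left slot; antisymmetry exchanges the slots, so the
  reduction to the frame is applied twice.\<close>

lemma integrable_J: "integrable_structure A J"
  unfolding integrable_structure_def
proof (intro allI impI)
  fix E F assume "smooth_vfield A E \<and> smooth_vfield A F"
  then have E: "smooth_vfield A E" and F: "smooth_vfield A F" by auto
  show "nijenhuis A J E F = 0"
  proof (rule nijenhuis_left_frame[OF E F])
    fix K assume K: "K \<in> {X, Y, Z, W}"
    then have sK: "smooth_vfield A K" using frame_smooth by auto
    have "nijenhuis A J F K = 0"
      by (rule nijenhuis_left_frame[OF F sK nijenhuis_frame[OF _ K]])
    then show "nijenhuis A J K F = 0" using nijenhuis_antisym[OF J sK F] by simp
  qed
qed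

lemma not_kaehler:
  assumes "\<theta>1 \<noteq> 0" shows "\<not> kaehler A g nabla J"
proof
  assume "kaehler A g nabla J"
  then have "nabla X (appl J X) - appl J (nabla X X) = 0"
    unfolding kaehler_def using frame_smooth by blast
  then have "comb 0 0 (- \<theta>1 / 2) (- \<theta>2 / 2) = comb 0 0 0 0"
    by (simp add: J_frame nabla_frame appl_comb comb_zero)
  then have "comb 0 0 (- \<theta>1 / 2) (- \<theta>2 / 2) undefined = comb 0 0 0 0 undefined" by (rule fun_cong)
  then show False using assms by simp
qed

end

end

section \<open>Local potentials and leaves\<close>

context bracket_frame
begin

text \<open>Indexed by the numeral type so as to match \<open>smooth_dual_frame\<close>. In that
  type 4 equals 0, and the last branch catches it.\<close>

definition frame :: "4 \<Rightarrow> 'm vfield"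
  where "frame k = (if k = 1 then X else if k = 2 then Y else if k = 3 then Z else W)"

lemma frame_simps [simp]: "frame 1 = X" "frame 2 = Y" "frame 3 = Z" "frame 4 = W"
  by (simp_all add: frame_def)

lemma frame_field_smooth [simp]: "smooth_vfield A (frame k)"
  by (simp add: frame_def frame_smooth)

lemma coords_comb:
  "coords U \<phi> (comb a b c d) y = a *\<^sub>R coords U \<phi> X y + b *\<^sub>R coords U \<phi> Y y
    + c *\<^sub>R coords U \<phi> Z y + d *\<^sub>R coords U \<phi> W y"
  unfolding coords_def comb_apply mdiff_def
  by (simp add: scaleR_fun_def algebra_simps sum.distrib scaleR_sum_right)

text \<open>The coordinate vectors of the frame are independent because \<open>mdiff \<phi>\<close>
  is injective on tangent vectors. \<alpha> k is the k-th form of the dual coframe, written as a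
  covector in the chart.\<close>

lemma frame_dual:
  assumes c: "(U, \<phi>) \<in> A"
  obtains \<alpha> :: "4 \<Rightarrow> real ^ 4 \<Rightarrow> real ^ 4" where
    "\<And>k. Cinf_on (\<phi> ` U) (\<alpha> k)"
    "\<And>y w. y \<in> \<phi> ` U \<Longrightarrow> (\<Sum>k\<in>UNIV. (\<alpha> k y \<bullet> w) *\<^sub>R coords U \<phi> (frame k) y) = w"
    "\<And>y j k. y \<in> \<phi> ` U \<Longrightarrow> \<alpha> k y \<bullet> coords U \<phi> (frame j) y = (if j = k then 1 else 0)"
proof -
  have indep: "c = (\<lambda>_. 0)" if y: "y \<in> \<phi> ` U" and 0: "(\<Sum>j\<in>UNIV. c j *\<^sub>R coords U \<phi> (frame j) y) = 0"
    for y and c :: "4 \<Rightarrow> real"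
  proof -
    define p where "p = inv_into U \<phi> y"
    have p: "p \<in> U" using y by (auto simp: p_def inv_into_into)
    have "coords U \<phi> (comb (c 1) (c 2) (c 3) (c 4)) y = 0"
      using 0 by (simp add: sum_4 coords_comb)
    then have "mdiff \<phi> (comb (c 1) (c 2) (c 3) (c 4) p) = 0"
      by (simp add: coords_def p_def)
    then have "comb (c 1) (c 2) (c 3) (c 4) p = chart_tvec A U \<phi> p 0"
      using chart_tvec_mdiff[OF c p comb_tangent] by metis
    also have "\<dots> = 0" by (rule linear_0[OF linear_chart_tvec[OF c p]])
    also have "\<dots> = comb 0 0 0 0 p" by (simp add: comb_zero)
    finally have "c 1 = 0 \<and> c 2 = 0 \<and> c 3 = 0 \<and> c 4 = 0" by (simp only: comb_eq_iff)
    then show ?thesis by (simp add: fun_eq_iff forall_4)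
  qed
  show thesis
    by (rule smooth_dual_frame[OF chart_open(2)[OF c] Cinf_on_coords[OF c frame_field_smooth] indep])
       (assumption, assumption, rule that)
qed

context
  fixes U \<phi> \<alpha>
  assumes c: "(U, \<phi>) \<in> A"
    and \<alpha>_smooth: "\<And>k. Cinf_on (\<phi> ` U) (\<alpha> k)"
    and \<alpha>_expand: "\<And>y w. y \<in> \<phi> ` U \<Longrightarrow> (\<Sum>k\<in>UNIV. (\<alpha> k y \<bullet> w) *\<^sub>R coords U \<phi> (frame k) y) = w"
    and \<alpha>_dual: "\<And>y j k. y \<in> \<phi> ` U \<Longrightarrow> \<alpha> k y \<bullet> coords U \<phi> (frame j) y = (if j = k then 1 else (0::real))"
begin

text \<open>Translates between the Euclidean pairing in the chart and the Riemannian metric on the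
  manifold.\<close>

lemma dual_mdiff:
  assumes q: "q \<in> U" and v: "v \<in> tangent A q"
  shows "\<alpha> k (\<phi> q) \<bullet> mdiff \<phi> v = g q v (frame k q)"
proof -
  have y: "\<phi> q \<in> \<phi> ` U" using q by auto
  have "mdiff \<phi> v = coords U \<phi> (comb (g q v (X q)) (g q v (Y q)) (g q v (Z q)) (g q v (W q))) (\<phi> q)"
    using tangent_comb[OF v] by (simp add: coords_def chart_inv[OF c q])
  moreover have "\<forall>k. \<alpha> k (\<phi> q) \<bullet> coords U \<phi> (comb a b c' d) (\<phi> q)
      = (if k = 1 then a else if k = 2 then b else if k = 3 then c' else d)" for a b c' d
    using \<alpha>_dual[OF y, of _ 1] \<alpha>_dual[OF y, of _ 2] \<alpha>_dual[OF y, of _ 3] \<alpha>_dual[OF y, of _ 4]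
    by (simp add: forall_4 coords_comb inner_add_right)
  ultimately show ?thesis by (simp add: frame_def)
qed

text \<open>The structure equation in a chart. The pairings of \<alpha> k with the frame are
  constant, so differentiating them trades derivatives of \<alpha> k for derivatives of the frame,
  which assemble into the bracket.\<close>

lemma dual_structure:
  assumes y: "y \<in> \<phi> ` U"
  shows "frechet_derivative (\<alpha> k) (at y) (coords U \<phi> (frame i) y) \<bullet> coords U \<phi> (frame j) y
    - frechet_derivative (\<alpha> k) (at y) (coords U \<phi> (frame j) y) \<bullet> coords U \<phi> (frame i) y
    = - (\<alpha> k y \<bullet> coords U \<phi> (lie_bracket A (frame i) (frame j)) y)"
proof -
  have D: "frechet_derivative (\<alpha> k) (at y) v \<bullet> coords U \<phi> (frame j) y =
      - (\<alpha> k y \<bullet> frechet_derivative (coords U \<phi> (frame j)) (at y) v)" for j v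
  proof -
    have "((\<lambda>y. \<alpha> k y \<bullet> coords U \<phi> (frame j) y) has_derivative
        (\<lambda>v. \<alpha> k y \<bullet> frechet_derivative (coords U \<phi> (frame j)) (at y) v +
          frechet_derivative (\<alpha> k) (at y) v \<bullet> coords U \<phi> (frame j) y)) (at y)"
      by (rule has_derivative_inner[OF Cinf_on_has_derivative[OF \<alpha>_smooth y]
            Cinf_on_has_derivative[OF Cinf_on_coords[OF c frame_field_smooth] y]])
    moreover have "((\<lambda>y. \<alpha> k y \<bullet> coords U \<phi> (frame j) y) has_derivative (\<lambda>v. 0)) (at y)"
      by (rule has_derivative_transform_within_open[OF has_derivative_const chart_open(2)[OF c] y])
         (simp add: \<alpha>_dual)
    ultimately have "(\<lambda>v. \<alpha> k y \<bullet> frechet_derivative (coords U \<phi> (frame j)) (at y) v +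
          frechet_derivative (\<alpha> k) (at y) v \<bullet> coords U \<phi> (frame j) y) = (\<lambda>v. 0)"
      by (rule has_derivative_unique)
    from fun_cong[OF this, of v] show ?thesis by simp
  qed
  show ?thesis
    unfolding coords_lie_bracket[OF c frame_field_smooth frame_field_smooth y] D by (simp add: inner_diff_right)
qed

text \<open>Closedness is symmetry of a bilinear form, so it may be tested on the frame, where the
  structure equation applies.\<close>

lemma symmetric_on_frame:
  assumes y: "y \<in> \<phi> ` U" and D: "linear D"
    and sym: "\<And>i j. D (coords U \<phi> (frame i) y) \<bullet> coords U \<phi> (frame j) y =
      D (coords U \<phi> (frame j) y) \<bullet> coords U \<phi> (frame i) y"
  shows "D v \<bullet> w = D w \<bullet> v"
proof -
  let ?\<xi> = "\<lambda>k. coords U \<phi> (frame k) y"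
  have expand: "D v \<bullet> w = (\<Sum>i\<in>UNIV. \<Sum>j\<in>UNIV. (\<alpha> i y \<bullet> v) * (\<alpha> j y \<bullet> w) * (D (?\<xi> i) \<bullet> ?\<xi> j))" for v w
  proof -
    have "D v \<bullet> w = D (\<Sum>i\<in>UNIV. (\<alpha> i y \<bullet> v) *\<^sub>R ?\<xi> i) \<bullet> (\<Sum>j\<in>UNIV. (\<alpha> j y \<bullet> w) *\<^sub>R ?\<xi> j)"
      by (simp only: \<alpha>_expand[OF y])
    also have "\<dots> = (\<Sum>i\<in>UNIV. \<Sum>j\<in>UNIV. (\<alpha> i y \<bullet> v) * (\<alpha> j y \<bullet> w) * (D (?\<xi> i) \<bullet> ?\<xi> j))"
      by (simp add: linear_sum[OF D] linear_cmul[OF D] inner_sum_left inner_sum_right sum_distrib_left mult_ac)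
         (rule trans[OF sum.swap], intro sum.cong refl, simp)
    finally show ?thesis .
  qed
  show ?thesis
    unfolding expand[of v w] expand[of w v]
    by (rule trans[OF sum.swap]) (intro sum.cong refl, simp only: sym mult.commute)
qed

text \<open>The form dual to \<open>Y\<close> is closed, hence locally \<open>dh\<close>, and \<open>exp (2 z2 h)\<close> is an integrating factor
  of the form dual to \<open>X\<close>.\<close>

lemma dual_potentials:
  assumes z2: "z2 \<noteq> 0" and B: "ball x0 r \<subseteq> \<phi> ` U"
  obtains f1 f2 l where "Cinf_on (ball x0 r) f1" "Cinf_on (ball x0 r) f2" "\<And>y. l y > 0"
    "\<And>y. y \<in> ball x0 r \<Longrightarrow> (f1 has_derivative (\<lambda>w. l y * (\<alpha> 1 y \<bullet> w))) (at y)"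
    "\<And>y. y \<in> ball x0 r \<Longrightarrow> (f2 has_derivative (\<lambda>w. l y * (\<alpha> 2 y \<bullet> w))) (at y)"
proof -
  let ?B = "ball x0 r"
  note sm = Cinf_on_subset[OF \<alpha>_smooth B]
  have yU: "y \<in> \<phi> ` U" if "y \<in> ?B" for y using that B by auto
  have D\<alpha>: "(\<alpha> k has_derivative frechet_derivative (\<alpha> k) (at y)) (at y)" if "y \<in> ?B" for k y
    by (rule Cinf_on_has_derivative[OF sm that])
  have dual: "\<alpha> k y \<bullet> coords U \<phi> (comb a b c' d) y
      = (if k = 1 then a else if k = 2 then b else if k = 3 then c' else d)" if "y \<in> ?B" for k y a b c' d
  proof -
    have "\<forall>k. \<alpha> k y \<bullet> coords U \<phi> (comb a b c' d) y
        = (if k = 1 then a else if k = 2 then b else if k = 3 then c' else d)"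
      using \<alpha>_dual[OF yU[OF that], of _ 1] \<alpha>_dual[OF yU[OF that], of _ 2]
        \<alpha>_dual[OF yU[OF that], of _ 3] \<alpha>_dual[OF yU[OF that], of _ 4]
      by (simp add: forall_4 coords_comb inner_add_right)
    then show ?thesis by blast
  qed
  \<comment> \<open>No structure constant has a \<open>Y\<close> component, so the second coframe
    form is closed.\<close>
  have no_Y: "\<forall>i j. \<alpha> 2 y \<bullet> coords U \<phi> (lie_bracket A (frame i) (frame j)) y = 0" if "y \<in> ?B" for y
    by (simp add: forall_4 bracket_comb dual[OF that])
  have closed2: "frechet_derivative (\<alpha> 2) (at y) v \<bullet> w = frechet_derivative (\<alpha> 2) (at y) w \<bullet> v"
    if "y \<in> ?B" for y v w
  proof (rule symmetric_on_frame[OF yU[OF that] has_derivative_linear[OF D\<alpha>[OF that]]])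
    fix i j
    show "frechet_derivative (\<alpha> 2) (at y) (coords U \<phi> (frame i) y) \<bullet> coords U \<phi> (frame j) y =
        frechet_derivative (\<alpha> 2) (at y) (coords U \<phi> (frame j) y) \<bullet> coords U \<phi> (frame i) y"
      using dual_structure[OF yU[OF that], of 2 i j] no_Y[OF that, rule_format, of i j] by simp
  qed
  obtain h where h: "\<And>y. y \<in> ?B \<Longrightarrow> (h has_derivative (\<lambda>w. \<alpha> 2 y \<bullet> w)) (at y)"
    by (rule poincare_lemma[OF sm closed2]) (assumption, rule that)
  have h_smooth: "Cinf_on ?B h"
    by (rule Cinf_onI_derivative[OF open_ball h Cinf_on_inner_const[OF open_ball sm]])
  \<comment> \<open>The exponent is chosen so that dl is 2 z2 l times the form dual to
    \<open>Y\<close>, cancelling the exterior derivative of the form dual to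
    \<open>X\<close>.\<close>
  define l where "l y = exp (2 * z2 * h y)" for y
  have l_smooth: "Cinf_on ?B l"
    unfolding l_def[abs_def]
    by (rule Cinf_on_compose[OF open_ball open_UNIV _ Cinf_on_mult[OF open_ball Cinf_on_const[OF open_ball] h_smooth]
          Cinf_on_exp]) auto
  have l: "(l has_derivative (\<lambda>w. 2 * z2 * l y * (\<alpha> 2 y \<bullet> w))) (at y)" if "y \<in> ?B" for y
    unfolding l_def[abs_def] by (auto intro!: derivative_eq_intros h that)
  let ?a = "\<lambda>y. l y *\<^sub>R \<alpha> 1 y"
  let ?Da = "\<lambda>y v. l y *\<^sub>R frechet_derivative (\<alpha> 1) (at y) v + (2 * z2 * l y * (\<alpha> 2 y \<bullet> v)) *\<^sub>R \<alpha> 1 y"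
  have a_smooth: "Cinf_on ?B ?a" by (rule Cinf_on_scaleR[OF open_ball l_smooth sm])
  have Da: "(?a has_derivative ?Da y) (at y)" if "y \<in> ?B" for y
    by (rule has_derivative_scaleR[OF l[OF that] D\<alpha>[OF that]])
  have sym_a: "frechet_derivative ?a (at y) v \<bullet> w = frechet_derivative ?a (at y) w \<bullet> v"
    if y: "y \<in> ?B" for y v w
  proof -
    let ?\<xi> = "\<lambda>k. coords U \<phi> (frame k) y"
    \<comment> \<open>The \<open>X\<close> component of a bracket of frame fields as a wedge product
      evaluated on them; only the pair \<open>X\<close>, \<open>Y\<close> contributes.\<close>
    have bracket: "\<forall>i j. \<alpha> 1 y \<bullet> coords U \<phi> (lie_bracket A (frame i) (frame j)) y =
        2 * z2 * ((\<alpha> 2 y \<bullet> ?\<xi> i) * (\<alpha> 1 y \<bullet> ?\<xi> j) - (\<alpha> 2 y \<bullet> ?\<xi> j) * (\<alpha> 1 y \<bullet> ?\<xi> i))"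
      unfolding \<alpha>_dual[OF yU[OF y]] by (simp add: forall_4 bracket_comb dual[OF y])
    have "?Da y v \<bullet> w = ?Da y w \<bullet> v"
    proof (rule symmetric_on_frame[OF yU[OF y] has_derivative_linear[OF Da[OF y]]])
      fix i j
      have "?Da y (?\<xi> i) \<bullet> ?\<xi> j - ?Da y (?\<xi> j) \<bullet> ?\<xi> i
        = l y * (frechet_derivative (\<alpha> 1) (at y) (?\<xi> i) \<bullet> ?\<xi> j - frechet_derivative (\<alpha> 1) (at y) (?\<xi> j) \<bullet> ?\<xi> i)
          + l y * (2 * z2 * ((\<alpha> 2 y \<bullet> ?\<xi> i) * (\<alpha> 1 y \<bullet> ?\<xi> j) - (\<alpha> 2 y \<bullet> ?\<xi> j) * (\<alpha> 1 y \<bullet> ?\<xi> i)))"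
        by (simp add: inner_add_left algebra_simps)
      also have "\<dots> = 0"
        unfolding dual_structure[OF yU[OF y]] bracket[rule_format] by simp
      finally show "?Da y (?\<xi> i) \<bullet> ?\<xi> j = ?Da y (?\<xi> j) \<bullet> ?\<xi> i" by simp
    qed
    moreover have "frechet_derivative ?a (at y) = ?Da y"
      using frechet_derivative_at[OF Da[OF y]] by simp
    ultimately show ?thesis by simp
  qed
  obtain f1 where f1: "\<And>y. y \<in> ?B \<Longrightarrow> (f1 has_derivative (\<lambda>w. ?a y \<bullet> w)) (at y)"
    by (rule poincare_lemma[OF a_smooth sym_a]) (assumption, rule that)
  \<comment> \<open>Normalised so that the differentials of f1 and f2 carry the same factor
    l.\<close>
  define f2 where "f2 y = l y / (2 * z2)" for y
  have f2: "(f2 has_derivative (\<lambda>w. l y * (\<alpha> 2 y \<bullet> w))) (at y)" if "y \<in> ?B" for y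
    unfolding f2_def[abs_def] using z2 by (auto intro!: derivative_eq_intros l that)
  show thesis
  proof (rule that)
    show "Cinf_on ?B f1"
      by (rule Cinf_onI_derivative[OF open_ball f1 Cinf_on_inner_const[OF open_ball a_smooth]])
    show "Cinf_on ?B f2"
      unfolding f2_def[abs_def] divide_inverse
      by (rule Cinf_on_mult[OF open_ball l_smooth Cinf_on_const[OF open_ball]])
    show "l y > 0" for y by (simp add: l_def)
  qed (use f1 f2 in auto)
qed

end

end

section \<open>Local submersions whose fibres are the leaves\<close>

context bracket_frame
begin

text \<open>Common source of integrability and of the holomorphic map. The last property, that
  fibres are contained in leaves, is the one that restricts the choice of U.\<close>

lemma local_submersion:
  assumes z2: "z2 \<noteq> 0"
  obtains U f1 f2 l where "open U" "p \<in> U" "smooth_on A U f1" "smooth_on A U f2" "\<And>q. l q > 0"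
    "\<And>q v. q \<in> U \<Longrightarrow> v \<in> tangent A q \<Longrightarrow> v f1 = l q * g q v (X q)"
    "\<And>q v. q \<in> U \<Longrightarrow> v \<in> tangent A q \<Longrightarrow> v f2 = l q * g q v (Y q)"
    "\<And>q x. q \<in> U \<Longrightarrow> x \<in> U \<Longrightarrow> f1 x = f1 q \<Longrightarrow> f2 x = f2 q \<Longrightarrow> x \<in> leaf_in A Vd U q"
proof -
  obtain U \<phi> where c: "(U, \<phi>) \<in> A" and p: "p \<in> U" by (rule chart_at)
  obtain \<alpha> where \<alpha>: "\<And>k. Cinf_on (\<phi> ` U) (\<alpha> k)"
    "\<And>y w. y \<in> \<phi> ` U \<Longrightarrow> (\<Sum>k\<in>UNIV. (\<alpha> k y \<bullet> w) *\<^sub>R coords U \<phi> (frame k) y) = w"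
    "\<And>y j k. y \<in> \<phi> ` U \<Longrightarrow> \<alpha> k y \<bullet> coords U \<phi> (frame j) y = (if j = k then 1 else 0)"
    by (rule frame_dual[OF c]) (rule that)
  define y0 where "y0 = \<phi> p"
  have y0: "y0 \<in> \<phi> ` U" using p by (simp add: y0_def)
  obtain r where r: "r > 0" "ball y0 r \<subseteq> \<phi> ` U"
    using chart_open(2)[OF c] y0 open_contains_ball by blast
  let ?B = "ball y0 r"
  obtain f1 f2 :: "real ^ 4 \<Rightarrow> real" and l where f: "Cinf_on ?B f1" "Cinf_on ?B f2" and l: "\<And>y. l y > 0"
    and f1: "\<And>y. y \<in> ?B \<Longrightarrow> (f1 has_derivative (\<lambda>w. l y * (\<alpha> 1 y \<bullet> w))) (at y)"
    and f2: "\<And>y. y \<in> ?B \<Longrightarrow> (f2 has_derivative (\<lambda>w. l y * (\<alpha> 2 y \<bullet> w))) (at y)"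
    by (rule dual_potentials[OF c \<alpha> z2 r(2)]) (assumption | rule that)+
  \<comment> \<open>The two potentials are completed by linear functions with the covectors \<alpha>
    3 y0 and \<alpha> 4 y0. At y0 the derivative then consists of the coframe, with two rows scaled
    by l > 0, so it is injective.\<close>
  define F :: "real ^ 4 \<Rightarrow> real ^ 4" where
    "F y = (\<chi> k. if k = 1 then f1 y else if k = 2 then f2 y else y \<bullet> \<alpha> k y0)" for y
  have F_smooth: "Cinf_on ?B F"
    unfolding F_def[abs_def]
  proof (rule Cinf_on_vec_lambda[OF open_ball])
    have id: "Cinf_on ?B (\<lambda>y. y)"
      by (rule Cinf_onI_derivative[OF open_ball has_derivative_ident Cinf_on_const[OF open_ball]])
    show "Cinf_on ?B (\<lambda>y. if k = 1 then f1 y else if k = 2 then f2 y else y \<bullet> \<alpha> k y0)" for k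
      using f Cinf_on_inner_const[OF open_ball id] by (cases "k = 1"; cases "k = 2") simp_all
  qed
  have DF: "frechet_derivative F (at y) w =
      (\<chi> k. if k = 1 then l y * (\<alpha> 1 y \<bullet> w) else if k = 2 then l y * (\<alpha> 2 y \<bullet> w) else w \<bullet> \<alpha> k y0)"
    if y: "y \<in> ?B" for y w
  proof -
    have "(F has_derivative frechet_derivative F (at y)) (at y)"
      by (rule Cinf_on_has_derivative[OF F_smooth y])
    then have k: "((\<lambda>y. F y $ k) has_derivative (\<lambda>w. frechet_derivative F (at y) w $ k)) (at y)" for k
      by (rule bounded_linear.has_derivative[OF bounded_linear_vec_nth])
    have k': "((\<lambda>y. F y $ k) has_derivative (\<lambda>w. if k = 1 then l y * (\<alpha> 1 y \<bullet> w)
        else if k = 2 then l y * (\<alpha> 2 y \<bullet> w) else w \<bullet> \<alpha> k y0)) (at y)" for k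
      using f1[OF y] f2[OF y] has_derivative_inner_left[OF has_derivative_ident]
      by (cases "k = 1"; cases "k = 2") (simp_all add: F_def)
    have "frechet_derivative F (at y) w $ k = (if k = 1 then l y * (\<alpha> 1 y \<bullet> w)
        else if k = 2 then l y * (\<alpha> 2 y \<bullet> w) else w \<bullet> \<alpha> k y0)" for k
      using has_derivative_unique[OF k k'] by (rule fun_cong)
    then show ?thesis by (simp add: vec_eq_iff)
  qed
  have y0B: "y0 \<in> ?B" using r by simp
  have inj: "w = 0" if "frechet_derivative F (at y0) w = 0" for w
  proof -
    have "\<forall>k. \<alpha> k y0 \<bullet> w = 0"
      using that l[of y0] unfolding DF[OF y0B] by (simp add: vec_eq_iff forall_4 inner_commute)
    then show ?thesis using \<alpha>(2)[OF y0, of w] by simp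
  qed
  obtain U0 s G G' where U0: "open U0" "y0 \<in> U0" "U0 \<subseteq> ?B"
    and hom: "homeomorphism U0 (ball (F y0) s) F G"
    and G: "\<And>z. z \<in> ball (F y0) s \<Longrightarrow> (G has_derivative G' z) (at z)"
    and G': "\<And>z w. z \<in> ball (F y0) s \<Longrightarrow> frechet_derivative F (at (G z)) (G' z w) = w"
    by (rule local_diffeo_onto_ball[OF open_ball y0B F_smooth inj]) (assumption | rule that)+
  have U0U: "U0 \<subseteq> \<phi> ` U" using U0 r by blast
  \<comment> \<open>The domain is exactly the part that F maps onto a ball, so segments in the ball
    lift to curves that stay in V.\<close>
  define V where "V = U \<inter> \<phi> -` U0"
  have V_open: "open V" unfolding V_def by (rule open_chart_preimage[OF c U0(1)])
  have dual: "\<alpha> k (\<phi> q) \<bullet> mdiff \<phi> v = g q v (frame k q)" if "q \<in> V" "v \<in> tangent A q" for k q v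
    by (rule dual_mdiff[OF c \<alpha>]) (use that in \<open>auto simp: V_def\<close>)
  have smooth: "smooth_on A V (\<lambda>x. h (\<phi> x))" if "Cinf_on ?B h" for h :: "real ^ 4 \<Rightarrow> real"
    unfolding V_def by (rule smooth_on_compose_chart[OF c U0(1) U0U Cinf_on_subset[OF that U0(3)]])
  have apply_pullback: "v (\<lambda>x. h (\<phi> x)) = D (mdiff \<phi> v)"
    if q: "q \<in> V" and v: "v \<in> tangent A q" and h: "Cinf_on ?B h" and D: "(h has_derivative D) (at (\<phi> q))"
    for q v D and h :: "real ^ 4 \<Rightarrow> real"
  proof -
    have qU: "q \<in> U" using q by (simp add: V_def)
    have near: "smooth_near A q (\<lambda>x. h (\<phi> x))"
      unfolding smooth_near_def using smooth[OF h] q by blast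
    have "((\<lambda>y. h (\<phi> (inv_into U \<phi> y))) has_derivative D) (at (\<phi> q))"
      by (rule has_derivative_transform_within_open[OF D chart_open(2)[OF c]])
         (use qU in \<open>auto simp: f_inv_into_f\<close>)
    from tangent_apply[OF c qU v near this] show ?thesis .
  qed
  have \<phi>B: "\<phi> q \<in> ?B" if "q \<in> V" for q using that U0 by (auto simp: V_def)
  have leaf: "x \<in> leaf_in A Vd V q"
    if q: "q \<in> V" and x: "x \<in> V" and eq: "f1 (\<phi> x) = f1 (\<phi> q)" "f2 (\<phi> x) = f2 (\<phi> q)" for q x
  proof -
    let ?a = "F (\<phi> q)" and ?b = "F (\<phi> x)"
    define d where "d = ?b - ?a"
    \<comment> \<open>The first two coordinates agree at both ends, hence along the segment; its
      lift joins q to x inside one fibre.\<close>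
    define line where "line t = ?a + t *\<^sub>R d" for t :: real
    define \<gamma> where "\<gamma> t = inv_into U \<phi> (G (line t))" for t
    have GF: "G (F y) = y" if "y \<in> U0" for y using hom that by (simp add: homeomorphism_def)
    have ends: "\<gamma> 0 = q" "\<gamma> 1 = x"
      using q x by (simp_all add: \<gamma>_def line_def d_def V_def GF chart_inv[OF c])
    have ab: "?a \<in> ball (F y0) s" "?b \<in> ball (F y0) s"
      using hom q x by (auto simp: V_def homeomorphism_def)
    have line_in: "line t \<in> ball (F y0) s" if "t \<in> {0..1}" for t
    proof -
      have "(1 - t) *\<^sub>R ?a + t *\<^sub>R ?b \<in> ball (F y0) s"
        using convexD_alt[OF convex_ball ab] that by auto
      then show ?thesis by (simp add: line_def d_def algebra_simps)
    qed
    have G_in: "G (line t) \<in> U0" if "t \<in> {0..1}" for t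
      using hom line_in[OF that] by (auto simp: homeomorphism_def)
    have \<phi>\<gamma>: "\<phi> (\<gamma> t) = G (line t)" "\<gamma> t \<in> V" if "t \<in> {0..1}" for t
    proof -
      have im: "G (line t) \<in> \<phi> ` U" using G_in[OF that] U0U by auto
      then show "\<phi> (\<gamma> t) = G (line t)" by (simp add: \<gamma>_def f_inv_into_f)
      then show "\<gamma> t \<in> V" using G_in[OF that] inv_into_into[OF im] by (simp add: V_def \<gamma>_def)
    qed
    have line_cont: "continuous_on {0..1} line" unfolding line_def by (intro continuous_intros)
    have "continuous_on {0..1} (\<lambda>t. G (line t))"
      by (rule continuous_on_compose2[OF _ line_cont, of "ball (F y0) s"])
         (use hom line_in in \<open>auto simp: homeomorphism_def\<close>)
    then have \<gamma>_cont: "continuous_on {0..1} \<gamma>"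
      unfolding \<gamma>_def[abs_def]
      by (rule continuous_on_compose2[OF chart_continuous(2)[OF c]]) (use G_in U0U in auto)
    have tangent_curve: "\<exists>v\<in>Vd (\<gamma> t). \<forall>f. smooth_near A (\<gamma> t) f \<longrightarrow>
        ((\<lambda>s. f (\<gamma> s)) has_real_derivative v f) (at t within {0..1})" if t: "t \<in> {0..1}" for t
    proof -
      have \<gamma>U: "\<gamma> t \<in> U" using \<phi>\<gamma>[OF t] by (simp add: V_def)
      \<comment> \<open>The coordinate velocity of the lift. The derivative of F sends it to d,
        whose first two entries are 0, so the forms dual to \<open>X\<close> and \<open>Y\<close>
        annihilate it and the velocity is vertical.\<close>
      define w where "w = G' (line t) d"
      define v where "v = chart_tvec A U \<phi> (\<gamma> t) w"
      have v: "v \<in> tangent A (\<gamma> t)" unfolding v_def tangent_eq_range[OF c \<gamma>U] by blast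
      have v_mdiff: "mdiff \<phi> v = w" unfolding v_def by (rule mdiff_chart_tvec[OF c \<gamma>U])
      have "frechet_derivative F (at (\<phi> (\<gamma> t))) w = d"
        using G'[OF line_in[OF t]] by (simp add: w_def \<phi>\<gamma>[OF t])
      then have dF: "frechet_derivative F (at (\<phi> (\<gamma> t))) w $ k = d $ k" for k by simp
      have "d $ 1 = 0" "d $ 2 = 0" using eq by (simp_all add: d_def F_def)
      then have "\<alpha> 1 (\<phi> (\<gamma> t)) \<bullet> w = 0" "\<alpha> 2 (\<phi> (\<gamma> t)) \<bullet> w = 0"
        using dF[of 1] dF[of 2] l[of "\<phi> (\<gamma> t)"] by (simp_all add: DF[OF \<phi>B[OF \<phi>\<gamma>(2)[OF t]]])
      then have "v \<in> Vd (\<gamma> t)"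
        using dual[OF \<phi>\<gamma>(2)[OF t] v, of 1] dual[OF \<phi>\<gamma>(2)[OF t] v, of 2] v
        by (simp add: Vd_iff v_mdiff)
      moreover have "((\<lambda>s. f (\<gamma> s)) has_real_derivative v f) (at t within {0..1})"
        if near: "smooth_near A (\<gamma> t) f" for f
      proof -
        let ?D = "\<lambda>w. chart_tvec A U \<phi> (\<gamma> t) w f"
        have dline: "(line has_derivative (\<lambda>h. h *\<^sub>R d)) (at t within {0..1})"
          unfolding line_def[abs_def] by (auto intro!: derivative_eq_intros)
        have dG: "((\<lambda>s. G (line s)) has_derivative (\<lambda>h. G' (line t) (h *\<^sub>R d))) (at t within {0..1})"
          by (rule has_derivative_compose[OF dline G[OF line_in[OF t]]])
        have df: "((\<lambda>y. f (inv_into U \<phi> y)) has_derivative ?D) (at (G (line t)))"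
          using smooth_near_has_derivative[OF c \<gamma>U near] by (simp add: \<phi>\<gamma>[OF t])
        have "((\<lambda>s. f (\<gamma> s)) has_derivative (\<lambda>h. ?D (G' (line t) (h *\<^sub>R d)))) (at t within {0..1})"
          unfolding \<gamma>_def by (rule has_derivative_compose[OF dG df[unfolded \<gamma>_def]])
        moreover have "(\<lambda>h. ?D (G' (line t) (h *\<^sub>R d))) = (*) (v f)"
        proof
          fix h
          show "?D (G' (line t) (h *\<^sub>R d)) = v f * h"
            using linear_cmul[OF has_derivative_linear[OF G[OF line_in[OF t]]], of h d]
              linear_cmul[OF has_derivative_linear[OF df], of h w]
            by (simp add: w_def v_def)
        qed
        ultimately show ?thesis by (simp add: has_field_derivative_def)
      qed
      ultimately show ?thesis by blast
    qed
    show ?thesis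
      unfolding leaf_in_def
    proof (intro CollectI exI conjI)
      show "path \<gamma>" using \<gamma>_cont by (simp add: path_def)
      show "path_image \<gamma> \<subseteq> V" using \<phi>\<gamma>(2) by (auto simp: path_image_def)
      show "\<forall>t\<in>{0..1}. \<exists>v\<in>Vd (\<gamma> t). \<forall>f. smooth_near A (\<gamma> t) f \<longrightarrow>
        ((\<lambda>s. f (\<gamma> s)) has_real_derivative v f) (at t within {0..1})"
        using tangent_curve by blast
    qed (simp_all add: pathstart_def pathfinish_def ends)
  qed
  show thesis
  proof (rule that[of V "\<lambda>x. f1 (\<phi> x)" "\<lambda>x. f2 (\<phi> x)" "\<lambda>x. l (\<phi> x)"])
    show "p \<in> V" using p U0 by (simp add: V_def y0_def)
    fix q v assume q: "q \<in> V" and v: "v \<in> tangent A q"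
    show "v (\<lambda>x. f1 (\<phi> x)) = l (\<phi> q) * g q v (X q)"
      using apply_pullback[OF q v f(1) f1[OF \<phi>B[OF q]]] dual[OF q v, of 1] by simp
    show "v (\<lambda>x. f2 (\<phi> x)) = l (\<phi> q) * g q v (Y q)"
      using apply_pullback[OF q v f(2) f2[OF \<phi>B[OF q]]] dual[OF q v, of 2] by simp
  qed (use V_open smooth[OF f(1)] smooth[OF f(2)] l leaf in auto)
qed

lemma integrable_Vd:
  assumes "z2 \<noteq> 0" shows "integrable_distribution A Vd"
  unfolding integrable_distribution_def
proof
  fix p
  obtain U f1 f2 l where U: "open U" "p \<in> U" "smooth_on A U f1" "smooth_on A U f2" and l: "\<And>q. l q > 0"
    and f: "\<And>q v. q \<in> U \<Longrightarrow> v \<in> tangent A q \<Longrightarrow> v f1 = l q * g q v (X q)"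
    "\<And>q v. q \<in> U \<Longrightarrow> v \<in> tangent A q \<Longrightarrow> v f2 = l q * g q v (Y q)"
    by (rule local_submersion[OF assms]) (assumption | rule that)+
  have l0: "l q \<noteq> 0" for q using l[of q] by simp
  show "\<exists>U fs. p \<in> U \<and> (\<forall>f\<in>set fs. smooth_on A U f) \<and> open U \<and>
     (\<forall>q\<in>U. (\<forall>c::nat \<Rightarrow> real. \<exists>v\<in>tangent A q. \<forall>i<length fs. v (fs ! i) = c i) \<and>
        Vd q = {v \<in> tangent A q. \<forall>f\<in>set fs. v f = 0})"
  proof (intro exI[of _ U] exI[of _ "[f1, f2]"] conjI ballI allI)
    fix q and c :: "nat \<Rightarrow> real" assume q: "q \<in> U"
    show "\<exists>v\<in>tangent A q. \<forall>i<length [f1, f2]. v ([f1, f2] ! i) = c i"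
      by (rule bexI[of _ "comb (c 0 / l q) (c 1 / l q) 0 0 q"])
         (use l0[of q] in \<open>auto simp: less_Suc_eq f[OF q comb_tangent]\<close>)
  next
    fix q assume q: "q \<in> U"
    show "Vd q = {v \<in> tangent A q. \<forall>f\<in>set [f1, f2]. v f = 0}"
      using l0[of q] by (auto simp: Vd_iff f[OF q])
  qed (use U in auto)
qed

lemma mdiff_complex: "mdiff \<phi> v = Complex (v (\<lambda>x. Re (\<phi> x))) (v (\<lambda>x. Im (\<phi> x)))"
  by (simp add: mdiff_def Basis_complex_def complex_eq_iff)

text \<open>The differential is l times the \<open>X\<close> component plus i times the
  \<open>Y\<close> component. Its kernel is \<open>Vd\<close>, and on the horizontal space it is an
  isometry scaled by l.\<close>

lemma holomorphic_Vd:
  assumes z2: "z2 \<noteq> 0" and J: "almost_hermitian A g J"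
    and J_frame: "appl J X = Y" "appl J Y = - X" "appl J Z = W" "appl J W = - Z"
  shows "holomorphic_foliation A g J Vd"
  unfolding holomorphic_foliation_def
proof
  fix p
  obtain U f1 f2 l where U: "open U" "p \<in> U" "smooth_on A U f1" "smooth_on A U f2" and l: "\<And>q. l q > 0"
    and f: "\<And>q v. q \<in> U \<Longrightarrow> v \<in> tangent A q \<Longrightarrow> v f1 = l q * g q v (X q)"
    "\<And>q v. q \<in> U \<Longrightarrow> v \<in> tangent A q \<Longrightarrow> v f2 = l q * g q v (Y q)"
    and leaf: "\<And>q x. q \<in> U \<Longrightarrow> x \<in> U \<Longrightarrow> f1 x = f1 q \<Longrightarrow> f2 x = f2 q \<Longrightarrow> x \<in> leaf_in A Vd U q"
    by (rule local_submersion[OF z2]) (assumption | rule that)+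
  have l0: "l q \<noteq> 0" for q using l[of q] by simp
  define \<phi> where "\<phi> x = Complex (f1 x) (f2 x)" for x
  have d\<phi>: "mdiff \<phi> v = Complex (l q * g q v (X q)) (l q * g q v (Y q))"
    if "q \<in> U" "v \<in> tangent A q" for q v
    using f[OF that] by (simp add: mdiff_complex \<phi>_def)
  have smooth: "smooth_on A U \<phi>"
  proof (rule smooth_onI[OF U(1)])
    fix V \<psi> assume c: "(V, \<psi>) \<in> A"
    note o = open_chart_image[OF c U(1)]
    have "Cinf_on (\<psi> ` (V \<inter> U)) (\<lambda>y. f1 (inv_into V \<psi> y) *\<^sub>R 1 + f2 (inv_into V \<psi> y) *\<^sub>R \<i>)"
      using smooth_on_chart[OF U(3) c] smooth_on_chart[OF U(4) c]
      by (intro Cinf_on_add Cinf_on_scaleR Cinf_on_const o)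
    then show "Cinf_on (\<psi> ` (V \<inter> U)) (\<lambda>y. \<phi> (inv_into V \<psi> y))"
      by (rule Cinf_on_cong[OF o, rotated]) (simp add: \<phi>_def complex_eq_iff)
  qed
  have Vd_ker: "{v \<in> tangent A q. mdiff \<phi> v = 0} = Vd q" if "q \<in> U" for q
    using l0[of q] by (auto simp: Vd_iff d\<phi>[OF that] complex_eq_iff)
  show "\<exists>U (\<phi> :: 'm \<Rightarrow> complex). open U \<and> p \<in> U \<and>
     submersion_on A U \<phi> \<and> horizontally_conformal_on A g U \<phi> \<and>
     (\<forall>q\<in>U. {x \<in> U. \<phi> x = \<phi> q} = leaf_in A Vd U q) \<and>
     (\<forall>q\<in>U. \<forall>v\<in>tangent A q. mdiff \<phi> (J q v) = \<i> * mdiff \<phi> v)"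
  proof (intro exI[of _ U] exI[of _ \<phi>] conjI ballI)
    show "submersion_on A U \<phi>"
      unfolding submersion_on_def
    proof (intro conjI smooth ballI)
      fix q assume q: "q \<in> U"
      have "z \<in> mdiff \<phi> ` tangent A q" for z
        by (rule image_eqI[of _ _ "comb (Re z / l q) (Im z / l q) 0 0 q"])
           (use l0[of q] in \<open>auto simp: d\<phi>[OF q] complex_eq_iff\<close>)
      then show "mdiff \<phi> ` tangent A q = UNIV" by auto
    qed
    show "horizontally_conformal_on A g U \<phi>"
      unfolding horizontally_conformal_on_def
    proof
      fix q assume q: "q \<in> U"
      have Hor: "ortho_complement A g (\<lambda>x. {v \<in> tangent A x. mdiff \<phi> v = 0}) q = Hd q"
        unfolding ortho_complement_def Vd_ker[OF q] by simp
      have "mdiff \<phi> v \<bullet> mdiff \<phi> w = (l q)\<^sup>2 * g q v w" if v: "v \<in> Hd q" and w: "w \<in> Hd q" for v w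
      proof -
        have t: "v \<in> tangent A q" "w \<in> tangent A q" using v w by (auto simp: Hd_iff)
        have "v = comb (g q v (X q)) (g q v (Y q)) 0 0 q" "w = comb (g q w (X q)) (g q w (Y q)) 0 0 q"
          using tangent_comb[OF t(1)] tangent_comb[OF t(2)] v w by (simp_all add: Hd_iff)
        then have "g q v w = g q v (X q) * g q w (X q) + g q v (Y q) * g q w (Y q)"
          by (metis g_comb add.right_neutral mult_zero_left)
        then show ?thesis
          by (simp add: d\<phi>[OF q t(1)] d\<phi>[OF q t(2)] inner_complex_def power2_eq_square algebra_simps)
      qed
      then show "\<exists>l>0. let Hor = ortho_complement A g (\<lambda>x. {v \<in> tangent A x. mdiff \<phi> v = 0}) q
          in \<forall>v\<in>Hor. \<forall>w\<in>Hor. mdiff \<phi> v \<bullet> mdiff \<phi> w = l\<^sup>2 * g q v w"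
        unfolding Hor Let_def using l[of q] by blast
    qed
  next
    fix q assume q: "q \<in> U"
    show "{x \<in> U. \<phi> x = \<phi> q} = leaf_in A Vd U q"
    proof
      show "{x \<in> U. \<phi> x = \<phi> q} \<subseteq> leaf_in A Vd U q"
        using leaf[OF q] by (auto simp: \<phi>_def)
      show "leaf_in A Vd U q \<subseteq> {x \<in> U. \<phi> x = \<phi> q}"
      proof
        fix x assume "x \<in> leaf_in A Vd U q"
        then obtain \<gamma> where \<gamma>: "path_image \<gamma> \<subseteq> U" "pathstart \<gamma> = q" "pathfinish \<gamma> = x"
          and d\<gamma>: "\<And>t. t \<in> {0..1} \<Longrightarrow> \<exists>v\<in>Vd (\<gamma> t). \<forall>f. smooth_near A (\<gamma> t) f \<longrightarrow>
            ((\<lambda>s. f (\<gamma> s)) has_real_derivative v f) (at t within {0..1})"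
          unfolding leaf_in_def by blast
        have \<gamma>U: "\<gamma> t \<in> U" if "t \<in> {0..1}" for t
          using \<gamma>(1) that by (auto simp: path_image_def)
        \<comment> \<open>A smooth function annihilated by \<open>Vd\<close> has zero derivative
          along a curve tangent to \<open>Vd\<close>. Applied to f1 and f2, this puts the leaf into
          the fibre.\<close>
        have const: "h x = h q" if h: "smooth_on A U h"
          and ker: "\<And>q v. q \<in> U \<Longrightarrow> v \<in> Vd q \<Longrightarrow> v h = 0" for h :: "'m \<Rightarrow> real"
        proof -
          have "((\<lambda>s. h (\<gamma> s)) has_real_derivative 0) (at t within {0..1})" if t: "t \<in> {0..1}" for t
          proof -
            have "smooth_near A (\<gamma> t) h" unfolding smooth_near_def using h \<gamma>U[OF t] by blast
            then show ?thesis using d\<gamma>[OF t] ker[OF \<gamma>U[OF t]] by metis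
          qed
          then have "\<exists>k. \<forall>t\<in>{0..1}. h (\<gamma> t) = k"
            using has_field_derivative_zero_constant[of "{0..1}" "\<lambda>s. h (\<gamma> s)"] by blast
          then have "h (\<gamma> 1) = h (\<gamma> 0)" by (metis atLeastAtMost_iff order_refl zero_le_one)
          then show ?thesis using \<gamma> by (simp add: pathstart_def pathfinish_def)
        qed
        have "f1 x = f1 q" "f2 x = f2 q"
          by (rule const[OF U(3)], simp add: f Vd_iff) (rule const[OF U(4)], simp add: f Vd_iff)
        then show "x \<in> {x \<in> U. \<phi> x = \<phi> q}"
          using \<gamma>U[of 1] \<gamma> by (simp add: \<phi>_def pathfinish_def)
      qed
    qed
  next
    fix q v assume q: "q \<in> U" and v: "v \<in> tangent A q"
    \<comment> \<open>J turns the horizontal components (x, y) into (-y, x), which is multiplication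
      of x + i y by i.\<close>
    have "J q v = comb (- g q v (Y q)) (g q v (X q)) (- g q v (W q)) (g q v (Z q)) q"
      using J_comb[OF J J_frame] tangent_comb[OF v] by metis
    then show "mdiff \<phi> (J q v) = \<i> * mdiff \<phi> v"
      by (simp add: d\<phi>[OF q v] d\<phi>[OF q comb_tangent] complex_eq_iff)
  qed (use U in auto)
qed

end

text \<open>The Jacobi sum is linear in its first slot and invariant under cyclic rotation, hence
  trilinear, so triples of spanning vectors decide it.\<close>

lemma lie_algebra_of_structure_constants:
  fixes br :: "'v::real_vector \<Rightarrow> 'v \<Rightarrow> 'v" and z2 \<theta>1 \<theta>2 :: real
  assumes span: "span {X, Y, Z, W} = UNIV" and bil: "bilinear br" and skew: "\<And>u v. br u v = - br v u"
    and br: "br Z X = (- 2 * z2) *\<^sub>R W" "br Z Y = z2 *\<^sub>R Z" "br W Y = (- z2) *\<^sub>R W"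
      "br Y X = (2 * z2) *\<^sub>R X + \<theta>1 *\<^sub>R Z + \<theta>2 *\<^sub>R W" "br W Z = 0" "br W X = 0"
  shows "lie_algebra br"
proof -
  have self: "br u u = 0" for u
  proof -
    have "2 *\<^sub>R br u u = 0" using skew[of u u] by (simp add: scaleR_2 add_eq_0_iff)
    then show ?thesis by simp
  qed
  define jac where "jac u v w = br u (br v w) + br v (br w u) + br w (br u v)" for u v w
  note rules = bilinear_ladd[OF bil] bilinear_radd[OF bil] bilinear_lmul[OF bil] bilinear_rmul[OF bil]
    bilinear_lzero[OF bil] bilinear_rzero[OF bil] bilinear_lneg[OF bil] bilinear_rneg[OF bil]
  have lin: "linear (\<lambda>u. jac u v w)" "jac u v w = jac v w u" for u v w
    by (intro linearI) (simp_all add: jac_def rules algebra_simps)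
  have br': "br X Z = (2 * z2) *\<^sub>R W" "br Y Z = (- z2) *\<^sub>R Z" "br Y W = z2 *\<^sub>R W"
    "br X Y = (- 2 * z2) *\<^sub>R X - \<theta>1 *\<^sub>R Z - \<theta>2 *\<^sub>R W" "br Z W = 0" "br X W = 0"
    using skew[of X Z] skew[of Y Z] skew[of Y W] skew[of X Y] skew[of Z W] skew[of X W]
    by (simp_all add: br)
  have frame: "jac u v w = 0" if "u \<in> {X, Y, Z, W}" "v \<in> {X, Y, Z, W}" "w \<in> {X, Y, Z, W}" for u v w
    using that by (auto simp: jac_def br br' self rules bilinear_rsub[OF bil] algebra_simps simp flip: scaleR_left.add)
  have step: "jac u v w = 0" if "\<And>u. u \<in> {X, Y, Z, W} \<Longrightarrow> jac u v w = 0" for u v w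
    using linear_eq_0_on_span[OF lin(1), of "{X, Y, Z, W}" v w u] that span by auto
  have "jac u v w = 0" for u v w
  proof -
    \<comment> \<open>Each round frees the first slot by linearity; rotation then brings a slot
      still restricted to the spanning set to the front.\<close>
    have 1: "jac u v w = 0" if "v \<in> {X, Y, Z, W}" "w \<in> {X, Y, Z, W}" for u v w
      by (rule step) (rule frame[OF _ that])
    have 2: "jac u v w = 0" if "w \<in> {X, Y, Z, W}" for u v w
      by (rule step) (metis lin(2) 1 that)
    show ?thesis by (rule step) (metis lin(2) 2)
  qed
  then show ?thesis
    unfolding lie_algebra_def jac_def using bil self by blast
qed

theorem mainTheorem1:
  fixes z2 \<theta>1 \<theta>2 :: real
    and br :: "'v::real_vector \<Rightarrow> 'v \<Rightarrow> 'v"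
    and X Y Z W :: 'v
  assumes "z2 \<noteq> 0" and "\<theta>1 \<noteq> 0" and "\<theta>2 \<noteq> 0"
    and "distinct [X, Y, Z, W]" and "independent {X, Y, Z, W}" and "span {X, Y, Z, W} = UNIV"
    and "bilinear br" and "\<And>u v. br u v = - br v u"
    and "br Z X = (- 2 * z2) *\<^sub>R W"
    and "br Z Y = z2 *\<^sub>R Z"
    and "br W Y = (- z2) *\<^sub>R W"
    and "br Y X = (2 * z2) *\<^sub>R X + \<theta>1 *\<^sub>R Z + \<theta>2 *\<^sub>R W"
    and "br W Z = 0" and "br W X = 0"
  shows "lie_algebra br \<and>
    (\<forall>(A :: ('g::{t2_space, second_countable_topology}, real ^ 4) atlas) mul e i L g nabla J V H.
       lie_group A mul e i \<and>
       lie_algebra_of_group_iso A mul br L \<and>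
       riemannian_metric A g \<and> left_invariant_metric A mul g \<and>
       (\<forall>p. orthonormal (g p) [L X p, L Y p, L Z p, L W p]) \<and>
       levi_civita A g nabla \<and>
       V = (\<lambda>p. span {L Z p, L W p}) \<and>
       H = ortho_complement A g V \<and>
       almost_hermitian A g J \<and> left_invariant_endo A mul J \<and>
       appl J (L X) = L Y \<and> appl J (L Y) = - L X \<and> appl J (L Z) = L W \<and> appl J (L W) = - L Z
     \<longrightarrow>
       (integrable_distribution A V \<and> conformal_foliation A g nabla V \<and>
        minimal_foliation A g nabla V \<and> has_codimension A V 2) \<and>
       (\<not> integrable_distribution A H \<and> \<not> totally_geodesic_foliation A g nabla V) \<and>
       (integrable_structure A J \<and> holomorphic_foliation A g J V) \<and>
       \<not> kaehler A g nabla J \<and>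
       \<not> einstein A g nabla)"
proof (rule conjI, goal_cases)
  case 1
  show ?case by (rule lie_algebra_of_structure_constants[OF assms(6-14)])
next
  case 2
  show ?case
  proof (intro allI impI, goal_cases)
    case main: (1 A mul e i L g nabla J V H)
    then have atlas: "smooth_atlas A" and iso: "lie_algebra_of_group_iso A mul br L"
      and riem: "riemannian_metric A g" and on: "\<And>p. orthonormal (g p) [L X p, L Y p, L Z p, L W p]"
      and lc: "levi_civita A g nabla" and V: "V = (\<lambda>p. span {L Z p, L W p})"
      and H: "H = ortho_complement A g V" and J: "almost_hermitian A g J"
      and JL: "appl J (L X) = L Y" "appl J (L Y) = - L X" "appl J (L Z) = L W" "appl J (L W) = - L Z"
      by (simp_all add: lie_group_def)
    from iso have lin: "linear L" and bij: "bij_betw L UNIV (left_invariant_vfields A mul)"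
      and bracket: "\<And>u v. lie_bracket A (L u) (L v) = L (br u v)"
      by (simp_all add: lie_algebra_of_group_iso_def)
    have "L u \<in> left_invariant_vfields A mul" for u
      using bij by (auto simp: bij_betw_def)
    then have smooth: "smooth_vfield A (L u)" for u
      by (simp add: left_invariant_vfields_def)
    \<comment> \<open>Left-invariant fields are smooth, and the isomorphism L carries the structure
      constants of \<open>br\<close> to brackets of vector fields.\<close>
    interpret bracket_frame A g nabla "L X" "L Y" "L Z" "L W" z2 \<theta>1 \<theta>2
    proof
      show "smooth_atlas A" by (rule atlas)
      show "riemannian_metric A g" by (rule riem)
      show "levi_civita A g nabla" by (rule lc)
      show "smooth_vfield A (L X)" "smooth_vfield A (L Y)" "smooth_vfield A (L Z)" "smooth_vfield A (L W)"
        by (rule smooth)+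
      show "orthonormal (g p) [L X p, L Y p, L Z p, L W p]" for p by (rule on)
      show "lie_bracket A (L Z) (L X) = (- 2 * z2) *\<^sub>R L W" "lie_bracket A (L Z) (L Y) = z2 *\<^sub>R L Z"
        "lie_bracket A (L W) (L Y) = (- z2) *\<^sub>R L W"
        "lie_bracket A (L Y) (L X) = (2 * z2) *\<^sub>R L X + \<theta>1 *\<^sub>R L Z + \<theta>2 *\<^sub>R L W"
        "lie_bracket A (L W) (L Z) = 0" "lie_bracket A (L W) (L X) = 0"
        unfolding bracket assms(9-14)
        by (simp_all only: linear_add[OF lin] linear_cmul[OF lin] linear_0[OF lin])
    qed
    show ?case
      unfolding H V
      by (intro conjI integrable_Vd conformal_Vd minimal_Vd codimension_Vd not_integrable_Hd
          not_totally_geodesic_Vd integrable_J[OF J JL] holomorphic_Vd[OF _ J JL]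
          not_kaehler[OF J JL] not_einstein assms(1,2))
  qed
qed

end
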